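(* Let $X_n$ be a locally convex space belonging to the class $\mathfrak M$ for each $n\in\mathbb Z_+$, and let $X=\bigoplus_{n=0}^\infty X_n$ be their locally convex direct sum. Then there is a hypercyclic operator on $X$.
   Context: Conventions: $\mathbb K$ is $\mathbb R$ or $\mathbb C$; all vector spaces are non-zero and over $\mathbb K$; all topological spaces are Hausdorff; $\mathbb Z_+=\{0,1,2,\dots\}$. The topology of a locally convex space $X$ is called weak if it coincides with $\sigma(X,Y)$ (the weakest topology making all functionals in $Y$ continuous) for some linear space $Y$ of linear functionals on $X$ separating points of $X$. A sequence $\{x_n\}_{n\in\mathbb Z_+}$ in a topological vector space $X$ is an $\ell_1$-sequence if $x_n\to0$ in $X$ and $\sum_{n=0}^\infty a_nx_n$ converges in $X$ for each $a\in\ell_1$. A locally convex space $X$ belongs to the class $\mathfrak M$ if its topology is not weak and there exists an $\ell_1$-sequence in $X$ with dense linear span. The locally convex direct sum $\bigoplus_n X_n$ is the algebraic direct sum endowed with the strongest locally convex topology which induces the original topology on each $X_n$. A hypercyclic operator on $X$ is a continuous linear operator $T:X\to X$ such that $\{T^kx:k\in\mathbb Z_+\}$ is dense in $X$ for some $x\in X$. *)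

theory Defs
  imports "HOL-Analysis.Analysis" "HOL-Library.Poly_Mapping"
begin

(* Topological vector spaces are given by a topology T on a linear subspace topspace T of an
   ambient vector space 'a with scalar multiplication smul. In this way the members of a
   sequence of spaces may be different spaces although their elements have the same type; every
   sequence of vector spaces embeds into a common one, so this is no restriction.
   The definitions make sense for every real normed field 'k; they are meant for real and
   complex scalars. *)

definition topological_vector_space ::
    "('k::real_normed_field \<Rightarrow> 'a::ab_group_add \<Rightarrow> 'a) \<Rightarrow> 'a topology \<Rightarrow> bool" where
  "topological_vector_space smul T \<longleftrightarrow>
     vector_space smul \<and>
     module.subspace smul (topspace T) \<and> topspace T \<noteq> {0} \<and>
     Hausdorff_space T \<and>
     continuous_map (prod_topology T T) T (\<lambda>(x, y). x + y) \<and>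
     continuous_map (prod_topology euclidean T) T (\<lambda>(c, x). smul c x)"

definition convex_wrt ::
    "('k::real_normed_field \<Rightarrow> 'a::ab_group_add \<Rightarrow> 'a) \<Rightarrow> 'a set \<Rightarrow> bool" where
  "convex_wrt smul C \<longleftrightarrow>
     (\<forall>x\<in>C. \<forall>y\<in>C. \<forall>t::real. 0 \<le> t \<and> t \<le> 1 \<longrightarrow>
        smul (of_real t) x + smul (of_real (1 - t)) y \<in> C)"

definition locally_convex_space ::
    "('k::real_normed_field \<Rightarrow> 'a::ab_group_add \<Rightarrow> 'a) \<Rightarrow> 'a topology \<Rightarrow> bool" where
  "locally_convex_space smul T \<longleftrightarrow>
     topological_vector_space smul T \<and>
     (\<forall>U. openin T U \<and> 0 \<in> U \<longrightarrow>
        (\<exists>V. openin T V \<and> 0 \<in> V \<and> convex_wrt smul V \<and> V \<subseteq> U))"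

definition linear_map_on ::
    "'a set \<Rightarrow> ('k \<Rightarrow> 'a::ab_group_add \<Rightarrow> 'a) \<Rightarrow> ('k \<Rightarrow> 'b::ab_group_add \<Rightarrow> 'b) \<Rightarrow>
     ('a \<Rightarrow> 'b) \<Rightarrow> bool" where
  "linear_map_on S smul1 smul2 f \<longleftrightarrow>
     (\<forall>x\<in>S. \<forall>y\<in>S. f (x + y) = f x + f y) \<and>
     (\<forall>c. \<forall>x\<in>S. f (smul1 c x) = smul2 c (f x))"

(* Linear spaces of linear functionals on S separating the points of S. Only the values of a
   functional on S matter. *)
definition separating_functionals ::
    "('k::real_normed_field \<Rightarrow> 'a::ab_group_add \<Rightarrow> 'a) \<Rightarrow> 'a set \<Rightarrow> ('a \<Rightarrow> 'k) set \<Rightarrow> bool" where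
  "separating_functionals smul S Y \<longleftrightarrow>
     (\<forall>f\<in>Y. linear_map_on S smul (*) f) \<and>
     (\<lambda>x. 0) \<in> Y \<and>
     (\<forall>f\<in>Y. \<forall>g\<in>Y. (\<lambda>x. f x + g x) \<in> Y) \<and>
     (\<forall>c. \<forall>f\<in>Y. (\<lambda>x. c * f x) \<in> Y) \<and>
     (\<forall>x\<in>S. \<forall>y\<in>S. x \<noteq> y \<longrightarrow> (\<exists>f\<in>Y. f x \<noteq> f y))"

definition sigma_topology ::
    "'a set \<Rightarrow> ('a \<Rightarrow> 'k::topological_space) set \<Rightarrow> 'a topology" where
  "sigma_topology S Y = topology_generated_by {{x \<in> S. f x \<in> U} | f U. f \<in> Y \<and> open U}"

definition weak_topology ::
    "('k::real_normed_field \<Rightarrow> 'a::ab_group_add \<Rightarrow> 'a) \<Rightarrow> 'a topology \<Rightarrow> bool" where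
  "weak_topology smul T \<longleftrightarrow>
     (\<exists>Y. separating_functionals smul (topspace T) Y \<and> T = sigma_topology (topspace T) Y)"

definition l1_sequence ::
    "('k::real_normed_field \<Rightarrow> 'a::ab_group_add \<Rightarrow> 'a) \<Rightarrow> 'a topology \<Rightarrow> (nat \<Rightarrow> 'a) \<Rightarrow> bool" where
  "l1_sequence smul T x \<longleftrightarrow>
     range x \<subseteq> topspace T \<and>
     limitin T x 0 sequentially \<and>
     (\<forall>a::nat \<Rightarrow> 'k. summable (\<lambda>n. norm (a n)) \<longrightarrow>
        (\<exists>s. limitin T (\<lambda>N. \<Sum>n<N. smul (a n) (x n)) s sequentially))"

definition class_M ::
    "('k::real_normed_field \<Rightarrow> 'a::ab_group_add \<Rightarrow> 'a) \<Rightarrow> 'a topology \<Rightarrow> bool" where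
  "class_M smul T \<longleftrightarrow>
     locally_convex_space smul T \<and>
     \<not> weak_topology smul T \<and>
     (\<exists>x. l1_sequence smul T x \<and>
          T closure_of (module.span smul (range x)) = topspace T)"

(* The algebraic direct sum of the spaces X n consists of the finitely supported functions
   with n-th value in X n. *)

definition sum_smul ::
    "('k \<Rightarrow> 'a::ab_group_add \<Rightarrow> 'a) \<Rightarrow> 'k \<Rightarrow> (nat \<Rightarrow>\<^sub>0 'a) \<Rightarrow> (nat \<Rightarrow>\<^sub>0 'a)" where
  "sum_smul smul c = Poly_Mapping.map (smul c)"

definition direct_sum_carrier ::
    "(nat \<Rightarrow> 'a::ab_group_add topology) \<Rightarrow> (nat \<Rightarrow>\<^sub>0 'a) set" where
  "direct_sum_carrier X = {x. \<forall>n. Poly_Mapping.lookup x n \<in> topspace (X n)}"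

definition inducing_lc_topology ::
    "('k::real_normed_field \<Rightarrow> 'a::ab_group_add \<Rightarrow> 'a) \<Rightarrow> (nat \<Rightarrow> 'a topology) \<Rightarrow>
     (nat \<Rightarrow>\<^sub>0 'a) topology \<Rightarrow> bool" where
  "inducing_lc_topology smul X T \<longleftrightarrow>
     topspace T = direct_sum_carrier X \<and>
     locally_convex_space (sum_smul smul) T \<and>
     (\<forall>n. embedding_map (X n) T (Poly_Mapping.single n))"

definition strongest_inducing_lc_topology ::
    "('k::real_normed_field \<Rightarrow> 'a::ab_group_add \<Rightarrow> 'a) \<Rightarrow> (nat \<Rightarrow> 'a topology) \<Rightarrow>
     (nat \<Rightarrow>\<^sub>0 'a) topology \<Rightarrow> bool" where
  "strongest_inducing_lc_topology smul X T \<longleftrightarrow>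
     inducing_lc_topology smul X T \<and>
     (\<forall>T'. inducing_lc_topology smul X T' \<longrightarrow> (\<forall>U. openin T' U \<longrightarrow> openin T U))"

definition lc_direct_sum ::
    "('k::real_normed_field \<Rightarrow> 'a::ab_group_add \<Rightarrow> 'a) \<Rightarrow> (nat \<Rightarrow> 'a topology) \<Rightarrow>
     (nat \<Rightarrow>\<^sub>0 'a) topology" where
  "lc_direct_sum smul X = (THE T. strongest_inducing_lc_topology smul X T)"

lemma lc_direct_sum_eqI:
  assumes "strongest_inducing_lc_topology smul X T"
  shows "lc_direct_sum smul X = T"
  unfolding lc_direct_sum_def
  using assms
  by (intro the_equality) (auto simp: strongest_inducing_lc_topology_def topology_eq)

definition hypercyclic_operator ::
    "('k::real_normed_field \<Rightarrow> 'a::ab_group_add \<Rightarrow> 'a) \<Rightarrow> 'a topology \<Rightarrow> ('a \<Rightarrow> 'a) \<Rightarrow> bool" where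
  "hypercyclic_operator smul T f \<longleftrightarrow>
     continuous_map T T f \<and>
     linear_map_on (topspace T) smul smul f \<and>
     (\<exists>x\<in>topspace T. T closure_of {(f ^^ k) x | k. True} = topspace T)"

end

theory Submission
  imports Defs
begin

text \<open>
  Proof idea. Since the topology of \<open>X n\<close> is not weak, some continuous seminorm has a kernel of
  infinite codimension. Gram-Schmidt, with Hahn-Banach functionals, turns an \<open>\<ell>\<^sub>1\<close>-sequence with dense
  span into vectors \<open>e n k\<close> and \<open>g n k\<close> with dense span and functionals \<open>f n k\<close>, equicontinuous on
  \<open>X n\<close>, such that \<open>f n k\<close> does not vanish on \<open>e n k\<close> but on all other \<open>e n j\<close> and on all \<open>g n j\<close>.
  Hence an operator on the direct sum may be prescribed, up to small nonzero factors, by the images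
  of the \<open>e n k\<close>, and it kills all \<open>g n k\<close>; on each \<open>X n\<close> finitely many of these images are arbitrary.

  The operator moves \<open>e 0 k\<close> to \<open>e 0 (k + 1)\<close>, except that at \<open>k = 3^m - 1\<close> it leaves \<open>X 0\<close> along
  \<open>e 0 k, e 1 k, e 2 k, \<dots>, e (k + 1) k\<close>. The vector \<open>e (k + 1) k\<close> is the one of \<open>X (k + 1)\<close> whose image
  is free: it is a huge multiple of a vector \<open>d m\<close> that lies in the span of the previous chains and the
  \<open>g n j\<close>, so that the operator is locally nilpotent on the span. The \<open>d m\<close> run infinitely often through a
  countable dense set. The starting point is the sum of \<open>2^-(3^m) e 0 (3^m)\<close>: after \<open>5 * 3^m\<close> steps the
  terms before the \<open>m\<close>-th one have died, the \<open>m\<close>-th one has become \<open>d m\<close>, and the later ones are still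
  in \<open>X 0\<close> and small. The delay in \<open>X 0\<close> keeps the error in a single summand, which is what convergence in
  the direct sum requires.
\<close>

section \<open>The Hahn-Banach theorem\<close>

text \<open>The powers of 3 come from counting steps. The \<open>m\<close>-th term spends
  \<open>3 ^ Suc m - 3 ^ m = 2 * 3 ^ m\<close> steps in \<open>X 0\<close> and
  \<open>3 ^ Suc m\<close> steps crossing the other summands, which makes \<open>5 * 3 ^ m\<close>.
  Meanwhile the next term, starting at index \<open>3 ^ Suc m\<close>, gets to index
  \<open>8 * 3 ^ m\<close>, short of \<open>9 * 3 ^ m\<close>, where it would have left
  \<open>X 0\<close>; powers of 2 would give it too little room. The same slack closes the induction
  that bounds the time in which a vector dies. The coefficients collected along a chain cannot be
  normalised: summability of the values of the functionals forces them to be small. Dividing by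
  their product yields huge images, and an unbounded set of images in one summand would destroy
  continuity. On a direct sum, however, continuity is tested on each summand separately, with no
  uniformity between summands, so one huge image per summand is harmless. This is why each chain
  ends in a summand of its own.\<close>

definition sublinear_on ::
    "(real \<Rightarrow> 'a::ab_group_add \<Rightarrow> 'a) \<Rightarrow> 'a set \<Rightarrow> ('a \<Rightarrow> real) \<Rightarrow> bool" where
  "sublinear_on s S q \<longleftrightarrow>
     (\<forall>x\<in>S. \<forall>y\<in>S. q (x + y) \<le> q x + q y) \<and>
     (\<forall>t\<ge>0. \<forall>x\<in>S. q (s t x) = t * q x) \<and> (\<forall>x. x \<notin> S \<longrightarrow> q x = 0)"

locale real_subspace = vector_space s for s :: "real \<Rightarrow> 'a::ab_group_add \<Rightarrow> 'a" +
  fixes S :: "'a set"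
  assumes S: "subspace S"
begin

abbreviation "sublin \<equiv> sublinear_on s S"

lemma sublin_add: "sublin q \<Longrightarrow> x \<in> S \<Longrightarrow> y \<in> S \<Longrightarrow> q (x + y) \<le> q x + q y"
  by (simp add: sublinear_on_def)

lemma sublin_scale: "sublin q \<Longrightarrow> x \<in> S \<Longrightarrow> 0 \<le> t \<Longrightarrow> q (s t x) = t * q x"
  by (simp add: sublinear_on_def)

lemma sublin_0: "sublin q \<Longrightarrow> q 0 = 0"
  using sublin_scale[of q 0 0] S by (simp add: subspace_0)

lemma sublin_neg: "sublin q \<Longrightarrow> x \<in> S \<Longrightarrow> - q (- x) \<le> q x"
  using sublin_add[of q x "- x"] S by (simp add: sublin_0 subspace_neg)

text \<open>A minimal sublinear functional coincides with all of its modifications \<open>sublin_mod\<close>, which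
  makes it linear.\<close>

definition sublin_mod :: "('a \<Rightarrow> real) \<Rightarrow> 'a \<Rightarrow> 'a \<Rightarrow> real" where
  "sublin_mod q y x = (if x \<in> S then INF t\<in>{0..}. q (x + s t y) - t * q y else 0)"

text \<open>The bound does not depend on \<open>t\<close>, so the infimum in
  \<open>sublin_mod\<close> is taken over a set that is bounded below.\<close>

lemma sublin_mod_bound:
  assumes q: "sublin q" and x: "x \<in> S" and y: "y \<in> S" and t: "t \<ge> 0"
  shows "- q (- x) \<le> q (x + s t y) - t * q y"
proof -
  have "q ((x + s t y) + - x) \<le> q (x + s t y) + q (- x)"
    using x y S by (intro sublin_add[OF q]) (auto intro: subspace_add subspace_scale subspace_neg)
  then show ?thesis using sublin_scale[OF q y t] by simp
qed

lemma sublin_mod_le: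
  assumes q: "sublin q" and x: "x \<in> S" and y: "y \<in> S" and t: "t \<ge> 0"
  shows "sublin_mod q y x \<le> q (x + s t y) - t * q y"
proof -
  have "(INF t\<in>{0..}. q (x + s t y) - t * q y) \<le> q (x + s t y) - t * q y"
    by (rule cINF_lower) (use sublin_mod_bound[OF q x y] t in \<open>auto intro!: bdd_belowI2\<close>)
  then show ?thesis using x by (simp add: sublin_mod_def)
qed

lemma sublin_mod_ge:
  assumes "x \<in> S" "\<And>t. t \<ge> 0 \<Longrightarrow> b \<le> q (x + s t y) - t * q y"
  shows "b \<le> sublin_mod q y x"
  using assms by (auto simp: sublin_mod_def intro!: cINF_greatest)

lemma sublin_mod_sublin:
  assumes q: "sublin q" and y: "y \<in> S"
  shows "sublin (sublin_mod q y)"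
  unfolding sublinear_on_def
proof (intro conjI ballI allI impI)
  fix x x' assume x: "x \<in> S" and x': "x' \<in> S"
  have "sublin_mod q y (x + x') - (q (x' + s t' y) - t' * q y) \<le> q (x + s t y) - t * q y"
    if "t \<ge> 0" "t' \<ge> 0" for t t'
  proof -
    \<comment> \<open>The parameter \<open>t + t'\<close> is the competitor for
      \<open>x + x'\<close>, since it distributes over the two summands.\<close>
    have "sublin_mod q y (x + x') \<le> q ((x + x') + s (t + t') y) - (t + t') * q y"
      using that x x' y S by (intro sublin_mod_le[OF q]) (auto intro: subspace_add)
    also have "(x + x') + s (t + t') y = (x + s t y) + (x' + s t' y)"
      by (simp add: scale_left_distrib)
    also have "q \<dots> \<le> q (x + s t y) + q (x' + s t' y)"
      using x x' y S by (intro sublin_add[OF q]) (auto intro: subspace_add subspace_scale)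
    finally show ?thesis by (simp add: algebra_simps)
  qed
  then have "sublin_mod q y (x + x') - (q (x' + s t' y) - t' * q y) \<le> sublin_mod q y x"
    if "t' \<ge> 0" for t'
    using that by (intro sublin_mod_ge x)
  then have "sublin_mod q y (x + x') - sublin_mod q y x \<le> sublin_mod q y x'"
    by (intro sublin_mod_ge x') (simp add: algebra_simps)
  then show "sublin_mod q y (x + x') \<le> sublin_mod q y x + sublin_mod q y x'"
    by simp
next
  \<comment> \<open>One inequality is enough: applied to \<open>1 / t\<close> and
    \<open>s t x\<close> it gives the reverse one.\<close>
  have *: "t * sublin_mod q y x \<le> sublin_mod q y (s t x)" if t: "t > 0" and x: "x \<in> S" for t x
  proof (rule sublin_mod_ge)
    show "s t x \<in> S" using x S by (rule subspace_scale[rotated])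
    fix r :: real assume r: "r \<ge> 0"
    have "sublin_mod q y x \<le> q (x + s (r / t) y) - (r / t) * q y"
      using r t by (intro sublin_mod_le[OF q x y]) auto
    then have "t * sublin_mod q y x \<le> t * (q (x + s (r / t) y) - (r / t) * q y)"
      using t by simp
    also have "\<dots> = t * q (x + s (r / t) y) - r * q y"
      using t by (simp add: right_diff_distrib)
    also have "t * q (x + s (r / t) y) = q (s t (x + s (r / t) y))"
      using x y t S by (intro sublin_scale[OF q, symmetric]) (auto intro: subspace_add subspace_scale)
    also have "s t (x + s (r / t) y) = s t x + s r y"
      using t by (simp add: scale_right_distrib)
    finally show "t * sublin_mod q y x \<le> q (s t x + s r y) - r * q y" .
  qed
  fix t :: real and x assume t: "t \<ge> 0" and x: "x \<in> S"
  show "sublin_mod q y (s t x) = t * sublin_mod q y x"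
  proof (cases "t = 0")
    case True
    have "sublin_mod q y 0 = (INF t\<in>{0::real..}. 0)"
      unfolding sublin_mod_def using S sublin_scale[OF q y]
      by (auto simp: subspace_0 intro!: INF_cong)
    then show ?thesis using True by simp
  next
    case False
    then have "t * sublin_mod q y x \<le> sublin_mod q y (s t x)"
      using * t x by simp
    moreover have "(1 / t) * sublin_mod q y (s t x) \<le> sublin_mod q y (s (1 / t) (s t x))"
      using False t x S by (intro *) (auto intro: subspace_scale)
    then have "sublin_mod q y (s t x) \<le> t * sublin_mod q y x"
      using False t by (simp add: field_simps)
    ultimately show ?thesis by simp
  qed
qed (simp add: sublin_mod_def)

lemma sublin_mod_le_self:
  assumes "sublin q" "y \<in> S"
  shows "sublin_mod q y x \<le> q x"
proof (cases "x \<in> S")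
  case True
  then show ?thesis using sublin_mod_le[OF assms(1) True assms(2), of 0] by simp
qed (use assms in \<open>simp add: sublin_mod_def sublinear_on_def\<close>)

text \<open>Subadditivity is where comparability enters: the smaller of \<open>q\<close> and
  \<open>r\<close>, applied to both vectors, stays below \<open>q x + r y\<close>. The infimum is
  finite because \<open>- p (- x)\<close> is a common lower bound.\<close>

lemma chain_Inf_sublin:
  assumes ne: "C \<noteq> {}" and sub: "\<And>q. q \<in> C \<Longrightarrow> sublin q \<and> q \<le> p"
    and chain: "\<And>q r. q \<in> C \<Longrightarrow> r \<in> C \<Longrightarrow> q \<le> r \<or> r \<le> q"
  shows "sublin (\<lambda>x. INF q\<in>C. q x)" "q \<in> C \<Longrightarrow> (\<lambda>x. INF q\<in>C. q x) \<le> q"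
proof -
  have bdd: "bdd_below ((\<lambda>q. q x) ` C)" for x
  proof (cases "x \<in> S")
    case True
    have "- p (- x) \<le> q x" if "q \<in> C" for q
      using sublin_neg[of q x] sub[OF that] True le_funD[of q p "- x"] by auto
    then show ?thesis by (rule bdd_belowI2)
  next
    case False
    then have "0 \<le> q x" if "q \<in> C" for q
      using sub[OF that] by (simp add: sublinear_on_def)
    then show ?thesis by (rule bdd_belowI2)
  qed
  have lower: "(INF q\<in>C. q x) \<le> q x" if "q \<in> C" for q x
    using cINF_lower[OF bdd that] .
  then show "q \<in> C \<Longrightarrow> (\<lambda>x. INF q\<in>C. q x) \<le> q"
    by (simp add: le_fun_def)
  show "sublin (\<lambda>x. INF q\<in>C. q x)"
    unfolding sublinear_on_def
  proof (intro conjI ballI allI impI)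
    fix x y assume x: "x \<in> S" and y: "y \<in> S"
    have *: "(INF q\<in>C. q (x + y)) \<le> q x + r y" if q: "q \<in> C" and r: "r \<in> C" for q r
    proof (cases "q \<le> r")
      case True
      then show ?thesis
        using lower[OF q, of "x + y"] sublin_add[of q x y] x y sub[OF q] le_funD[of q r y] by simp
    next
      case False
      then have "r \<le> q" using chain q r by blast
      then show ?thesis
        using lower[OF r, of "x + y"] sublin_add[of r x y] x y sub[OF r] le_funD[of r q x] by simp
    qed
    have "(INF q\<in>C. q (x + y)) - r y \<le> (INF q\<in>C. q x)" if "r \<in> C" for r
      using ne *[OF _ that] by (intro cINF_greatest) (auto simp: algebra_simps)
    then have "(INF q\<in>C. q (x + y)) - (INF q\<in>C. q x) \<le> (INF q\<in>C. q y)"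
      using ne by (intro cINF_greatest) (auto simp: algebra_simps)
    then show "(INF q\<in>C. q (x + y)) \<le> (INF q\<in>C. q x) + (INF q\<in>C. q y)" by simp
  next
    fix t :: real and x assume t: "t \<ge> 0" and x: "x \<in> S"
    have "(INF q\<in>C. q (s t x)) = (INF q\<in>C. t * q x)"
      using sub x t by (intro INF_cong) (auto simp: sublin_scale)
    also have "\<dots> = t * (INF q\<in>C. q x)"
    proof (cases "t = 0")
      case True
      then show ?thesis using ne by simp
    next
      case False
      then have t: "t > 0" using t by simp
      show ?thesis
      proof (rule antisym)
        have "(INF q\<in>C. t * q x) / t \<le> q x" if "q \<in> C" for q
        proof -
          have "bdd_below ((\<lambda>q. t * q x) ` C)"
            using bdd[of x] t unfolding bdd_below_def by (force intro: mult_left_mono)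
          then have "(INF q\<in>C. t * q x) \<le> t * q x"
            using that by (rule cINF_lower)
          then show ?thesis using t by (simp add: field_simps)
        qed
        then have "(INF q\<in>C. t * q x) / t \<le> (INF q\<in>C. q x)"
          using ne by (intro cINF_greatest)
        then show "(INF q\<in>C. t * q x) \<le> t * (INF q\<in>C. q x)"
          using t by (simp add: field_simps)
        show "t * (INF q\<in>C. q x) \<le> (INF q\<in>C. t * q x)"
          using ne t lower by (intro cINF_greatest) auto
      qed
    qed
    finally show "(INF q\<in>C. q (s t x)) = t * (INF q\<in>C. q x)" .
  next
    fix x assume "x \<notin> S"
    then have "(INF q\<in>C. q x) = (INF q\<in>C. 0)"
      using sub by (intro INF_cong) (auto simp: sublinear_on_def)
    then show "(INF q\<in>C. q x) = 0" using ne by simp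
  qed
qed

text \<open>Zorn's lemma for the reversed pointwise order. Since sublinear functionals are fixed to
  be 0 off \<open>S\<close>, minimality can be stated as equality of functions.\<close>

lemma minimal_sublin_exists:
  assumes p: "sublin p"
  obtains m where "sublin m" "m \<le> p" "\<And>q. sublin q \<Longrightarrow> q \<le> m \<Longrightarrow> q = m"
proof -
  define A where "A = {q. sublin q \<and> q \<le> p}"
  have "\<exists>m\<in>A. \<forall>a\<in>A. m \<ge> a \<longrightarrow> a = m"
  proof (rule predicate_Zorn)
    show "partial_order_on A (relation_of (\<lambda>x y. y \<le> x) A)"
      by (rule partial_order_on_relation_ofI) auto
    fix C assume C: "C \<in> Chains (relation_of (\<lambda>x y. y \<le> x) A)"
    have CA: "C \<subseteq> A" using C by (auto simp: Chains_def relation_of_def)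
    have chain: "q \<le> r \<or> r \<le> q" if "q \<in> C" "r \<in> C" for q r
      using C that by (auto simp: Chains_def relation_of_def)
    show "\<exists>u\<in>A. \<forall>a\<in>C. u \<le> a"
    proof (cases "C = {}")
      case True
      then show ?thesis using p by (auto simp: A_def)
    next
      case False
      have sub: "sublin q \<and> q \<le> p" if "q \<in> C" for q
        using that CA by (auto simp: A_def)
      have I1: "sublin (\<lambda>x. INF q\<in>C. q x)"
        by (rule chain_Inf_sublin(1)[OF False]) (use sub chain in auto)
      have I2: "(\<lambda>x. INF q\<in>C. q x) \<le> q" if "q \<in> C" for q
        by (rule chain_Inf_sublin(2)[OF False]) (use sub chain that in auto)
      obtain q where q: "q \<in> C" using False by auto
      have "(\<lambda>x. INF q\<in>C. q x) \<le> p"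
        using I2[OF q] sub[OF q] by (blast intro: order_trans)
      then have "(\<lambda>x. INF q\<in>C. q x) \<in> A"
        using I1 by (simp add: A_def)
      then show ?thesis using I2 by blast
    qed
  qed
  then obtain m where m: "m \<in> A" "\<And>a. a \<in> A \<Longrightarrow> a \<le> m \<Longrightarrow> a = m" by blast
  show thesis
  proof (rule that)
    show "sublin m" "m \<le> p" using m(1) by (auto simp: A_def)
    fix q assume "sublin q" "q \<le> m"
    then show "q = m" using m(1) by (intro m(2)) (auto simp: A_def intro: order_trans)
  qed
qed

text \<open>Minimality gives \<open>sublin_mod m y = m\<close>, and the parameter 1 in its infimum
  yields \<open>m x \<le> m (x + y) - m y\<close>, the missing half of additivity. Additivity then
  extends homogeneity to negative scalars.\<close>

lemma minimal_sublin_linear: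
  assumes m: "sublin m" and min: "\<And>q. sublin q \<Longrightarrow> q \<le> m \<Longrightarrow> q = m"
  shows "linear_map_on S s (*) m"
proof -
  have add: "m (x + y) = m x + m y" if x: "x \<in> S" and y: "y \<in> S" for x y
  proof (rule antisym)
    have "sublin_mod m y = m"
      using sublin_mod_sublin[OF m y] sublin_mod_le_self[OF m y] by (intro min) (auto simp: le_fun_def)
    then show "m x + m y \<le> m (x + y)"
      using sublin_mod_le[OF m x y, of 1] by simp
  qed (rule sublin_add[OF m x y])
  have neg: "m (- x) = - m x" if "x \<in> S" for x
    using add[of x "- x"] that S by (simp add: subspace_neg sublin_0[OF m])
  have "m (s t x) = t * m x" if x: "x \<in> S" for t x
  proof (cases "t \<ge> 0")
    case False
    have "m (s t x) = m (- (s (- t) x))" by simp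
    also have "\<dots> = - m (s (- t) x)" using x S by (intro neg) (auto intro: subspace_neg subspace_scale)
    finally show ?thesis using sublin_scale[OF m x, of "- t"] False by simp
  qed (rule sublin_scale[OF m x])
  then show ?thesis using add by (simp add: linear_map_on_def)
qed

text \<open>The minimal functional is taken below \<open>sublin_mod p e\<close> instead of
  \<open>p\<close>: at \<open>- e\<close> the parameter 1 gives the value \<open>p 0 - p e\<close>
  as an upper bound, which forces the functional to attain \<open>p e\<close> at
  \<open>e\<close>.\<close>

lemma Hahn_Banach_sublin:
  assumes p: "sublin p" and e: "e \<in> S"
  obtains f where "linear_map_on S s (*) f" "f \<le> p" "f e \<ge> p e"
proof -
  obtain m where m: "sublin m" "m \<le> sublin_mod p e" "\<And>q. sublin q \<Longrightarrow> q \<le> m \<Longrightarrow> q = m"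
    using minimal_sublin_exists[OF sublin_mod_sublin[OF p e]] by metis
  have "m (- e) \<le> sublin_mod p e (- e)" using m(2) by (rule le_funD)
  also have "\<dots> \<le> p (- e + s 1 e) - 1 * p e"
    using e S by (intro sublin_mod_le[OF p]) (auto intro: subspace_neg)
  finally have "m (- e) \<le> - p e" by (simp add: sublin_0[OF p])
  then have "m e \<ge> p e" using sublin_neg[OF m(1) e] by simp
  moreover have "m x \<le> p x" for x
    using le_funD[OF m(2)] sublin_mod_le_self[OF p e] order_trans by blast
  ultimately show thesis
    using that minimal_sublin_linear[OF m(1,3)] by (auto simp: le_fun_def)
qed

end

section \<open>Functionals dominated by a seminorm, over the real and the complex scalars\<close>

definition seminorm_on ::
    "('k::real_normed_field \<Rightarrow> 'a::ab_group_add \<Rightarrow> 'a) \<Rightarrow> 'a set \<Rightarrow> ('a \<Rightarrow> real) \<Rightarrow> bool" where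
  "seminorm_on smul S p \<longleftrightarrow>
     (\<forall>x\<in>S. \<forall>y\<in>S. p (x + y) \<le> p x + p y) \<and>
     (\<forall>c. \<forall>x\<in>S. p (smul c x) = norm c * p x)"

text \<open>This property isolates what is proved separately for real and complex scalars, so that
  the construction of the operator is carried out once for both.\<close>

definition supporting_functionals ::
    "('k::real_normed_field \<Rightarrow> 'a::ab_group_add \<Rightarrow> 'a) \<Rightarrow> bool" where
  "supporting_functionals smul \<longleftrightarrow>
     (\<forall>S p e. module.subspace smul S \<and> seminorm_on smul S p \<and> e \<in> S \<and> p e \<noteq> 0 \<longrightarrow>
        (\<exists>f. linear_map_on S smul (*) f \<and> (\<forall>x\<in>S. norm (f x) \<le> p x) \<and> f e \<noteq> 0))"

lemma Hahn_Banach_seminorm: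
  assumes "vector_space s" "module.subspace s S" "seminorm_on s S p" "e \<in> S"
  obtains f where "linear_map_on S s (*) f" "\<And>x. x \<in> S \<Longrightarrow> \<bar>f x\<bar> \<le> p x" "f e \<ge> p e"
proof -
  interpret real_subspace s S
    using assms by (simp add: real_subspace_def real_subspace_axioms_def)
  have *: "- x \<in> S \<and> p (- x) = p x" if "x \<in> S" for x
  proof -
    have "s (- 1) x = - x" by simp
    moreover have "p (s (- 1) x) = \<bar>-1\<bar> * p x"
      using assms(3) that unfolding seminorm_on_def by (metis real_norm_def)
    ultimately show ?thesis using that S by (simp add: subspace_neg)
  qed
  have "sublin (\<lambda>x. if x \<in> S then p x else 0)"
    using assms(3) S by (auto simp: sublinear_on_def seminorm_on_def subspace_add subspace_scale)
  then obtain f where f: "linear_map_on S s (*) f" "f \<le> (\<lambda>x. if x \<in> S then p x else 0)" "f e \<ge> p e"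
    using assms(4) by (auto elim: Hahn_Banach_sublin)
  have le: "f x \<le> p x" if "x \<in> S" for x
    using le_funD[OF f(2), of x] that by simp
  have "f (- x) = - f x" if "x \<in> S" for x
  proof -
    have "f (s (- 1) x) = - 1 * f x" using f(1) that by (simp only: linear_map_on_def)
    then show ?thesis by simp
  qed
  then have "\<bar>f x\<bar> \<le> p x" if "x \<in> S" for x
    using le[of x] le[of "- x"] *[OF that] that by auto
  then show thesis using that f by blast
qed

lemma supporting_functionals_real:
  fixes smul :: "real \<Rightarrow> 'a::ab_group_add \<Rightarrow> 'a"
  assumes "vector_space smul"
  shows "supporting_functionals smul"
  unfolding supporting_functionals_def
proof (intro allI impI, elim conjE)
  fix S p and e :: 'a
  assume *: "module.subspace smul S" "seminorm_on smul S p" "e \<in> S" "p e \<noteq> 0"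
  interpret vector_space smul by fact
  obtain f where f: "linear_map_on S smul (*) f" "\<And>x. x \<in> S \<Longrightarrow> \<bar>f x\<bar> \<le> p x" "f e \<ge> p e"
    using Hahn_Banach_seminorm[OF assms *(1-3)] by blast
  then have "f e \<noteq> 0" using *(3,4) f(2)[of e] by linarith
  then show "\<exists>f. linear_map_on S smul (*) f \<and> (\<forall>x\<in>S. norm (f x) \<le> p x) \<and> f e \<noteq> 0"
    using f by auto
qed

lemma supporting_functionals_complex:
  fixes smul :: "complex \<Rightarrow> 'a::ab_group_add \<Rightarrow> 'a"
  assumes vs: "vector_space smul"
  shows "supporting_functionals smul"
  unfolding supporting_functionals_def
proof (intro allI impI, elim conjE)
  fix S p and e :: 'a
  assume *: "module.subspace smul S" "seminorm_on smul S p" "e \<in> S" "p e \<noteq> 0"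
  interpret vector_space smul by fact
  define s where "s = (\<lambda>t::real. smul (of_real t))"
  have vsr: "vector_space s"
    by unfold_locales (auto simp: s_def scale_right_distrib scale_left_distrib)
  interpret R: vector_space s by fact
  have subr: "module.subspace s S"
    using *(1) unfolding R.subspace_def subspace_def by (auto simp: s_def)
  have "seminorm_on s S p"
    using *(2) by (auto simp: seminorm_on_def s_def)
  then obtain f where f: "linear_map_on S s (*) f" "\<And>x. x \<in> S \<Longrightarrow> \<bar>f x\<bar> \<le> p x" "f e \<ge> p e"
    using Hahn_Banach_seminorm[OF vsr subr _ *(3)] by blast
  \<comment> \<open>The complex functional whose real part is the real functional
    \<open>f\<close>.\<close>
  define F where "F x = Complex (f x) (- f (smul \<i> x))" for x
  have fadd: "f (x + y) = f x + f y" if "x \<in> S" "y \<in> S" for x y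
    using f(1) that by (simp add: linear_map_on_def)
  have fs: "f (smul (of_real t) x) = t * f x" if "x \<in> S" for t x
    using f(1) that by (simp add: linear_map_on_def s_def)
  have S: "smul c x \<in> S" if "x \<in> S" for c x
    using *(1) that by (rule subspace_scale)
  have fc: "f (smul c x) = Re c * f x + Im c * f (smul \<i> x)" if "x \<in> S" for c x
  proof -
    have "c = of_real (Re c) + of_real (Im c) * \<i>" by (simp add: complex_eq_iff)
    from arg_cong[OF this, of "\<lambda>c. smul c x"]
    have "smul c x = smul (of_real (Re c)) x + smul (of_real (Im c)) (smul \<i> x)"
      by (simp only: scale_scale scale_left_distrib)
    also have "f \<dots> = Re c * f x + f (smul (of_real (Im c)) (smul \<i> x))"
      using that by (simp only: fadd fs S)
    finally show ?thesis using that by (simp only: fs S)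
  qed
  have lin: "linear_map_on S smul (*) F"
    unfolding linear_map_on_def
  proof (intro conjI ballI allI)
    fix x y assume "x \<in> S" "y \<in> S"
    then show "F (x + y) = F x + F y"
      by (simp add: F_def complex_eq_iff scale_right_distrib fadd S)
  next
    fix c x assume x: "x \<in> S"
    have "f (smul \<i> (smul c x)) = Re c * f (smul \<i> x) - Im c * f x"
      using fc[OF x, of "\<i> * c"] by simp
    then show "F (smul c x) = c * F x"
      using fc[OF x, of c] by (simp add: F_def complex_eq_iff)
  qed
  have "norm (F x) \<le> p x" if x: "x \<in> S" for x
  proof (cases "F x = 0")
    case True
    then show ?thesis using f(2)[OF x] by simp
  next
    case False
    \<comment> \<open>Rotating \<open>x\<close> by this unimodular factor makes the value of
      \<open>F\<close> real and nonnegative, so that the bound for \<open>f\<close> applies.\<close>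
    define c where "c = of_real (norm (F x)) / F x"
    have nc: "norm c = 1" using False by (simp add: c_def norm_divide)
    have "F (smul c x) = c * F x" using lin x by (simp add: linear_map_on_def)
    then have "F (smul c x) = of_real (norm (F x))" using False by (simp add: c_def)
    then have "norm (F x) = f (smul c x)" by (simp add: F_def complex_eq_iff)
    also have "\<dots> \<le> p (smul c x)" using f(2)[OF S[OF x, of c]] by simp
    also have "\<dots> = p x" using *(2) x nc by (simp add: seminorm_on_def)
    finally show ?thesis .
  qed
  moreover have "Re (F e) \<noteq> 0"
    using f(2)[OF *(3)] f(3) *(4) by (auto simp: F_def)
  then have "F e \<noteq> 0" by auto
  ultimately show "\<exists>f. linear_map_on S smul (*) f \<and> (\<forall>x\<in>S. norm (f x) \<le> p x) \<and> f e \<noteq> 0"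
    using lin by blast
qed

section \<open>Locally convex spaces and continuous seminorms\<close>

lemma
  fixes scale :: "'k::real_normed_field \<Rightarrow> 'a::ab_group_add \<Rightarrow> 'a"
  assumes vs: "vector_space scale" and sn: "seminorm_on scale S p" and sub: "module.subspace scale S"
  shows seminorm_on_triangle: "\<And>x y. x \<in> S \<Longrightarrow> y \<in> S \<Longrightarrow> p (x + y) \<le> p x + p y"
    and seminorm_on_scale: "\<And>c x. x \<in> S \<Longrightarrow> p (scale c x) = norm c * p x"
    and seminorm_on_0: "p 0 = 0"
    and seminorm_on_neg: "\<And>x. x \<in> S \<Longrightarrow> p (- x) = p x"
    and seminorm_on_nonneg: "\<And>x. x \<in> S \<Longrightarrow> 0 \<le> p x"
    and seminorm_on_diff: "\<And>x y. x \<in> S \<Longrightarrow> y \<in> S \<Longrightarrow> p (x - y) \<le> p x + p y"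
    and seminorm_on_minus_commute: "\<And>x y. x \<in> S \<Longrightarrow> y \<in> S \<Longrightarrow> p (x - y) = p (y - x)"
    and seminorm_on_abs_diff: "\<And>x y. x \<in> S \<Longrightarrow> y \<in> S \<Longrightarrow> \<bar>p x - p y\<bar> \<le> p (x - y)"
    and seminorm_on_sum: "\<And>I g. (\<And>i. i \<in> I \<Longrightarrow> g i \<in> S) \<Longrightarrow> p (\<Sum>i\<in>I. g i) \<le> (\<Sum>i\<in>I. p (g i))"
proof -
  interpret vector_space scale by fact
  show tri: "p (x + y) \<le> p x + p y" if "x \<in> S" "y \<in> S" for x y
    using sn that by (simp add: seminorm_on_def)
  show sc: "p (scale c x) = norm c * p x" if "x \<in> S" for c x
    using sn that by (simp add: seminorm_on_def)
  show z: "p 0 = 0"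
    using sc[of 0 0] sub by (simp add: subspace_0)
  show neg: "p (- x) = p x" if "x \<in> S" for x
    using sc[OF that, of "- 1"] by simp
  show "0 \<le> p x" if "x \<in> S" for x
    using tri[of x "- x"] neg[of x] that z sub by (simp add: subspace_neg)
  show diff: "p (x - y) \<le> p x + p y" if "x \<in> S" "y \<in> S" for x y
    using tri[of x "- y"] neg[of y] that sub by (simp add: subspace_neg)
  show comm: "p (x - y) = p (y - x)" if "x \<in> S" "y \<in> S" for x y
    using neg[of "x - y"] that sub by (simp add: subspace_diff)
  show "\<bar>p x - p y\<bar> \<le> p (x - y)" if "x \<in> S" "y \<in> S" for x y
    using tri[of "x - y" y] tri[of "y - x" x] comm[of x y] that sub
    by (simp add: subspace_diff)
  show "p (\<Sum>i\<in>I. g i) \<le> (\<Sum>i\<in>I. p (g i))" if "\<And>i. i \<in> I \<Longrightarrow> g i \<in> S" for I and g :: "'c \<Rightarrow> 'a"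
    using that
  proof (induction I rule: infinite_finite_induct)
    case (insert i I)
    then have "p (g i + (\<Sum>i\<in>I. g i)) \<le> p (g i) + p (\<Sum>i\<in>I. g i)"
      by (intro tri subspace_sum[OF sub]) auto
    also have "p (\<Sum>i\<in>I. g i) \<le> (\<Sum>i\<in>I. p (g i))"
      using insert by simp
    finally show ?case using insert by simp
  qed (auto simp: z)
qed

definition cont_seminorm ::
    "('k::real_normed_field \<Rightarrow> 'a::ab_group_add \<Rightarrow> 'a) \<Rightarrow> 'a topology \<Rightarrow> ('a \<Rightarrow> real) \<Rightarrow> bool" where
  "cont_seminorm smul T p \<longleftrightarrow>
     seminorm_on smul (topspace T) p \<and> continuous_map T euclideanreal p"

section \<open>Minkowski functionals of convex balanced absorbing sets\<close>

definition gauge_on :: "('k::real_normed_field \<Rightarrow> 'a \<Rightarrow> 'a) \<Rightarrow> 'a set \<Rightarrow> 'a \<Rightarrow> real" where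
  "gauge_on smul B x = Inf {t. t > 0 \<and> smul (of_real (1 / t)) x \<in> B}"

text \<open>Convexity gives the triangle inequality, and balancedness gives homogeneity for
  arbitrary scalars as well as upward closure of the set of admissible \<open>t\<close>. Absorption
  makes that set nonempty, hence its infimum meaningful.\<close>

lemma
  fixes B :: "'b::ab_group_add set" and scl :: "'k::real_normed_field \<Rightarrow> 'b \<Rightarrow> 'b"
  assumes vs: "vector_space scl" and S: "module.subspace scl S"
    and conv: "convex_wrt scl B"
    and bal: "\<And>c x. norm c \<le> 1 \<Longrightarrow> x \<in> B \<Longrightarrow> scl c x \<in> B"
    and absb: "\<And>x. x \<in> S \<Longrightarrow> \<exists>t>0. scl (of_real (1 / t)) x \<in> B"
  shows seminorm_on_gauge: "seminorm_on scl S (gauge_on scl B)"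
    and gauge_on_less_1: "\<And>x. x \<in> S \<Longrightarrow> gauge_on scl B x < 1 \<Longrightarrow> x \<in> B"
    and gauge_on_le_1: "\<And>x. x \<in> B \<Longrightarrow> gauge_on scl B x \<le> 1"
proof -
  interpret vector_space scl by fact
  define A where "A x = {t. t > 0 \<and> scl (of_real (1 / t)) x \<in> B}" for x
  have g: "gauge_on scl B x = Inf (A x)" for x
    by (simp add: gauge_on_def A_def)
  have bdd: "bdd_below (A x)" for x
    by (rule bdd_belowI[of _ 0]) (auto simp: A_def)
  have low: "gauge_on scl B x \<le> t" if "t \<in> A x" for x t
    unfolding g using that bdd by (rule cInf_lower)
  have ne: "A x \<noteq> {}" if "x \<in> S" for x
    using absb[OF that] by (auto simp: A_def)
  have up: "t' \<in> A x" if "t \<in> A x" "t \<le> t'" for t t' x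
  proof -
    have "scl (of_real (t / t')) (scl (of_real (1 / t)) x) \<in> B"
      by (rule bal) (use that in \<open>auto simp: A_def norm_divide simp del: of_real_divide\<close>)
    moreover have "of_real (t / t') * of_real (1 / t) = (of_real (1 / t') :: 'k)"
      using that unfolding of_real_mult[symmetric] by (simp add: A_def)
    ultimately show ?thesis using that by (simp add: A_def)
  qed
  show "gauge_on scl B x \<le> 1" if "x \<in> B" for x
    using that by (intro low) (simp add: A_def)
  show "x \<in> B" if "x \<in> S" "gauge_on scl B x < 1" for x
  proof -
    obtain t where "t \<in> A x" "t < 1"
      using \<open>gauge_on scl B x < 1\<close> ne[OF \<open>x \<in> S\<close>] bdd[of x] unfolding g by (auto simp: cInf_less_iff)
    then have "1 \<in> A x" by (rule up[OF _ less_imp_le])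
    then show ?thesis by (simp add: A_def)
  qed
  have hom: "gauge_on scl B (scl c x) \<le> norm c * gauge_on scl B x" if x: "x \<in> S" and c: "c \<noteq> 0" for c x
  proof -
    have "gauge_on scl B (scl c x) / norm c \<le> t" if t: "t \<in> A x" for t
    proof -
      have "scl (c / of_real (norm c)) (scl (of_real (1 / t)) x) \<in> B"
        by (rule bal) (use t c in \<open>auto simp: A_def norm_divide\<close>)
      also have "scl (c / of_real (norm c)) (scl (of_real (1 / t)) x) =
          scl (of_real (1 / (norm c * t))) (scl c x)"
        using t c by (simp add: A_def field_simps)
      finally have "gauge_on scl B (scl c x) \<le> norm c * t"
        using t c by (intro low) (simp add: A_def)
      then show ?thesis using c by (simp add: field_simps)
    qed
    then have "gauge_on scl B (scl c x) / norm c \<le> Inf (A x)"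
      using ne[OF x] by (intro cInf_greatest)
    then show ?thesis unfolding g using c by (simp add: field_simps)
  qed
  have zero: "gauge_on scl B 0 = 0"
  proof -
    obtain b where "b \<in> B" using absb[of 0] S by (auto simp: subspace_0)
    then have "0 \<in> B" using bal[of 0 b] by simp
    then have "gauge_on scl B 0 \<le> t" if "t > 0" for t
      using that by (intro low) (simp add: A_def)
    then have "gauge_on scl B 0 \<le> 0" by (rule dense_ge)
    moreover have "0 \<le> gauge_on scl B 0"
      unfolding g using ne[OF subspace_0[OF S]] by (rule cInf_greatest) (simp add: A_def)
    ultimately show ?thesis by simp
  qed
  show "seminorm_on scl S (gauge_on scl B)"
    unfolding seminorm_on_def
  proof (intro conjI ballI allI)
    fix x y assume x: "x \<in> S" and y: "y \<in> S"
    have *: "gauge_on scl B (x + y) \<le> t + r" if t: "t \<in> A x" and r: "r \<in> A y" for t r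
    proof (rule low)
      have pos: "t > 0" "r > 0" using t r by (auto simp: A_def)
      have tr: "0 \<le> t / (t + r)" "t / (t + r) \<le> 1" using pos by simp_all
      \<comment> \<open>The weights \<open>t / (t + r)\<close> and \<open>r / (t + r)\<close> turn
        the two scaled vectors into \<open>(x + y) / (t + r)\<close>.\<close>
      have "scl (of_real (t / (t + r))) (scl (of_real (1 / t)) x) +
          scl (of_real (1 - t / (t + r))) (scl (of_real (1 / r)) y) \<in> B"
        using conv[unfolded convex_wrt_def, rule_format, OF _ _ conjI[OF tr]] t r
        by (simp only: A_def mem_Collect_eq)
      also have "1 - t / (t + r) = r / (t + r)"
        using pos by (simp add: field_simps)
      finally have "scl (of_real (t / (t + r) * (1 / t))) x + scl (of_real (r / (t + r) * (1 / r))) y \<in> B"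
        unfolding scale_scale of_real_mult .
      then show "t + r \<in> A (x + y)"
        using pos by (simp add: A_def scale_right_distrib)
    qed
    have "gauge_on scl B (x + y) - r \<le> gauge_on scl B x" if "r \<in> A y" for r
      unfolding g[of x] using ne[OF x] *[OF _ that]
      by (intro cInf_greatest) (auto simp: algebra_simps)
    then have "gauge_on scl B (x + y) - gauge_on scl B x \<le> gauge_on scl B y"
      unfolding g[of y] using ne[OF y] by (intro cInf_greatest) (auto simp: algebra_simps)
    then show "gauge_on scl B (x + y) \<le> gauge_on scl B x + gauge_on scl B y" by simp
  next
    fix c x assume x: "x \<in> S"
    show "gauge_on scl B (scl c x) = norm c * gauge_on scl B x"
    proof (cases "c = 0")
      case False
      have "gauge_on scl B (scl (inverse c) (scl c x)) \<le> norm (inverse c) * gauge_on scl B (scl c x)"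
        using x S False by (intro hom) (auto simp: subspace_scale)
      then have "norm c * gauge_on scl B x \<le> gauge_on scl B (scl c x)"
        using False by (simp add: norm_inverse norm_divide field_simps)
      then show ?thesis using hom[OF x False] by simp
    qed (simp add: zero)
  qed
qed

locale lcs =
  fixes smul :: "'k::real_normed_field \<Rightarrow> 'a::ab_group_add \<Rightarrow> 'a" and T :: "'a topology"
  assumes locally_convex_space: "locally_convex_space smul T"
begin

lemma tvs: "topological_vector_space smul T"
  using locally_convex_space by (simp add: locally_convex_space_def)

sublocale vector_space smul
  using tvs by (simp add: topological_vector_space_def)

abbreviation S where "S \<equiv> topspace T"

lemma subspace_S: "subspace S"
  using tvs by (simp add: topological_vector_space_def)

lemmas S_intros [simp, intro] = subspace_0[OF subspace_S] subspace_add[OF subspace_S]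
  subspace_scale[OF subspace_S] subspace_neg[OF subspace_S] subspace_diff[OF subspace_S]

lemma S_sum: "(\<And>i. i \<in> I \<Longrightarrow> g i \<in> S) \<Longrightarrow> (\<Sum>i\<in>I. g i) \<in> S"
  by (rule subspace_sum[OF subspace_S])

lemma continuous_add:
  assumes "continuous_map X T f" "continuous_map X T g"
  shows "continuous_map X T (\<lambda>x. f x + g x)"
proof -
  have "continuous_map X T ((\<lambda>(x, y). x + y) \<circ> (\<lambda>x. (f x, g x)))"
    using assms tvs by (intro continuous_map_compose[of _ "prod_topology T T"] continuous_map_pairedI)
      (auto simp: topological_vector_space_def)
  then show ?thesis by (simp add: o_def)
qed

lemma continuous_scale:
  assumes "continuous_map X euclidean f" "continuous_map X T g"
  shows "continuous_map X T (\<lambda>x. smul (f x) (g x))"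
proof -
  have "continuous_map X T ((\<lambda>(x, y). smul x y) \<circ> (\<lambda>x. (f x, g x)))"
    using assms tvs by (intro continuous_map_compose[of _ "prod_topology euclidean T"] continuous_map_pairedI)
      (auto simp: topological_vector_space_def)
  then show ?thesis by (simp add: o_def)
qed

lemma openin_affine_preimage:
  assumes U: "openin T U" and a: "a \<in> S"
  shows "openin T {x \<in> S. smul c (x - a) \<in> U}"
proof -
  have "continuous_map T T (\<lambda>x. smul c (x + - a))"
    using a by (intro continuous_scale continuous_add) auto
  then show ?thesis
    using openin_continuous_map_preimage[OF _ U] by fastforce
qed

abbreviation "csn \<equiv> cont_seminorm smul T"

lemma csn_seminorm: "csn p \<Longrightarrow> seminorm_on smul S p"
  by (simp add: cont_seminorm_def)

lemmas csn_triangle = seminorm_on_triangle[OF vector_space_axioms csn_seminorm subspace_S]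
  and csn_scale = seminorm_on_scale[OF vector_space_axioms csn_seminorm subspace_S]
  and csn_0 = seminorm_on_0[OF vector_space_axioms csn_seminorm subspace_S]
  and csn_nonneg = seminorm_on_nonneg[OF vector_space_axioms csn_seminorm subspace_S]
  and csn_diff = seminorm_on_diff[OF vector_space_axioms csn_seminorm subspace_S]
  and csn_minus_commute = seminorm_on_minus_commute[OF vector_space_axioms csn_seminorm subspace_S]
  and csn_sum = seminorm_on_sum[OF vector_space_axioms csn_seminorm subspace_S]
  and csn_abs_diff = seminorm_on_abs_diff[OF vector_space_axioms csn_seminorm subspace_S]

lemma csn_ball_open:
  assumes "csn p" "a \<in> S"
  shows "openin T {x \<in> S. p (x - a) < r}"
proof -
  have "continuous_map T T (\<lambda>x. x + - a)"
    using assms by (intro continuous_add) auto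
  then have "continuous_map T euclideanreal (p \<circ> (\<lambda>x. x + - a))"
    using assms by (intro continuous_map_compose) (auto simp: cont_seminorm_def)
  then have "continuous_map T euclideanreal (\<lambda>x. p (x - a))"
    by (simp add: o_def)
  then have "openin T {x \<in> S. p (x - a) \<in> {..<r}}"
    by (rule openin_continuous_map_preimage) (simp add: open_openin[symmetric])
  then show ?thesis by simp
qed

text \<open>Boundedness near 0 spreads to every point: on a scaled translate of \<open>U\<close> the
  reverse triangle inequality makes \<open>p\<close> vary by at most \<open>e / 2\<close>.\<close>

lemma csnI:
  assumes p: "seminorm_on smul S p" and U: "openin T U" "0 \<in> U" and le: "\<And>x. x \<in> U \<Longrightarrow> p x \<le> 1"
  shows "csn p"
  unfolding cont_seminorm_def
proof
  show "continuous_map T euclideanreal p"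
    unfolding continuous_map_def
  proof (intro conjI allI impI)
    fix V :: "real set" assume "openin euclideanreal V"
    then have V: "open V" by (simp only: open_openin)
    show "openin T {x \<in> S. p x \<in> V}"
    proof (subst openin_subopen, intro ballI)
      fix x assume "x \<in> {x \<in> S. p x \<in> V}"
      then have x: "x \<in> S" "p x \<in> V" by auto
      obtain e where e: "e > 0" "ball (p x) e \<subseteq> V"
        using V x(2) by (auto simp: open_contains_ball)
      let ?W = "{y \<in> S. smul (of_real (2 / e)) (y - x) \<in> U}"
      have "p y \<in> V" if "y \<in> ?W" for y
      proof -
        have y: "y \<in> S" using that by simp
        have "2 / e * p (y - x) = p (smul (of_real (2 / e)) (y - x))"
          using seminorm_on_scale[OF vector_space_axioms p subspace_S, of "y - x" "of_real (2 / e)"] x y e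
          by (simp add: norm_divide)
        also have "\<dots> \<le> 1" using that by (intro le) auto
        finally have "p (y - x) \<le> e / 2" using e by (simp add: field_simps)
        then have "dist (p x) (p y) < e"
          using seminorm_on_abs_diff[OF vector_space_axioms p subspace_S y x(1)] e by (simp add: dist_real_def)
        then show ?thesis using e by auto
      qed
      then show "\<exists>W. openin T W \<and> x \<in> W \<and> W \<subseteq> {x \<in> S. p x \<in> V}"
        using openin_affine_preimage[OF U(1) x(1), of "of_real (2 / e)"] x U(2)
        by (intro exI[of _ ?W]) auto
    qed
  qed simp
qed (rule p)

lemma csn_dominated:
  assumes p: "seminorm_on smul S p" and q: "csn q" and le: "\<And>x. x \<in> S \<Longrightarrow> p x \<le> C * q x"
  shows "csn p"
proof (rule csnI[OF p])
  show "openin T {x \<in> S. q (x - 0) < 1 / (\<bar>C\<bar> + 1)}"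
    using q by (rule csn_ball_open) simp
  show "0 \<in> {x \<in> S. q (x - 0) < 1 / (\<bar>C\<bar> + 1)}"
    using csn_0[OF q] by simp
  fix x assume x: "x \<in> {x \<in> S. q (x - 0) < 1 / (\<bar>C\<bar> + 1)}"
  then have "p x \<le> C * q x" by (intro le) simp
  also have "\<dots> \<le> (\<bar>C\<bar> + 1) * q x"
    using csn_nonneg[OF q, of x] x by (intro mult_right_mono) auto
  also have "\<dots> \<le> 1" using x by (simp add: field_simps)
  finally show "p x \<le> 1" .
qed

lemma csn_add:
  assumes "csn p" "csn q"
  shows "csn (\<lambda>x. p x + q x)"
  unfolding cont_seminorm_def
proof
  show "seminorm_on smul S (\<lambda>x. p x + q x)"
    unfolding seminorm_on_def
  proof (intro conjI ballI allI)
    fix x y assume "x \<in> S" "y \<in> S"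
    then show "p (x + y) + q (x + y) \<le> p x + q x + (p y + q y)"
      using csn_triangle[OF assms(1), of x y] csn_triangle[OF assms(2), of x y] by simp
  qed (simp add: csn_scale assms distrib_left)
  show "continuous_map T euclideanreal (\<lambda>x. p x + q x)"
    using assms by (intro continuous_map_add) (auto simp: cont_seminorm_def)
qed

lemma csn_mult:
  assumes "csn p" "c \<ge> 0"
  shows "csn (\<lambda>x. c * p x)"
proof (rule csn_dominated)
  show "seminorm_on smul S (\<lambda>x. c * p x)"
    using assms unfolding cont_seminorm_def seminorm_on_def
    by (auto simp: distrib_left[symmetric] intro: mult_left_mono)
qed (use assms in auto)

lemma csn_zero: "csn (\<lambda>x. 0)"
  by (simp add: cont_seminorm_def seminorm_on_def)

lemma nhd_0_seminorm:
  assumes U: "openin T U" "0 \<in> U"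
  shows "\<exists>p. csn p \<and> (\<forall>x\<in>S. p x < 1 \<longrightarrow> x \<in> U)"
proof -
  obtain V where V: "openin T V" "0 \<in> V" "convex_wrt smul V" "V \<subseteq> U"
    using locally_convex_space U unfolding locally_convex_space_def by blast
  have VS: "V \<subseteq> S" using V(1) by (rule openin_subset)
  \<comment> \<open>The balanced core of \<open>V\<close>. It inherits convexity from
    \<open>V\<close>, and joint continuity of scalar multiplication at \<open>(0, 0)\<close> puts a
    neighbourhood of 0 into it.\<close>
  define B where "B = {x \<in> S. \<forall>c. norm c \<le> 1 \<longrightarrow> smul c x \<in> V}"
  define P where "P = {z \<in> topspace (prod_topology euclidean T). (\<lambda>(c, x). smul c x) z \<in> V}"
  have P0: "(0, 0) \<in> P" using V(2) by (simp add: P_def)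
  have Popen: "openin (prod_topology euclidean T) P"
    unfolding P_def using tvs V(1) unfolding topological_vector_space_def
    by (intro openin_continuous_map_preimage[where Y = T]) auto
  obtain D W where DW: "openin euclidean D" "openin T W" "(0::'k) \<in> D" "0 \<in> W" "D \<times> W \<subseteq> P"
    using Popen[unfolded openin_prod_topology_alt, rule_format, OF P0] by (elim exE conjE)
  have "open D" using DW(1) by (simp only: open_openin)
  then obtain d where d: "d > 0" "ball 0 d \<subseteq> D"
    using DW(3) by (rule openE)
  have DWV: "smul c x \<in> V" if "norm c < d" "x \<in> W" for c x
  proof -
    have "c \<in> D" using d(2) that(1) by auto
    then have "(c, x) \<in> P" using DW(5) that(2) by auto
    then show ?thesis by (simp add: P_def)
  qed
  \<comment> \<open>For \<open>norm c \<le> 1\<close>, write \<open>c\<close> as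
    \<open>c * (d / 2)\<close> times \<open>2 / d\<close>: the first factor has norm below
    \<open>d\<close>, the second moves \<open>x\<close> into \<open>W\<close>.\<close>
  let ?W = "{x \<in> S. smul (of_real (2 / d)) (x - 0) \<in> W}"
  have Wopen: "openin T ?W"
    using DW(2) by (rule openin_affine_preimage) simp
  have WB: "x \<in> B" if "x \<in> ?W" for x
  proof -
    have "smul c x \<in> V" if "norm c \<le> 1" for c
    proof -
      have "smul (c * of_real (d / 2)) (smul (of_real (2 / d)) x) \<in> V"
        using that d(1) \<open>x \<in> ?W\<close> mult_mono[of "norm c" 1 "d / 2" "d / 2"]
        by (intro DWV) (auto simp: norm_mult norm_divide)
      moreover have "c * of_real (d / 2) * of_real (2 / d) = c"
        using d(1) by (simp add: field_simps)
      ultimately show ?thesis by simp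
    qed
    then show ?thesis using that by (simp add: B_def)
  qed
  have conv: "convex_wrt smul B"
    unfolding convex_wrt_def
  proof (intro ballI allI impI)
    fix x y and t :: real assume x: "x \<in> B" and y: "y \<in> B" and t: "0 \<le> t \<and> t \<le> 1"
    have "smul c (smul (of_real t) x + smul (of_real (1 - t)) y) \<in> V" if c: "norm c \<le> 1" for c
    proof -
      have "smul (of_real t) (smul c x) + smul (of_real (1 - t)) (smul c y) \<in> V"
        using V(3) t x y c unfolding convex_wrt_def B_def by blast
      then show ?thesis by (simp add: scale_right_distrib mult.commute)
    qed
    then show "smul (of_real t) x + smul (of_real (1 - t)) y \<in> B"
      using x y by (auto simp: B_def)
  qed
  have bal: "smul c x \<in> B" if "norm c \<le> 1" "x \<in> B" for c x
  proof -
    have "norm (d * c) \<le> 1" if "norm d \<le> 1" for d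
      using that \<open>norm c \<le> 1\<close> by (simp add: norm_mult mult_le_one)
    then show ?thesis using that by (auto simp: B_def)
  qed
  have absb: "\<exists>t>0. smul (of_real (1 / t)) x \<in> B" if x: "x \<in> S" for x
  proof -
    define R where "R = {r. smul (of_real r) x \<in> ?W}"
    have "continuous_map euclideanreal T (\<lambda>r. smul (of_real r) x)"
      using x by (intro continuous_scale)
        (auto simp: continuous_map_iff_continuous2 intro!: continuous_intros)
    from openin_continuous_map_preimage[OF this Wopen] have "openin euclideanreal R"
      by (simp add: R_def)
    then have "open R" by (simp only: open_openin)
    moreover have "0 \<in> R" using DW(4) by (simp add: R_def)
    ultimately obtain e where e: "e > 0" "ball 0 e \<subseteq> R"
      by (rule openE)
    have "e / 2 \<in> ball 0 e" using e(1) by simp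
    then have "smul (of_real (e / 2)) x \<in> ?W" using e(2) unfolding R_def by blast
    then have "smul (of_real (e / 2)) x \<in> B" by (rule WB)
    then show ?thesis using e(1) by (intro exI[of _ "2 / e"]) auto
  qed
  have g1: "seminorm_on smul S (gauge_on smul B)"
    by (rule seminorm_on_gauge[OF vector_space_axioms subspace_S conv]) (fact bal, fact absb)
  have g2: "x \<in> B" if "x \<in> S" "gauge_on smul B x < 1" for x
    by (rule gauge_on_less_1[OF vector_space_axioms subspace_S conv]) (fact bal, fact absb, fact that, fact that)
  have g3: "gauge_on smul B x \<le> 1" if "x \<in> B" for x
    by (rule gauge_on_le_1[OF vector_space_axioms subspace_S conv]) (fact bal, fact absb, fact that)
  show ?thesis
  proof (intro exI conjI ballI impI)
    show "csn (gauge_on smul B)"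
      using g1 Wopen by (rule csnI) (use DW(4) g3 WB in auto)
    fix x assume "x \<in> S" "gauge_on smul B x < 1"
    then have "x \<in> B" by (rule g2)
    then have "norm (1::'k) \<le> 1 \<longrightarrow> smul 1 x \<in> V" unfolding B_def by blast
    then show "x \<in> U" using V(4) by auto
  qed
qed

lemma nhd_seminorm:
  assumes U: "openin T U" "a \<in> U"
  shows "\<exists>p. csn p \<and> (\<forall>x\<in>S. p (x - a) < 1 \<longrightarrow> x \<in> U)"
proof -
  have a: "a \<in> S" using U openin_subset by blast
  have "continuous_map T T (\<lambda>x. x + a)"
    using a by (intro continuous_add) auto
  then have "openin T {x \<in> S. x + a \<in> U}"
    by (rule openin_continuous_map_preimage) (rule U)
  then obtain p where p: "csn p" "\<And>x. x \<in> S \<Longrightarrow> p x < 1 \<Longrightarrow> x \<in> {x \<in> S. x + a \<in> U}"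
    using nhd_0_seminorm[of "{x \<in> S. x + a \<in> U}"] U(2) by auto
  show ?thesis
  proof (intro exI conjI ballI impI)
    show "csn p" by fact
    fix x assume "x \<in> S" "p (x - a) < 1"
    then show "x \<in> U" using p(2)[of "x - a"] a by simp
  qed
qed

text \<open>From here on a locally convex topology is handled through its continuous seminorms
  alone; limits and closures get analogous descriptions.\<close>

lemma openin_iff_seminorm:
  "openin T U \<longleftrightarrow> U \<subseteq> S \<and> (\<forall>a\<in>U. \<exists>p. csn p \<and> (\<forall>x\<in>S. p (x - a) < 1 \<longrightarrow> x \<in> U))"
proof
  assume "openin T U"
  then show "U \<subseteq> S \<and> (\<forall>a\<in>U. \<exists>p. csn p \<and> (\<forall>x\<in>S. p (x - a) < 1 \<longrightarrow> x \<in> U))"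
    using openin_subset[of T U] nhd_seminorm[of U] by simp
next
  assume *: "U \<subseteq> S \<and> (\<forall>a\<in>U. \<exists>p. csn p \<and> (\<forall>x\<in>S. p (x - a) < 1 \<longrightarrow> x \<in> U))"
  show "openin T U"
  proof (subst openin_subopen, intro ballI)
    fix a assume a: "a \<in> U"
    then obtain p where p: "csn p" "\<And>x. x \<in> S \<Longrightarrow> p (x - a) < 1 \<Longrightarrow> x \<in> U" using * by blast
    show "\<exists>V. openin T V \<and> a \<in> V \<and> V \<subseteq> U"
      using csn_ball_open[OF p(1), of a 1] a * p csn_0[OF p(1)]
      by (intro exI[of _ "{x \<in> S. p (x - a) < 1}"]) auto
  qed
qed

lemma eq_0_if_csn_0:
  assumes "x \<in> S" "\<And>p. csn p \<Longrightarrow> p x = 0"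
  shows "x = 0"
proof (rule ccontr)
  assume "x \<noteq> 0"
  have "Hausdorff_space T" using tvs by (simp add: topological_vector_space_def)
  then obtain U where "openin T U" "0 \<in> U" "x \<notin> U"
    using assms(1) \<open>x \<noteq> 0\<close> subspace_0[OF subspace_S]
    unfolding Hausdorff_space_def disjnt_iff by metis
  then obtain p where "csn p" "p x < 1 \<longrightarrow> x \<in> U"
    using nhd_0_seminorm assms(1) by blast
  then show False using assms(2)[of p] \<open>x \<notin> U\<close> by simp
qed

lemma limitin_iff_seminorm:
  "limitin T f l F \<longleftrightarrow>
     l \<in> S \<and> (\<forall>\<^sub>F n in F. f n \<in> S) \<and> (\<forall>p. csn p \<longrightarrow> ((\<lambda>n. p (f n - l)) \<longlongrightarrow> 0) F)"
proof
  assume lim: "limitin T f l F"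
  then have l: "l \<in> S" by (rule limitin_topspace)
  have ev: "\<forall>\<^sub>F n in F. f n \<in> S"
    using lim l unfolding limitin_def by simp
  have "((\<lambda>n. p (f n - l)) \<longlongrightarrow> 0) F" if p: "csn p" for p
  proof (rule tendstoI)
    fix e :: real assume "e > 0"
    then have "\<forall>\<^sub>F n in F. f n \<in> {x \<in> S. p (x - l) < e}"
      using lim csn_ball_open[OF p l, of e] l csn_0[OF p] unfolding limitin_def
      by (elim conjE allE[of _ "{x \<in> S. p (x - l) < e}"]) simp
    then show "\<forall>\<^sub>F n in F. dist (p (f n - l)) 0 < e"
    proof eventually_elim
      case (elim n)
      then show ?case using csn_nonneg[OF p, of "f n - l"] l by (simp add: dist_real_def)
    qed
  qed
  then show "l \<in> S \<and> (\<forall>\<^sub>F n in F. f n \<in> S) \<and> (\<forall>p. csn p \<longrightarrow> ((\<lambda>n. p (f n - l)) \<longlongrightarrow> 0) F)"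
    using l ev by simp
next
  assume *: "l \<in> S \<and> (\<forall>\<^sub>F n in F. f n \<in> S) \<and> (\<forall>p. csn p \<longrightarrow> ((\<lambda>n. p (f n - l)) \<longlongrightarrow> 0) F)"
  show "limitin T f l F"
    unfolding limitin_def
  proof (intro conjI allI impI)
    fix U assume "openin T U \<and> l \<in> U"
    then obtain p where p: "csn p" "\<And>x. x \<in> S \<Longrightarrow> p (x - l) < 1 \<Longrightarrow> x \<in> U"
      using nhd_seminorm[of U l] by auto
    have "\<forall>\<^sub>F n in F. p (f n - l) < 1"
      using * p(1) by (intro order_tendstoD) auto
    moreover have "\<forall>\<^sub>F n in F. f n \<in> S" using * by simp
    ultimately show "\<forall>\<^sub>F n in F. f n \<in> U"
      by eventually_elim (rule p(2))
  qed (use * in simp)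
qed

lemma in_closure_iff_seminorm:
  "x \<in> T closure_of A \<longleftrightarrow> x \<in> S \<and> (\<forall>p e. csn p \<and> e > 0 \<longrightarrow> (\<exists>y\<in>A \<inter> S. p (y - x) < e))"
proof (intro iffI conjI allI impI)
  assume x: "x \<in> T closure_of A"
  then show xS: "x \<in> S" by (simp add: in_closure_of)
  fix p and e :: real assume pe: "csn p \<and> e > 0"
  then have "openin T {y \<in> S. p (y - x) < e}" "x \<in> {y \<in> S. p (y - x) < e}"
    using xS csn_0[of p] csn_ball_open[of p x e] by simp_all
  then obtain y where "y \<in> A" "y \<in> {y \<in> S. p (y - x) < e}"
    using x unfolding in_closure_of by meson
  then show "\<exists>y\<in>A \<inter> S. p (y - x) < e" by blast
next
  assume *: "x \<in> S \<and> (\<forall>p e. csn p \<and> e > 0 \<longrightarrow> (\<exists>y\<in>A \<inter> S. p (y - x) < e))"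
  show "x \<in> T closure_of A"
    unfolding in_closure_of
  proof (intro conjI allI impI)
    fix U assume "x \<in> U \<and> openin T U"
    then obtain p where p: "csn p" "\<And>y. y \<in> S \<Longrightarrow> p (y - x) < 1 \<Longrightarrow> y \<in> U"
      using nhd_seminorm[of U x] by auto
    then obtain y where "y \<in> A \<inter> S" "p (y - x) < 1" using *[THEN conjunct2, rule_format, of p 1] by auto
    then show "\<exists>y. y \<in> A \<and> y \<in> U" using p(2)[of y] by blast
  qed (use * in simp)
qed

lemma limit_unique: "limitin T f l sequentially \<Longrightarrow> limitin T f l' sequentially \<Longrightarrow> l = l'"
  using tvs limitin_Hausdorff_unique[of T f l sequentially l']
  by (simp add: topological_vector_space_def)

end

lemma continuous_linear_mapI:
  assumes "lcs s T" "lcs s' T'" and lin: "linear_map_on (topspace T) s s' f"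
    and im: "\<And>x. x \<in> topspace T \<Longrightarrow> f x \<in> topspace T'"
    and cont: "\<And>q. cont_seminorm s' T' q \<Longrightarrow>
      \<exists>p C. cont_seminorm s T p \<and> (\<forall>x\<in>topspace T. q (f x) \<le> C * p x)"
  shows "continuous_map T T' f"
  unfolding continuous_map_def
proof (intro conjI allI impI)
  interpret A: lcs s T by fact
  interpret B: lcs s' T' by fact
  have diff: "f (x - y) = f x - f y" if "x \<in> A.S" "y \<in> A.S" for x y
  proof -
    have "f ((x - y) + y) = f (x - y) + f y"
      using lin that A.S_intros unfolding linear_map_on_def by blast
    then show ?thesis by simp
  qed
  fix U assume U: "openin T' U"
  show "openin T {x \<in> A.S. f x \<in> U}"
    unfolding A.openin_iff_seminorm
  proof (intro conjI ballI)
    fix a assume "a \<in> {x \<in> A.S. f x \<in> U}"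
    then have a: "a \<in> A.S" "f a \<in> U" by auto
    obtain q where q: "B.csn q" "\<And>y. y \<in> B.S \<Longrightarrow> q (y - f a) < 1 \<Longrightarrow> y \<in> U"
      using B.nhd_seminorm[OF U a(2)] by blast
    obtain p C where p: "A.csn p" "\<And>x. x \<in> A.S \<Longrightarrow> q (f x) \<le> C * p x"
      using cont[OF q(1)] by blast
    have "f x \<in> U" if x: "x \<in> A.S" "(\<bar>C\<bar> + 1) * p (x - a) < 1" for x
    proof (rule q(2))
      have "q (f x - f a) \<le> C * p (x - a)"
        using p(2)[of "x - a"] diff[OF x(1) a(1)] x(1) a(1) by auto
      also have "\<dots> \<le> (\<bar>C\<bar> + 1) * p (x - a)"
        using A.csn_nonneg[OF p(1), of "x - a"] x(1) a(1) by (intro mult_right_mono) auto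
      finally show "q (f x - f a) < 1" using x(2) by simp
    qed (rule im[OF x(1)])
    then show "\<exists>p. A.csn p \<and> (\<forall>x\<in>A.S. p (x - a) < 1 \<longrightarrow> x \<in> {x \<in> A.S. f x \<in> U})"
      using A.csn_mult[OF p(1), of "\<bar>C\<bar> + 1"] by (intro exI[of _ "\<lambda>x. (\<bar>C\<bar> + 1) * p x"]) auto
  qed auto
qed (simp add: Pi_iff im)

lemma cont_seminorm_compose:
  assumes "linear_map_on (topspace T) s s' f" "continuous_map T T' f" "cont_seminorm s' T' q"
  shows "cont_seminorm s T (\<lambda>x. q (f x))"
  unfolding cont_seminorm_def
proof
  have "f x \<in> topspace T'" if "x \<in> topspace T" for x
    using continuous_map_image_subset_topspace[OF assms(2)] that by blast
  then show "seminorm_on s (topspace T) (\<lambda>x. q (f x))"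
    using assms(1,3) by (simp add: seminorm_on_def linear_map_on_def cont_seminorm_def)
  show "continuous_map T euclideanreal (\<lambda>x. q (f x))"
    using continuous_map_compose[of T T' f euclideanreal q] assms
    by (simp add: cont_seminorm_def o_def)
qed

section \<open>Summation of absolutely summable combinations\<close>

text \<open>Boundedness replaces the convergence to 0 required of an \<open>l1_sequence\<close>:
  combinations of its terms with coefficients in the unit ball of l1, as Gram-Schmidt produces them,
  stay bounded but need not tend to 0.\<close>

definition l1_conv ::
    "('k::real_normed_field \<Rightarrow> 'a::ab_group_add \<Rightarrow> 'a) \<Rightarrow> 'a topology \<Rightarrow> (nat \<Rightarrow> 'a) \<Rightarrow> bool" where
  "l1_conv smul T v \<longleftrightarrow>
     (\<forall>k. v k \<in> topspace T) \<and>
     (\<forall>p. cont_seminorm smul T p \<longrightarrow> (\<exists>B. \<forall>k. p (v k) \<le> B)) \<and>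
     (\<forall>a. summable (\<lambda>k. norm (a k)) \<longrightarrow>
        (\<exists>s. limitin T (\<lambda>N. \<Sum>k<N. smul (a k) (v k)) s sequentially))"

context lcs
begin

lemma csn_limit:
  assumes "csn p" "limitin T f l F"
  shows "((\<lambda>n. p (f n)) \<longlongrightarrow> p l) F"
proof -
  have "limitin euclideanreal (p \<circ> f) (p l) F"
    using assms by (intro continuous_map_limit) (auto simp: cont_seminorm_def)
  then show ?thesis by (simp add: o_def limitin_canonical_iff)
qed

lemma limitin_csn_bound:
  assumes "csn p" "limitin T f l sequentially" "\<And>n. n \<ge> m \<Longrightarrow> p (f n) \<le> b"
  shows "p l \<le> b"
  using csn_limit[OF assms(1,2)]
  by (rule tendsto_upperbound) (use assms(3) in \<open>auto simp: eventually_sequentially\<close>)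

lemma limitin_add:
  assumes "limitin T f l F" "limitin T g m F"
  shows "limitin T (\<lambda>n. f n + g n) (l + m) F"
proof -
  have "limitin T ((\<lambda>(x, y). x + y) \<circ> (\<lambda>n. (f n, g n))) ((\<lambda>(x, y). x + y) (l, m)) F"
  proof (rule continuous_map_limit)
    show "continuous_map (prod_topology T T) T (\<lambda>(x, y). x + y)"
      using tvs by (simp add: topological_vector_space_def)
    show "limitin (prod_topology T T) (\<lambda>n. (f n, g n)) (l, m) F"
      using assms by (simp add: limitin_pairwise o_def)
  qed
  then show ?thesis by (simp add: o_def)
qed

lemma limitin_scale:
  assumes "limitin T f l F"
  shows "limitin T (\<lambda>n. smul c (f n)) (smul c l) F"
proof -
  have "limitin T (smul c \<circ> f) (smul c l) F"
  proof (rule continuous_map_limit)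
    show "continuous_map T T (smul c)"
      using continuous_scale[of T "\<lambda>x. c" "\<lambda>x. x"] by simp
  qed (rule assms)
  then show ?thesis by (simp add: o_def)
qed

lemma limitin_const: "l \<in> S \<Longrightarrow> limitin T (\<lambda>n. l) l F"
  by simp

lemma l1_sequence_imp_l1_conv:
  assumes "l1_sequence smul T x"
  shows "l1_conv smul T x"
  unfolding l1_conv_def
proof (intro conjI allI impI)
  show "x k \<in> S" for k using assms by (auto simp: l1_sequence_def)
  show "\<exists>s. limitin T (\<lambda>N. \<Sum>k<N. smul (a k) (x k)) s sequentially"
    if "summable (\<lambda>k. norm (a k))" for a
    using assms that by (simp add: l1_sequence_def)
  fix p assume p: "csn p"
  have "(\<lambda>n. p (x n)) \<longlonglongrightarrow> p 0"
    using p assms by (intro csn_limit) (auto simp: l1_sequence_def)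
  then have "Bseq (\<lambda>n. p (x n))" by (intro convergent_imp_Bseq convergentI)
  then obtain B where B: "\<And>n. norm (p (x n)) \<le> B" by (auto simp: Bseq_def)
  have "p (x k) \<le> B" for k using B[of k] by (simp add: abs_le_iff)
  then show "\<exists>B. \<forall>k. p (x k) \<le> B" by blast
qed

lemma l1_convD:
  assumes "l1_conv smul T v"
  shows "v k \<in> S" "csn p \<Longrightarrow> \<exists>B. \<forall>k. p (v k) \<le> B"
    "summable (\<lambda>k. norm (a k)) \<Longrightarrow> \<exists>s. limitin T (\<lambda>N. \<Sum>k<N. smul (a k) (v k)) s sequentially"
  using assms by (auto simp: l1_conv_def)

lemma csn_lin_comb_le:
  assumes p: "csn p" and I: "\<And>k. k \<in> I \<Longrightarrow> v k \<in> S" and B: "\<And>k. k \<in> I \<Longrightarrow> p (v k) \<le> B"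
  shows "p (\<Sum>k\<in>I. smul (a k) (v k)) \<le> B * (\<Sum>k\<in>I. norm (a k))"
proof -
  have "p (\<Sum>k\<in>I. smul (a k) (v k)) \<le> (\<Sum>k\<in>I. p (smul (a k) (v k)))"
    using I by (intro csn_sum[OF p]) auto
  also have "\<dots> \<le> (\<Sum>k\<in>I. B * norm (a k))"
  proof (rule sum_mono)
    fix k assume "k \<in> I"
    then show "p (smul (a k) (v k)) \<le> B * norm (a k)"
      using csn_scale[OF p I] mult_right_mono[OF B, of k "norm (a k)"] by (simp add: mult.commute)
  qed
  finally show ?thesis by (simp add: sum_distrib_left)
qed

definition l1_sum :: "(nat \<Rightarrow> 'a) \<Rightarrow> (nat \<Rightarrow> 'k) \<Rightarrow> 'a" where
  "l1_sum v a = (SOME s. limitin T (\<lambda>N. \<Sum>k<N. smul (a k) (v k)) s sequentially)"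

lemma l1_sum_limit:
  assumes "l1_conv smul T v" "summable (\<lambda>k. norm (a k))"
  shows "limitin T (\<lambda>N. \<Sum>k<N. smul (a k) (v k)) (l1_sum v a) sequentially"
  unfolding l1_sum_def using l1_convD(3)[OF assms] by (rule someI_ex)

lemma l1_sum_eqI:
  assumes "limitin T (\<lambda>N. \<Sum>k<N. smul (a k) (v k)) s sequentially"
  shows "l1_sum v a = s"
  unfolding l1_sum_def using assms by (rule some_equality) (rule limit_unique[OF _ assms])

lemma l1_sum_in_S: "l1_conv smul T v \<Longrightarrow> summable (\<lambda>k. norm (a k)) \<Longrightarrow> l1_sum v a \<in> S"
  by (rule limitin_topspace[OF l1_sum_limit])

lemma csn_l1_sum_le:
  assumes v: "l1_conv smul T v" and a: "summable (\<lambda>k. norm (a k))" and p: "csn p"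
    and B: "\<And>k. p (v k) \<le> B"
  shows "p (l1_sum v a) \<le> B * (suminf (\<lambda>k. norm (a k)))"
  using p l1_sum_limit[OF v a]
proof (rule limitin_csn_bound[where m = 0])
  fix N
  have "B \<ge> 0" using csn_nonneg[OF p l1_convD(1)[OF v]] B order_trans by blast
  have "p (\<Sum>k<N. smul (a k) (v k)) \<le> B * (\<Sum>k<N. norm (a k))"
    using l1_convD(1)[OF v] B by (intro csn_lin_comb_le[OF p])
  also have "\<dots> \<le> B * (suminf (\<lambda>k. norm (a k)))"
    using \<open>B \<ge> 0\<close> a by (intro mult_left_mono sum_le_suminf) auto
  finally show "p (\<Sum>k<N. smul (a k) (v k)) \<le> B * (suminf (\<lambda>k. norm (a k)))" .
qed

text \<open>The coefficients are eventually 0, so the representation holds for every large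
  \<open>n\<close>. This form lets finitely many vectors share one summation range.\<close>

lemma span_range_rep:
  fixes z :: "nat \<Rightarrow> 'a"
  assumes "e \<in> span (range z)"
  shows "\<exists>\<alpha> n0 C. (\<forall>n\<ge>n0. e = (\<Sum>j<n. smul (\<alpha> j) (z j))) \<and> (\<forall>J. (\<Sum>j<J. norm (\<alpha> j)) \<le> C)"
  using assms
proof (induction rule: span_induct_alt)
  case base
  show ?case by (intro exI[of _ "\<lambda>_. 0"] exI[of _ 0]) auto
next
  case (step c x y)
  obtain \<alpha> n0 C where *: "\<And>n. n \<ge> n0 \<Longrightarrow> y = (\<Sum>j<n. smul (\<alpha> j) (z j))" "\<And>J. (\<Sum>j<J. norm (\<alpha> j)) \<le> C"
    using step by blast
  obtain i where i: "x = z i" using step by blast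
  let ?\<beta> = "\<lambda>j. (if j = i then c else 0) + \<alpha> j"
  have rep: "smul c x + y = (\<Sum>j<n. smul (?\<beta> j) (z j))" if "n \<ge> max n0 (Suc i)" for n
  proof -
    have "(\<Sum>j<n. smul (?\<beta> j) (z j)) = (\<Sum>j<n. smul (if j = i then c else 0) (z j)) + y"
      using that *(1)[of n] by (simp add: scale_left_distrib sum.distrib)
    also have "(\<Sum>j<n. smul (if j = i then c else 0) (z j)) = (\<Sum>j<n. if j = i then smul c (z i) else 0)"
      by (rule sum.cong) auto
    also have "\<dots> = smul c x" using that i by simp
    finally show ?thesis by simp
  qed
  have bnd: "(\<Sum>j<J. norm (?\<beta> j)) \<le> norm c + C" for J
  proof -
    have "(\<Sum>j<J. norm (?\<beta> j)) \<le> (\<Sum>j<J. (if j = i then norm c else 0) + norm (\<alpha> j))"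
    proof (rule sum_mono)
      fix j
      show "norm (?\<beta> j) \<le> (if j = i then norm c else 0) + norm (\<alpha> j)"
        using norm_triangle_ineq[of c "\<alpha> j"] by auto
    qed
    also have "\<dots> = (\<Sum>j<J. if j = i then norm c else 0) + (\<Sum>j<J. norm (\<alpha> j))"
      by (rule sum.distrib)
    also have "\<dots> \<le> norm c + C"
      using *(2)[of J] by (intro add_mono) simp_all
    finally show ?thesis .
  qed
  show ?case
    by (rule exI[of _ ?\<beta>], rule exI[of _ "max n0 (Suc i)"], rule exI[of _ "norm c + C"])
      (use rep bnd in blast)
qed

end

text \<open>The rearranged series has the coefficients \<open>\<lambda>j. suminf (\<lambda>k. a k * \<alpha> k j)\<close>, which is where
  completeness of the scalars enters.\<close>

lemma l1_conv_lin_combs: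
  fixes smul :: "'k::{real_normed_field, banach} \<Rightarrow> 'a::ab_group_add \<Rightarrow> 'a"
  assumes "lcs smul T" and z: "l1_conv smul T z"
    and y: "\<And>k. \<exists>n0. \<forall>n\<ge>n0. y k = (\<Sum>j<n. smul (\<alpha> k j) (z j))"
    and \<alpha>: "\<And>k J. (\<Sum>j<J. norm (\<alpha> k j)) \<le> 1"
  shows "l1_conv smul T y"
  unfolding l1_conv_def
proof (intro conjI allI impI)
  interpret lcs smul T by fact
  show yS: "y k \<in> S" for k
  proof -
    obtain n where "y k = (\<Sum>j<n. smul (\<alpha> k j) (z j))" using y[of k] by blast
    then show ?thesis using l1_convD(1)[OF z] by (auto intro!: S_sum)
  qed
  show "\<exists>B. \<forall>k. p (y k) \<le> B" if p: "csn p" for p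
  proof -
    obtain B where B: "\<And>k. p (z k) \<le> B" using l1_convD(2)[OF z p] by blast
    have "B \<ge> 0" using csn_nonneg[OF p l1_convD(1)[OF z, of 0]] B[of 0] by simp
    have "p (y k) \<le> B" for k
    proof -
      obtain n where "y k = (\<Sum>j<n. smul (\<alpha> k j) (z j))" using y[of k] by blast
      then have "p (y k) \<le> B * (\<Sum>j<n. norm (\<alpha> k j))"
        using l1_convD(1)[OF z] B by (auto intro: csn_lin_comb_le[OF p])
      also have "\<dots> \<le> B * 1" using \<alpha> \<open>B \<ge> 0\<close> by (rule mult_left_mono)
      finally show ?thesis by simp
    qed
    then show ?thesis by blast
  qed
  fix a :: "nat \<Rightarrow> 'k" assume a: "summable (\<lambda>k. norm (a k))"
  \<comment> \<open>\<open>\<beta> M\<close> holds the coefficients, with respect to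
    \<open>z\<close>, of the tail of the series from \<open>M\<close> on; \<open>\<beta> 0\<close>
    belongs to the whole series.\<close>
  define \<beta> where "\<beta> M j = (suminf (\<lambda>k. a (k + M) * \<alpha> (k + M) j))" for M j
  have \<alpha>1: "norm (\<alpha> k j) \<le> 1" for k j
  proof -
    have "norm (\<alpha> k j) \<le> (\<Sum>j<Suc j. norm (\<alpha> k j))"
      by (rule member_le_sum) auto
    then show ?thesis using \<alpha>[where k = k and J = "Suc j"] by simp
  qed
  have aM: "summable (\<lambda>k. norm (a (k + M)))" for M
    using a by (simp add: summable_iff_shift[of "\<lambda>k. norm (a k)"])
  have prod: "summable (\<lambda>k. norm (a (k + M) * \<alpha> (k + M) j))" for M j
  proof (rule summable_comparison_test'[OF aM[of M], of 0])
    fix k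
    show "norm (norm (a (k + M) * \<alpha> (k + M) j)) \<le> norm (a (k + M))"
      using \<alpha>1[of "k + M" j] by (simp add: norm_mult mult_left_le)
  qed
  have tail: "(\<Sum>j<J. norm (\<beta> M j)) \<le> (suminf (\<lambda>k. norm (a (k + M))))" for J M
  proof -
    have "(\<Sum>j<J. norm (\<beta> M j)) \<le> (\<Sum>j<J. suminf (\<lambda>k. norm (a (k + M) * \<alpha> (k + M) j)))"
      unfolding \<beta>_def by (intro sum_mono summable_norm prod)
    also have "\<dots> = (suminf (\<lambda>k. \<Sum>j<J. norm (a (k + M) * \<alpha> (k + M) j)))"
      using prod by (intro suminf_sum[symmetric])
    also have "\<dots> \<le> (suminf (\<lambda>k. norm (a (k + M))))"
    proof (rule suminf_le)
      show "summable (\<lambda>k. \<Sum>j<J. norm (a (k + M) * \<alpha> (k + M) j))"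
        using prod by (intro summable_sum)
      fix k
      have "(\<Sum>j<J. norm (a (k + M) * \<alpha> (k + M) j)) = norm (a (k + M)) * (\<Sum>j<J. norm (\<alpha> (k + M) j))"
        by (simp add: norm_mult sum_distrib_left)
      also have "\<dots> \<le> norm (a (k + M))"
        using \<alpha> by (intro mult_left_le) auto
      finally show "(\<Sum>j<J. norm (a (k + M) * \<alpha> (k + M) j)) \<le> norm (a (k + M))" .
    qed (rule aM)
    finally show ?thesis .
  qed
  have "summable (\<lambda>j. norm (\<beta> 0 j))"
    using tail[where M = 0] by (intro summableI_nonneg_bounded) simp_all
  then have lim: "limitin T (\<lambda>J. \<Sum>j<J. smul (\<beta> 0 j) (z j)) (l1_sum z (\<beta> 0)) sequentially"
    by (rule l1_sum_limit[OF z])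
  have sS: "l1_sum z (\<beta> 0) \<in> S" using lim by (rule limitin_topspace)
  have zS: "z j \<in> S" for j using l1_convD(1)[OF z] .
  have PS: "(\<Sum>k<M. smul (a k) (y k)) \<in> S" for M
    using yS by (intro S_sum) auto
  have bound: "p (l1_sum z (\<beta> 0) - (\<Sum>k<M. smul (a k) (y k))) \<le> B * (suminf (\<lambda>k. norm (a (k + M))))"
    if p: "csn p" and B: "\<And>k. p (z k) \<le> B" for p B M
  proof -
    have "B \<ge> 0" using csn_nonneg[OF p zS[of 0]] B[of 0] by simp
    obtain n where n: "\<And>k m. m \<ge> n k \<Longrightarrow> y k = (\<Sum>j<m. smul (\<alpha> k j) (z j))"
      using y by metis
    \<comment> \<open>A sum is used as a convenient common upper bound of all \<open>n k\<close>
      with \<open>k < M\<close>.\<close>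
    define n0 where "n0 = (\<Sum>k<M. n k)"
    have "limitin T (\<lambda>J. (\<Sum>j<J. smul (\<beta> 0 j) (z j)) + - (\<Sum>k<M. smul (a k) (y k)))
        (l1_sum z (\<beta> 0) + - (\<Sum>k<M. smul (a k) (y k))) sequentially"
      using PS by (intro limitin_add[OF lim] limitin_const) auto
    then have "p (l1_sum z (\<beta> 0) + - (\<Sum>k<M. smul (a k) (y k))) \<le> B * (suminf (\<lambda>k. norm (a (k + M))))"
    proof (rule limitin_csn_bound[OF p, where m = n0])
      fix J assume J: "J \<ge> n0"
      have nJ: "n k \<le> J" if "k < M" for k
        using member_le_sum[of k "{..<M}" n] that J by (simp add: n0_def)
      have "(\<Sum>k<M. smul (a k) (y k)) = (\<Sum>k<M. smul (a k) (\<Sum>j<J. smul (\<alpha> k j) (z j)))"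
        using n nJ by (intro sum.cong) auto
      also have "\<dots> = (\<Sum>k<M. \<Sum>j<J. smul (a k * \<alpha> k j) (z j))"
        by (simp add: scale_sum_right)
      also have "\<dots> = (\<Sum>j<J. smul (\<Sum>k<M. a k * \<alpha> k j) (z j))"
        by (subst sum.swap) (simp add: scale_sum_left)
      finally have "(\<Sum>j<J. smul (\<beta> 0 j) (z j)) + - (\<Sum>k<M. smul (a k) (y k)) =
          (\<Sum>j<J. smul (\<beta> 0 j - (\<Sum>k<M. a k * \<alpha> k j)) (z j))"
        by (simp add: scale_left_diff_distrib sum_subtractf)
      \<comment> \<open>Removing the first \<open>M\<close> terms from the series defining
        \<open>\<beta> 0 j\<close> leaves \<open>\<beta> M j\<close>, whose l1 norm is bounded by
        the tail of \<open>a\<close>.\<close>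
      also have "\<dots> = (\<Sum>j<J. smul (\<beta> M j) (z j))"
      proof (rule sum.cong)
        fix j
        have "summable (\<lambda>k. a k * \<alpha> k j)"
          using summable_norm_cancel[OF prod[of 0 j]] by simp
        from suminf_split_initial_segment[OF this, of M]
        show "smul (\<beta> 0 j - (\<Sum>k<M. a k * \<alpha> k j)) (z j) = smul (\<beta> M j) (z j)"
          by (simp add: \<beta>_def)
      qed simp
      also have "p \<dots> \<le> B * (\<Sum>j<J. norm (\<beta> M j))"
        using zS B by (intro csn_lin_comb_le[OF p])
      also have "\<dots> \<le> B * (suminf (\<lambda>k. norm (a (k + M))))"
        using tail \<open>B \<ge> 0\<close> by (intro mult_left_mono)
      finally show "p ((\<Sum>j<J. smul (\<beta> 0 j) (z j)) + - (\<Sum>k<M. smul (a k) (y k)))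
          \<le> B * (suminf (\<lambda>k. norm (a (k + M))))" .
    qed
    then show ?thesis by simp
  qed
  have "limitin T (\<lambda>M. \<Sum>k<M. smul (a k) (y k)) (l1_sum z (\<beta> 0)) sequentially"
    unfolding limitin_iff_seminorm
  proof (intro conjI allI impI)
    fix p assume p: "csn p"
    obtain B where B: "\<And>k. p (z k) \<le> B" using l1_convD(2)[OF z p] by blast
    have "(\<lambda>M. B * (suminf (\<lambda>k. norm (a (k + M))))) \<longlonglongrightarrow> B * 0"
      using a by (intro tendsto_mult_left suminf_exist_split2)
    then have "(\<lambda>M. B * (suminf (\<lambda>k. norm (a (k + M))))) \<longlonglongrightarrow> 0" by simp
    then show "(\<lambda>M. p ((\<Sum>k<M. smul (a k) (y k)) - l1_sum z (\<beta> 0))) \<longlonglongrightarrow> 0"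
    proof (rule Lim_null_comparison[rotated])
      show "\<forall>\<^sub>F M in sequentially. norm (p ((\<Sum>k<M. smul (a k) (y k)) - l1_sum z (\<beta> 0)))
          \<le> B * (suminf (\<lambda>k. norm (a (k + M))))"
      proof (rule always_eventually, rule allI)
        fix M
        show "norm (p ((\<Sum>k<M. smul (a k) (y k)) - l1_sum z (\<beta> 0)))
            \<le> B * (suminf (\<lambda>k. norm (a (k + M))))"
          using bound[OF p B, of M] csn_minus_commute[OF p sS PS[of M]]
            csn_nonneg[OF p, of "l1_sum z (\<beta> 0) - (\<Sum>k<M. smul (a k) (y k))"] sS PS[of M]
          by simp
      qed
    qed
  qed (use sS PS in auto)
  then show "\<exists>s. limitin T (\<lambda>N. \<Sum>k<N. smul (a k) (y k)) s sequentially" by blast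
qed

section \<open>Seminorms of finite rank and weak topologies\<close>

context lcs
begin

definition bdd_functional :: "('a \<Rightarrow> real) \<Rightarrow> ('a \<Rightarrow> 'k) \<Rightarrow> bool" where
  "bdd_functional p f \<longleftrightarrow> linear_map_on S smul (*) f \<and> (\<exists>C. \<forall>x\<in>S. norm (f x) \<le> C * p x)"

text \<open>The kernel of \<open>p\<close> has finite codimension, expressed by coordinates on the
  quotient that are bounded by \<open>p\<close>.\<close>

definition finite_rank :: "('a \<Rightarrow> real) \<Rightarrow> bool" where
  "finite_rank p \<longleftrightarrow> (\<exists>(m::nat) e f. (\<forall>i<m. e i \<in> S \<and> bdd_functional p (f i)) \<and>
     (\<forall>x\<in>S. p (x - (\<Sum>i<m. smul (f i x) (e i))) = 0))"

lemma linear_map_onD: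
  assumes "linear_map_on S smul (*) f"
  shows "x \<in> S \<Longrightarrow> y \<in> S \<Longrightarrow> f (x + y) = f x + f y"
    "x \<in> S \<Longrightarrow> f (smul c x) = c * f x" "f 0 = 0" "x \<in> S \<Longrightarrow> y \<in> S \<Longrightarrow> f (x - y) = f x - f y"
    "(\<And>i. i \<in> I \<Longrightarrow> g i \<in> S) \<Longrightarrow> f (\<Sum>i\<in>I. g i) = (\<Sum>i\<in>I. f (g i))"
proof -
  show add: "f (x + y) = f x + f y" if "x \<in> S" "y \<in> S" for x y
    using assms that by (simp add: linear_map_on_def)
  show scale: "f (smul c x) = c * f x" if "x \<in> S" for c x
    using assms that by (simp add: linear_map_on_def)
  show zero: "f 0 = 0" using scale[of 0 0] by simp
  show "f (x - y) = f x - f y" if "x \<in> S" "y \<in> S" for x y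
    using add[of "x - y" y] that by (simp add: algebra_simps)
  show "f (\<Sum>i\<in>I. g i) = (\<Sum>i\<in>I. f (g i))" if "\<And>i. i \<in> I \<Longrightarrow> g i \<in> S"
    using that by (induction I rule: infinite_finite_induct) (auto simp: zero add S_sum)
qed

lemma bdd_functional_continuous:
  assumes f: "bdd_functional p f" and p: "csn p"
  shows "continuous_map T euclidean f"
  unfolding continuous_map_def
proof (intro conjI allI impI)
  have lin: "linear_map_on S smul (*) f" using f by (simp add: bdd_functional_def)
  obtain C where C: "\<And>x. x \<in> S \<Longrightarrow> norm (f x) \<le> C * p x"
    using f by (auto simp: bdd_functional_def)
  have "seminorm_on smul S (\<lambda>x. norm (f x))"
    unfolding seminorm_on_def using linear_map_onD(1,2)[OF lin]
    by (auto simp: norm_mult intro: norm_triangle_ineq)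
  then have nf: "csn (\<lambda>x. norm (f x))" using p C by (rule csn_dominated)
  fix U :: "'k set" assume "openin euclidean U"
  then have U: "open U" by (simp only: open_openin)
  show "openin T {x \<in> S. f x \<in> U}"
  proof (subst openin_subopen, intro ballI)
    fix a assume "a \<in> {x \<in> S. f x \<in> U}"
    then have a: "a \<in> S" "f a \<in> U" by auto
    obtain e where e: "e > 0" "ball (f a) e \<subseteq> U" using U a(2) by (rule openE)
    have "f x \<in> U" if "x \<in> S" "norm (f (x - a)) < e" for x
      using e(2) that linear_map_onD(4)[OF lin that(1) a(1)]
      by (auto simp: dist_norm norm_minus_commute)
    then show "\<exists>V. openin T V \<and> a \<in> V \<and> V \<subseteq> {x \<in> S. f x \<in> U}"
      using csn_ball_open[OF nf a(1), of e] a(1) e(1) linear_map_onD(3)[OF lin]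
      by (intro exI[of _ "{x \<in> S. norm (f (x - a)) < e}"]) auto
  qed
qed simp

text \<open>Used in contrapositive form: a topology that is not weak has a continuous seminorm
  without finite rank. If \<open>p\<close> has finite rank, finitely many continuous functionals
  control it, so its balls are weak neighbourhoods.\<close>

lemma weak_topology_if_finite_rank:
  assumes fr: "\<And>p. csn p \<Longrightarrow> finite_rank p"
  shows "weak_topology smul T"
proof -
  define Y where "Y = {f. linear_map_on S smul (*) f \<and> continuous_map T euclidean f}"
  have bddY: "f \<in> Y" if "bdd_functional p f" "csn p" for p f
    using that bdd_functional_continuous by (auto simp: Y_def bdd_functional_def)
  have eq: "p x = 0" if p: "csn p" and x: "x \<in> S" and Y0: "\<And>f. f \<in> Y \<Longrightarrow> f x = 0" for p x
  proof -
    obtain m :: nat and e f where ef: "\<And>i. i < m \<Longrightarrow> e i \<in> S \<and> bdd_functional p (f i)"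
      "\<And>x. x \<in> S \<Longrightarrow> p (x - (\<Sum>i<m. smul (f i x) (e i))) = 0"
      using fr[OF p] unfolding finite_rank_def by blast
    have "(\<Sum>i<m. smul (f i x) (e i)) = 0"
      using ef(1) bddY[OF _ p] Y0 by (intro sum.neutral) auto
    then show ?thesis using ef(2)[OF x] by simp
  qed
  have sep: "separating_functionals smul S Y"
    unfolding separating_functionals_def
  proof (intro conjI ballI allI impI)
    show "linear_map_on S smul (*) f" if "f \<in> Y" for f using that by (simp add: Y_def)
    show "(\<lambda>x. 0) \<in> Y" by (simp add: Y_def linear_map_on_def)
    show "(\<lambda>x. f x + g x) \<in> Y" if "f \<in> Y" "g \<in> Y" for f g
      using that by (simp add: Y_def linear_map_on_def distrib_left continuous_map_add)
    show "(\<lambda>x. c * f x) \<in> Y" if "f \<in> Y" for c f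
    proof -
      have "continuous_map T euclidean ((*) c \<circ> f)"
        using that by (intro continuous_map_compose[of _ euclidean])
          (auto simp: Y_def continuous_map_iff_continuous2 intro!: continuous_intros)
      then show ?thesis using that by (simp add: Y_def linear_map_on_def distrib_left o_def)
    qed
    fix x y assume xy: "x \<in> S" "y \<in> S" "x \<noteq> y"
    show "\<exists>f\<in>Y. f x \<noteq> f y"
    proof (rule ccontr)
      assume "\<not> (\<exists>f\<in>Y. f x \<noteq> f y)"
      then have "f (x - y) = 0" if "f \<in> Y" for f
        using that xy linear_map_onD(4)[of f x y] by (auto simp: Y_def)
      then have "x - y = 0" using xy eq by (intro eq_0_if_csn_0) auto
      then show False using xy by simp
    qed
  qed
  define G where "G = {{x \<in> S. f x \<in> U} | f U. f \<in> Y \<and> open U}"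
  have G: "{x \<in> S. f x \<in> U} \<in> G" if "f \<in> Y" "open U" for f U
    using that by (auto simp: G_def)
  \<comment> \<open>The zero functional contributes \<open>S\<close> itself, so the generated
    topology lives on all of \<open>S\<close>.\<close>
  have "S \<in> G" using G[of "\<lambda>x. 0" UNIV] sep by (simp add: separating_functionals_def)
  have "V \<subseteq> S" if "V \<in> G" for V
    using that by (auto simp: G_def)
  then have top: "topspace (topology_generated_by G) = S"
    using \<open>S \<in> G\<close> unfolding topology_generated_by_topspace by blast
  have "openin T U = openin (topology_generated_by G) U" for U
  proof
    assume U: "openin T U"
    show "openin (topology_generated_by G) U"
    proof (subst openin_subopen, intro ballI)
      fix a assume "a \<in> U"
      then obtain p where p: "csn p" "\<And>x. x \<in> S \<Longrightarrow> p (x - a) < 1 \<Longrightarrow> x \<in> U"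
        using nhd_seminorm[OF U, of a] by auto
      have a: "a \<in> S" using openin_subset[OF U] \<open>a \<in> U\<close> by blast
      obtain m :: nat and e f where ef: "\<And>i. i < m \<Longrightarrow> e i \<in> S \<and> bdd_functional p (f i)"
        "\<And>x. x \<in> S \<Longrightarrow> p (x - (\<Sum>i<m. smul (f i x) (e i))) = 0"
        using fr[OF p(1)] unfolding finite_rank_def by blast
      have eS: "\<And>i. i < m \<Longrightarrow> e i \<in> S" and fY: "\<And>i. i < m \<Longrightarrow> f i \<in> Y"
        using ef(1) bddY[OF _ p(1)] by auto
      define K where "K = (\<Sum>i<m. p (e i))"
      have K: "K \<ge> 0" unfolding K_def using csn_nonneg[OF p(1)] eS by (intro sum_nonneg) auto
      \<comment> \<open>If every coordinate of \<open>x - a\<close> is at most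
        \<open>\<delta>\<close>, then \<open>p (x - a)\<close> is at most
        \<open>\<delta> * K\<close>, which is below 1.\<close>
      define \<delta> where "\<delta> = 1 / (1 + K)"
      have \<delta>: "\<delta> > 0" "\<delta> * K < 1" using K by (auto simp: \<delta>_def)
      \<comment> \<open>Intersecting with the whole space covers \<open>m = 0\<close>, where the
        intersection over no indices would be the entire type.\<close>
      define W where "W = (\<Inter>i\<in>{..<m}. {x \<in> S. f i x \<in> ball (f i a) \<delta>}) \<inter> topspace (topology_generated_by G)"
      have "openin (topology_generated_by G) W"
        unfolding W_def
        by (rule openin_INT) (simp, rule topology_generated_by_Basis, rule G, use fY in simp, rule open_ball)
      moreover have "a \<in> W" unfolding W_def top using a \<delta>(1) by simp
      moreover have "x \<in> U" if x: "x \<in> W" for x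
      proof (rule p(2))
        show xS: "x \<in> S" using x unfolding W_def top by simp
        have xa: "x - a \<in> S" using xS a by simp
        let ?s = "\<Sum>i<m. smul (f i (x - a)) (e i)"
        have sS: "?s \<in> S" using eS by (intro S_sum) auto
        have "p (x - a) \<le> p (x - a - ?s) + p ?s"
          using csn_triangle[OF p(1), of "x - a - ?s" ?s] xa sS by simp
        also have "\<dots> = p ?s" using ef(2)[OF xa] by simp
        also have "\<dots> \<le> (\<Sum>i<m. p (smul (f i (x - a)) (e i)))"
          using eS by (intro csn_sum[OF p(1)]) auto
        also have "\<dots> \<le> (\<Sum>i<m. \<delta> * p (e i))"
        proof (rule sum_mono)
          fix i assume i: "i \<in> {..<m}"
          have "f i (x - a) = f i x - f i a"
            using fY[of i] i xS a by (intro linear_map_onD(4)) (auto simp: Y_def)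
          moreover have "f i x \<in> ball (f i a) \<delta>" using x i unfolding W_def by blast
          ultimately have "norm (f i (x - a)) \<le> \<delta>"
            by (simp add: dist_norm norm_minus_commute)
          then show "p (smul (f i (x - a)) (e i)) \<le> \<delta> * p (e i)"
            using csn_scale[OF p(1), of "e i"] eS[of i] i csn_nonneg[OF p(1), of "e i"]
            by (auto intro: mult_right_mono)
        qed
        also have "\<dots> < 1" using \<delta>(2) by (simp add: K_def sum_distrib_left)
        finally show "p (x - a) < 1" .
      qed
      ultimately show "\<exists>W. openin (topology_generated_by G) W \<and> a \<in> W \<and> W \<subseteq> U"
        by (intro exI[of _ W]) auto
    qed
  next
    assume "openin (topology_generated_by G) U"
    then have gen: "generate_topology_on G U" by (rule openin_topology_generated_by)
    have GT: "openin T V" if V: "V \<in> G" for V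
    proof -
      obtain f U where fU: "V = {x \<in> S. f x \<in> U}" "f \<in> Y" "open U" using V by (auto simp: G_def)
      have "openin euclidean U" using fU(3) by (simp only: open_openin)
      moreover have "continuous_map T euclidean f" using fU(2) by (simp add: Y_def)
      ultimately show ?thesis unfolding fU(1) by (rule openin_continuous_map_preimage[rotated])
    qed
    show "openin T U"
      using istopology_openin GT gen by (rule generate_topology_on_coarsest)
  qed
  then have "T = sigma_topology S Y"
    unfolding sigma_topology_def G_def[symmetric] by (simp add: topology_eq)
  then show ?thesis using sep by (auto simp: weak_topology_def)
qed

end

section \<open>Biorthogonal systems\<close>

context lcs
begin

definition residual :: "(nat \<Rightarrow> 'a) \<Rightarrow> (nat \<Rightarrow> 'a \<Rightarrow> 'k) \<Rightarrow> nat \<Rightarrow> 'a \<Rightarrow> 'a" where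
  "residual e f m x = x - (\<Sum>i<m. smul (f i x) (e i))"

lemma residual_Suc: "residual e f (Suc m) x = residual e f m x - smul (f m x) (e m)"
  by (simp add: residual_def algebra_simps)

lemma bdd_functional_lin: "bdd_functional p f \<Longrightarrow> linear_map_on S smul (*) f"
  by (simp add: bdd_functional_def)

lemma bdd_functional_zero:
  assumes "bdd_functional p f" "x \<in> S" "p x = 0"
  shows "f x = 0"
proof -
  obtain C where "norm (f x) \<le> C * p x"
    using assms(1,2) by (auto simp: bdd_functional_def)
  then show ?thesis using assms(3) by simp
qed

lemma residual_in_S: "(\<And>i. i < m \<Longrightarrow> e i \<in> S) \<Longrightarrow> x \<in> S \<Longrightarrow> residual e f m x \<in> S"
  unfolding residual_def by (intro S_intros S_sum) auto

lemma residual_in_span: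
  assumes "\<And>i. i < m \<Longrightarrow> e i \<in> span B" "x \<in> span B"
  shows "residual e f m x \<in> span B"
  unfolding residual_def using assms
  by (intro span_diff span_sum span_scale) auto

lemma functional_residual:
  assumes lin: "linear_map_on S smul (*) h" and e: "\<And>i. i < m \<Longrightarrow> e i \<in> S" and x: "x \<in> S"
  shows "h (residual e f m x) = h x - (\<Sum>i<m. f i x * h (e i))"
proof -
  have sm: "smul (f i x) (e i) \<in> S" if "i \<in> {..<m}" for i
    using e that by simp
  have "h (residual e f m x) = h x - h (\<Sum>i<m. smul (f i x) (e i))"
    unfolding residual_def by (intro linear_map_onD(4)[OF lin] x S_sum sm)
  also have "h (\<Sum>i<m. smul (f i x) (e i)) = (\<Sum>i<m. h (smul (f i x) (e i)))"
    using sm by (rule linear_map_onD(5)[OF lin])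
  also have "\<dots> = (\<Sum>i<m. f i x * h (e i))"
    using e by (intro sum.cong) (auto simp: linear_map_onD(2)[OF lin])
  finally show ?thesis .
qed

lemma csn_residual:
  assumes p: "csn p" and e: "\<And>i. i < m \<Longrightarrow> e i \<in> S" and f: "\<And>i. i < m \<Longrightarrow> bdd_functional p (f i)"
  shows "csn (\<lambda>x. p (residual e f m x))" "\<exists>K. \<forall>x\<in>S. p (residual e f m x) \<le> K * p x"
proof -
  have lin: "linear_map_on S smul (*) (f i)" if "i < m" for i
    using f[OF that] by (rule bdd_functional_lin)
  have sn: "seminorm_on smul S (\<lambda>x. p (residual e f m x))"
    unfolding seminorm_on_def
  proof (intro conjI ballI allI)
    fix x y assume x: "x \<in> S" and y: "y \<in> S"
    have "(\<Sum>i<m. smul (f i (x + y)) (e i)) = (\<Sum>i<m. smul (f i x) (e i)) + (\<Sum>i<m. smul (f i y) (e i))"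
      unfolding sum.distrib[symmetric]
      using x y by (intro sum.cong) (auto simp: linear_map_onD(1)[OF lin] scale_left_distrib)
    then have "residual e f m (x + y) = residual e f m x + residual e f m y"
      by (simp add: residual_def)
    then show "p (residual e f m (x + y)) \<le> p (residual e f m x) + p (residual e f m y)"
      using residual_in_S[of m e] e x y csn_triangle[OF p] by simp
  next
    fix c x assume x: "x \<in> S"
    have "(\<Sum>i<m. smul (f i (smul c x)) (e i)) = smul c (\<Sum>i<m. smul (f i x) (e i))"
      unfolding scale_sum_right
      using x by (intro sum.cong) (auto simp: linear_map_onD(2)[OF lin])
    then have "residual e f m (smul c x) = smul c (residual e f m x)"
      by (simp add: residual_def scale_right_diff_distrib)
    then show "p (residual e f m (smul c x)) = norm c * p (residual e f m x)"
      using residual_in_S[of m e] e x csn_scale[OF p] by simp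
  qed
  have "\<forall>i\<in>{..<m}. \<exists>C. \<forall>x\<in>S. norm (f i x) \<le> C * p x"
    using f by (simp add: bdd_functional_def)
  then obtain C where C: "\<And>i x. i < m \<Longrightarrow> x \<in> S \<Longrightarrow> norm (f i x) \<le> C i * p x"
    by (auto simp: bchoice_iff)
  have le: "p (residual e f m x) \<le> (1 + (\<Sum>i<m. C i * p (e i))) * p x" if x: "x \<in> S" for x
  proof -
    have sm: "smul (f i x) (e i) \<in> S" if "i \<in> {..<m}" for i
      using e that by simp
    have "p (residual e f m x) \<le> p x + p (\<Sum>i<m. smul (f i x) (e i))"
      unfolding residual_def by (intro csn_diff[OF p] x S_sum sm)
    also have "p (\<Sum>i<m. smul (f i x) (e i)) \<le> (\<Sum>i<m. p (smul (f i x) (e i)))"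
      using sm by (rule csn_sum[OF p])
    also have "\<dots> \<le> (\<Sum>i<m. C i * p (e i) * p x)"
    proof (rule sum_mono)
      fix i assume i: "i \<in> {..<m}"
      have "p (smul (f i x) (e i)) = norm (f i x) * p (e i)"
        using i e by (intro csn_scale[OF p]) simp
      also have "\<dots> \<le> (C i * p x) * p (e i)"
        using i C x e csn_nonneg[OF p] by (intro mult_right_mono) auto
      finally show "p (smul (f i x) (e i)) \<le> C i * p (e i) * p x" by (simp add: algebra_simps)
    qed
    finally show ?thesis by (simp add: distrib_right sum_distrib_right)
  qed
  then show "\<exists>K. \<forall>x\<in>S. p (residual e f m x) \<le> K * p x" by blast
  show "csn (\<lambda>x. p (residual e f m x))"
    using sn p le by (rule csn_dominated)
qed

lemma csn_zero_on_closure: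
  fixes z :: "nat \<Rightarrow> 'a"
  assumes q: "csn q" and z: "\<And>k. z k \<in> S" and q0: "\<And>k. q (z k) = 0"
    and dense: "T closure_of (span (range z)) = S" and x: "x \<in> S"
  shows "q x = 0"
proof -
  have sub: "subspace {x \<in> S. q x = 0}"
  proof (rule subspaceI)
    show "x + y \<in> {x \<in> S. q x = 0}" if "x \<in> {x \<in> S. q x = 0}" "y \<in> {x \<in> S. q x = 0}" for x y
      using that csn_triangle[OF q, of x y] csn_nonneg[OF q, of "x + y"] by auto
  qed (auto simp: csn_0[OF q] csn_scale[OF q])
  then have sp: "span (range z) \<subseteq> {x \<in> S. q x = 0}"
    using z q0 by (intro span_minimal) auto
  have "q x \<le> 0 + e" if e: "e > 0" for e
  proof -
    have "x \<in> T closure_of (span (range z))" using dense x by simp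
    then obtain y where "y \<in> span (range z) \<inter> S" "q (y - x) < e"
      unfolding in_closure_iff_seminorm using q e by meson
    then have y: "y \<in> S" "q y = 0" "q (y - x) < e" using sp by auto
    then show ?thesis using csn_abs_diff[OF q y(1) x] by simp
  qed
  then have "q x \<le> 0" by (rule field_le_epsilon)
  then show ?thesis using csn_nonneg[OF q x] by simp
qed

text \<open>The seminorm \<open>p\<close> of the residual is continuous. If it vanished on all
  \<open>z j\<close>, density would make it vanish everywhere and \<open>p\<close> would have finite
  rank. A functional bounded by this seminorm and nonzero at the new vector kills every
  \<open>e i\<close> automatically, because \<open>e i\<close> has residual 0.\<close>

lemma Gram_Schmidt_step:
  fixes z :: "nat \<Rightarrow> 'a"
  assumes sf: "supporting_functionals smul" and p: "csn p" and nfr: "\<not> finite_rank p"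
    and z: "\<And>k. z k \<in> S" and dense: "T closure_of (span (range z)) = S"
    and e: "\<And>i. i < m \<Longrightarrow> e i \<in> S" and f: "\<And>i. i < m \<Longrightarrow> bdd_functional p (f i)"
    and bi: "\<And>i j. i < m \<Longrightarrow> j < m \<Longrightarrow> f i (e j) = (if i = j then 1 else 0)"
  shows "\<exists>j h. p (residual e f m (z j)) \<noteq> 0 \<and> (\<forall>i<j. p (residual e f m (z i)) = 0) \<and>
    bdd_functional p h \<and> h (residual e f m (z j)) = 1 \<and>
    (\<forall>i<m. h (e i) = 0 \<and> f i (residual e f m (z j)) = 0)"
proof -
  let ?r = "residual e f m"
  let ?q = "\<lambda>x. p (?r x)"
  have lin: "linear_map_on S smul (*) (f i)" if "i < m" for i
    using f[OF that] by (rule bdd_functional_lin)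
  have q: "csn ?q" using p e f by (rule csn_residual(1))
  obtain K where K: "\<And>x. x \<in> S \<Longrightarrow> ?q x \<le> K * p x"
    using csn_residual(2)[of p m e f] p e f by blast
  have rS: "?r x \<in> S" if "x \<in> S" for x using e that by (rule residual_in_S)
  have fr: "f i (?r x) = 0" if i: "i < m" and x: "x \<in> S" for i x
  proof -
    have "f i (?r x) = f i x - (\<Sum>j<m. f j x * f i (e j))"
      using lin[OF i] e x by (rule functional_residual)
    also have "(\<Sum>j<m. f j x * f i (e j)) = (\<Sum>j<m. if j = i then f i x else 0)"
      using i by (intro sum.cong) (auto simp: bi)
    finally show ?thesis using i by simp
  qed
  have "\<exists>j. ?q (z j) \<noteq> 0"
  proof (rule ccontr)
    assume "\<nexists>j. ?q (z j) \<noteq> 0"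
    then have "?q x = 0" if "x \<in> S" for x
      using csn_zero_on_closure[OF q z _ dense that] by simp
    then have "finite_rank p"
      unfolding finite_rank_def residual_def using e f by blast
    then show False using nfr by simp
  qed
  \<comment> \<open>The least such \<open>j\<close>, so that the recursion never passes over a
    vector of \<open>z\<close>.\<close>
  then obtain j where j: "?q (z j) \<noteq> 0" "\<And>i. i < j \<Longrightarrow> ?q (z i) = 0"
    using exists_least_iff[of "\<lambda>j. ?q (z j) \<noteq> 0"] by blast
  define u where "u = ?r (z j)"
  have uS: "u \<in> S" unfolding u_def by (rule rS[OF z])
  \<comment> \<open>All \<open>f i\<close> vanish on a residual, so taking residuals is
    idempotent.\<close>
  have "?r u = u"
    unfolding residual_def[of _ _ _ u] using fr[OF _ z[of j]] by (simp add: u_def)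
  then have "?q u \<noteq> 0" using j(1) by (simp add: u_def)
  then obtain h where h: "linear_map_on S smul (*) h" "\<And>x. x \<in> S \<Longrightarrow> norm (h x) \<le> ?q x" "h u \<noteq> 0"
    using sf[unfolded supporting_functionals_def, rule_format, of S ?q u]
      subspace_S csn_seminorm[OF q] uS by blast
  define h' where "h' x = inverse (h u) * h x" for x
  have "norm (h' x) \<le> (norm (inverse (h u)) * K) * p x" if "x \<in> S" for x
    unfolding h'_def norm_mult
    using order_trans[OF h(2) K, OF that that] by (simp add: mult_left_mono mult.assoc)
  then have "bdd_functional p h'"
    unfolding bdd_functional_def using h(1)
    by (auto simp: linear_map_on_def h'_def distrib_left)
  moreover have "h' u = 1" using h(3) by (simp add: h'_def)
  moreover have "h' (e i) = 0" if i: "i < m" for i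
  proof -
    have "(\<Sum>j<m. smul (f j (e i)) (e j)) = (\<Sum>j<m. if j = i then e i else 0)"
      using i by (intro sum.cong) (auto simp: bi)
    then have "?r (e i) = 0" using i by (simp add: residual_def)
    then have "norm (h (e i)) \<le> 0" using h(2)[OF e[OF i]] csn_0[OF p] by simp
    then show ?thesis by (simp add: h'_def)
  qed
  moreover have "f i u = 0" if "i < m" for i unfolding u_def using that z by (rule fr)
  ultimately show ?thesis
    using j unfolding u_def by blast
qed

text \<open>The vectors of \<open>z\<close> that lie in the span of the previous ones modulo the kernel of \<open>p\<close> only
  contribute to \<open>g\<close>.\<close>

lemma Gram_Schmidt:
  fixes z :: "nat \<Rightarrow> 'a"
  assumes sf: "supporting_functionals smul" and p: "csn p" and nfr: "\<not> finite_rank p"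
    and z: "\<And>k. z k \<in> S" and dense: "T closure_of (span (range z)) = S"
  obtains e :: "nat \<Rightarrow> 'a" and f :: "nat \<Rightarrow> 'a \<Rightarrow> 'k" and g :: "nat \<Rightarrow> 'a"
    where "\<And>k. e k \<in> span (range z)" "\<And>k. bdd_functional p (f k)"
    "\<And>i j. f i (e j) = (if i = j then 1 else 0)"
    "\<And>k. g k \<in> span (range z)" "\<And>i k. f i (g k) = 0"
    "\<And>k. z k \<in> span (range e \<union> range g)"
proof -
  define res where "res F m = residual (\<lambda>i. fst (F i)) (\<lambda>i. snd (F i)) m"
    for F :: "nat \<Rightarrow> 'a \<times> ('a \<Rightarrow> 'k)" and m
  \<comment> \<open>\<open>good F m r\<close> says that the pair \<open>r\<close> of a vector and a
    functional may be appended to the first \<open>m\<close> pairs of \<open>F\<close>. Recording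
    the minimality of \<open>j\<close> is what makes every \<open>z k\<close> be treated after
    finitely many steps.\<close>
  define good where "good F m r \<longleftrightarrow> fst r \<in> span (range z) \<and> bdd_functional p (snd r) \<and>
      snd r (fst r) = 1 \<and> (\<forall>i<m. snd r (fst (F i)) = 0 \<and> snd (F i) (fst r) = 0) \<and>
      (\<exists>j. p (res F m (z j)) \<noteq> 0 \<and> (\<forall>i<j. p (res F m (z i)) = 0) \<and> fst r = res F m (z j))"
    for F :: "nat \<Rightarrow> 'a \<times> ('a \<Rightarrow> 'k)" and m and r :: "'a \<times> ('a \<Rightarrow> 'k)"
  have zspan: "z j \<in> span (range z)" for j by (rule span_base) simp
  have spanS: "x \<in> S" if "x \<in> span (range z)" for x
    using span_minimal[of "range z" S] subspace_S z that by blast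
  have "\<exists>F. \<forall>m. good F m (F m)"
  proof (rule dependent_wellorder_choice)
    fix r and F G :: "nat \<Rightarrow> 'a \<times> ('a \<Rightarrow> 'k)" and m :: nat assume FG: "\<And>y. y < m \<Longrightarrow> F y = G y"
    then have "res F m = res G m"
      by (auto simp: res_def residual_def fun_eq_iff)
    then show "good F m r = good G m r"
      using FG unfolding good_def by simp
  next
    fix m :: nat and F :: "nat \<Rightarrow> 'a \<times> ('a \<Rightarrow> 'k)" assume IH: "\<And>y. y < m \<Longrightarrow> good F y (F y)"
    let ?e = "\<lambda>i. fst (F i)" and ?f = "\<lambda>i. snd (F i)"
    have "?f i (?e j) = (if i = j then 1 else 0)" if "i < m" "j < m" for i j
      using IH[OF that(1)] IH[OF that(2)] unfolding good_def
      by (cases i j rule: linorder_cases) auto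
    moreover have es: "?e i \<in> span (range z)" if "i < m" for i
      using IH[OF that] by (simp add: good_def)
    moreover have "bdd_functional p (?f i)" if "i < m" for i
      using IH[OF that] by (simp add: good_def)
    ultimately obtain j h where jh: "p (res F m (z j)) \<noteq> 0" "\<forall>i<j. p (res F m (z i)) = 0"
      "bdd_functional p h" "h (res F m (z j)) = 1"
      "\<forall>i<m. h (?e i) = 0 \<and> ?f i (res F m (z j)) = 0"
      using Gram_Schmidt_step[OF sf p nfr z dense, of m ?e ?f] spanS unfolding res_def by blast
    have "res F m (z j) \<in> span (range z)"
      unfolding res_def by (rule residual_in_span[OF es zspan])
    then have "good F m (res F m (z j), h)"
      using jh unfolding good_def by auto
    then show "\<exists>r. good F m r" by blast
  qed
  then obtain F where F: "\<And>m. good F m (F m)" by blast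
  define e where "e = (\<lambda>i. fst (F i))"
  define f where "f = (\<lambda>i. snd (F i))"
  have res: "res F = residual e f" by (simp add: fun_eq_iff res_def e_def f_def)
  note G = F[unfolded good_def res, folded e_def f_def]
  have es: "e k \<in> span (range z)" for k using G[of k] by (simp add: e_def)
  have f: "bdd_functional p (f k)" for k using G[of k] by (simp add: f_def)
  have bi: "f i (e j) = (if i = j then 1 else 0)" for i j
    using G[of i] G[of j] by (cases i j rule: linorder_cases) (auto simp: e_def f_def)
  have eS: "e k \<in> S" for k by (rule spanS[OF es])
  have rS: "residual e f m x \<in> S" if "x \<in> S" for m x
    using eS that by (rule residual_in_S)
  have next0: "residual e f (Suc m) x = residual e f m x" if "p (residual e f m x) = 0" "x \<in> S" for m x
  proof -
    have "f m x = f m (residual e f m x)"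
      using functional_residual[OF bdd_functional_lin[OF f] eS that(2), where m = m and f = f] by (simp add: bi)
    also have "\<dots> = 0" using f rS[OF that(2)] that(1) by (rule bdd_functional_zero)
    finally show ?thesis by (simp add: residual_Suc)
  qed
  \<comment> \<open>After \<open>m\<close> steps at least the first \<open>m\<close> vectors of
    \<open>z\<close> are exhausted modulo the kernel of \<open>p\<close>.\<close>
  have A: "\<forall>i<m. p (residual e f m (z i)) = 0" for m
  proof (induction m)
    case (Suc m)
    obtain j where j: "p (residual e f m (z j)) \<noteq> 0" "\<And>i. i < j \<Longrightarrow> p (residual e f m (z i)) = 0"
        "e m = residual e f m (z j)"
      using G[of m] by (auto simp: e_def)
    \<comment> \<open>By the induction hypothesis the first \<open>m\<close> vectors are not
      eligible at step \<open>m\<close>.\<close>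
    have "m \<le> j" using j(1) Suc by (cases "m \<le> j") auto
    show ?case
    proof (intro allI impI)
      fix i assume "i < Suc m"
      then consider "i < j" | "i = j" using \<open>m \<le> j\<close> by linarith
      then show "p (residual e f (Suc m) (z i)) = 0"
      proof cases
        case 1
        then show ?thesis using j(2) next0[of m "z i"] z by simp
      next
        case 2
        have "f m (e m) = f m (z j)"
          unfolding j(3) using functional_residual[OF bdd_functional_lin[OF f] eS z, where m = m and f = f]
          by (simp add: bi)
        then have "f m (z j) = 1" by (simp add: bi)
        then show ?thesis using 2 j(3) csn_0[OF p] by (simp add: residual_Suc)
      qed
    qed
  qed simp
  \<comment> \<open>What is left of \<open>z k\<close> once it has been exhausted. It lies in the
    kernel of \<open>p\<close>, hence in the kernel of every \<open>f i\<close>, including those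
    constructed later.\<close>
  define g where "g k = residual e f (Suc k) (z k)" for k
  show thesis
  proof (rule that[of e f g])
    show "g k \<in> span (range z)" for k
      unfolding g_def by (rule residual_in_span[OF es zspan])
    show "f i (g k) = 0" for i k
    proof (rule bdd_functional_zero[OF f])
      show "g k \<in> S" unfolding g_def by (rule rS[OF z])
      show "p (g k) = 0" unfolding g_def using A by simp
    qed
    show "z k \<in> span (range e \<union> range g)" for k
    proof -
      have "z k = g k + (\<Sum>i<Suc k. smul (f i (z k)) (e i))"
        by (simp add: g_def residual_def)
      moreover have "g k \<in> span (range e \<union> range g)" by (rule span_base) simp
      moreover have "(\<Sum>i<Suc k. smul (f i (z k)) (e i)) \<in> span (range e \<union> range g)"
        by (intro span_sum span_scale span_base) simp
      ultimately show ?thesis by (metis span_add)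
    qed
  qed (fact es f bi)+
qed

end

text \<open>The factor \<open>(1 / 2) ^ k\<close> makes the values \<open>f k x\<close> absolutely
  summable, so that they can serve as coefficients for any \<open>l1_conv\<close> sequence. Together
  with \<open>p (e k) \<le> 1\<close> it bounds \<open>f k (e k)\<close> by
  \<open>(1 / 2) ^ k\<close>; biorthogonality is therefore required only up to nonzero
  factors.\<close>

definition l1_system ::
    "('k::real_normed_field \<Rightarrow> 'a::ab_group_add \<Rightarrow> 'a) \<Rightarrow> 'a topology \<Rightarrow> ('a \<Rightarrow> real) \<Rightarrow>
     (nat \<Rightarrow> 'a) \<Rightarrow> (nat \<Rightarrow> 'a \<Rightarrow> 'k) \<Rightarrow> (nat \<Rightarrow> 'a) \<Rightarrow> bool" where
  "l1_system smul T p e f g \<longleftrightarrow>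
     cont_seminorm smul T p \<and> l1_conv smul T e \<and>
     (\<forall>k. linear_map_on (topspace T) smul (*) (f k)) \<and>
     (\<forall>k. \<forall>x\<in>topspace T. norm (f k x) \<le> (1 / 2) ^ k * p x) \<and>
     (\<forall>k. p (e k) \<le> 1) \<and> (\<forall>j k. f k (e j) \<noteq> 0 \<longleftrightarrow> j = k) \<and>
     range g \<subseteq> topspace T \<and> (\<forall>j k. f k (g j) = 0) \<and>
     T closure_of (module.span smul (range e \<union> range g)) = topspace T"

lemma class_M_l1_system:
  fixes smul :: "'k::{real_normed_field, banach} \<Rightarrow> 'a::ab_group_add \<Rightarrow> 'a"
  assumes M: "class_M smul T" and sf: "supporting_functionals smul"
  shows "\<exists>p e f g. l1_system smul T p e f g"
proof -
  interpret lcs smul T using M by (simp add: lcs_def class_M_def)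
  obtain z where z: "l1_sequence smul T z" "T closure_of (span (range z)) = S"
    using M by (auto simp: class_M_def)
  have zl: "l1_conv smul T z" using z(1) by (rule l1_sequence_imp_l1_conv)
  have zS: "z k \<in> S" for k using l1_convD(1)[OF zl] .
  obtain p where p: "csn p" "\<not> finite_rank p"
    using weak_topology_if_finite_rank M by (auto simp: class_M_def)
  show ?thesis
  proof (rule Gram_Schmidt[OF sf p zS z(2)])
    fix e :: "nat \<Rightarrow> 'a" and f :: "nat \<Rightarrow> 'a \<Rightarrow> 'k" and g :: "nat \<Rightarrow> 'a"
    assume es: "\<And>k. e k \<in> span (range z)" and f: "\<And>k. bdd_functional p (f k)"
      and bi: "\<And>i j. f i (e j) = (if i = j then 1 else 0)"
      and gs: "\<And>k. g k \<in> span (range z)" and fg: "\<And>i k. f i (g k) = 0"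
      and zs: "\<And>k. z k \<in> span (range e \<union> range g)"
    have spanS: "x \<in> S" if "x \<in> span (range z)" for x
      using span_minimal[of "range z" S] subspace_S zS that by blast
    have eS: "e k \<in> S" for k by (rule spanS[OF es])
    have "\<forall>k. \<exists>\<alpha> n0 C. (\<forall>n\<ge>n0. e k = (\<Sum>j<n. smul (\<alpha> j) (z j))) \<and> (\<forall>J. (\<Sum>j<J. norm (\<alpha> j)) \<le> C)"
      by (intro allI span_range_rep es)
    then obtain \<alpha> n0 C where rep: "\<And>k n. n \<ge> n0 k \<Longrightarrow> e k = (\<Sum>j<n. smul (\<alpha> k j) (z j))"
      and C: "\<And>k J. (\<Sum>j<J. norm (\<alpha> k j)) \<le> C k"
      by metis
    have "\<forall>k::nat. \<exists>D. \<forall>x\<in>S. norm (f k x) \<le> D * p x"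
      using f by (simp add: bdd_functional_def)
    then obtain D where D: "\<And>k x. x \<in> S \<Longrightarrow> norm (f k x) \<le> D k * p x"
      by metis
    \<comment> \<open>One factor that brings both the l1 norm of the coefficients of
      \<open>e k\<close> and the value \<open>p (e k)\<close> down to at most 1.\<close>
    define t where "t k = 1 / (1 + C k + p (e k))" for k
    have C0: "C k \<ge> 0" for k using C[of k 0] by simp
    have p0: "p (e k) \<ge> 0" for k using csn_nonneg[OF p(1) eS] .
    have t: "t k > 0" "t k * C k \<le> 1" "t k * p (e k) \<le> 1" for k
    proof -
      have "1 + C k + p (e k) > 0" using C0[of k] p0[of k] by simp
      then show "t k > 0" "t k * C k \<le> 1" "t k * p (e k) \<le> 1"
        using C0[of k] p0[of k] by (simp_all add: t_def field_simps)
    qed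
    \<comment> \<open>Turns the individual bounds \<open>D k\<close> into the common geometric
      bound; \<open>1 + \<bar>D k\<bar>\<close> keeps the denominator positive.\<close>
    define s where "s k = (1 / 2) ^ k / (1 + \<bar>D k\<bar>)" for k
    have s: "s k > 0" for k by (simp add: s_def add_pos_nonneg)
    define e' where "e' k = smul (of_real (t k)) (e k)" for k
    define f' where "f' k x = of_real (s k) * f k x" for k x
    have "l1_conv smul T e'"
    proof (rule l1_conv_lin_combs[OF lcs_axioms zl])
      fix k
      show "\<exists>n0. \<forall>n\<ge>n0. e' k = (\<Sum>j<n. smul (of_real (t k) * \<alpha> k j) (z j))"
      proof (intro exI allI impI)
        fix n assume "n \<ge> n0 k"
        then show "e' k = (\<Sum>j<n. smul (of_real (t k) * \<alpha> k j) (z j))"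
          unfolding e'_def by (subst rep) (simp_all add: scale_sum_right)
      qed
      fix J
      have "(\<Sum>j<J. norm (of_real (t k) * \<alpha> k j)) = t k * (\<Sum>j<J. norm (\<alpha> k j))"
        using t(1)[of k] by (simp add: norm_mult sum_distrib_left)
      also have "\<dots> \<le> t k * C k"
        using t(1)[of k] C by (intro mult_left_mono) auto
      finally show "(\<Sum>j<J. norm (of_real (t k) * \<alpha> k j)) \<le> 1" using t(2)[of k] by simp
    qed
    moreover have "linear_map_on S smul (*) (f' k)" for k
      using bdd_functional_lin[OF f[of k]]
      by (simp add: linear_map_on_def f'_def distrib_left)
    moreover have "norm (f' k x) \<le> (1 / 2) ^ k * p x" if x: "x \<in> S" for k x
    proof -
      have "norm (f' k x) = s k * norm (f k x)" using s[of k] by (simp add: f'_def norm_mult)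
      also have "\<dots> \<le> s k * (D k * p x)"
        using s[of k] D[OF x] by (intro mult_left_mono) auto
      also have "\<dots> \<le> s k * ((1 + \<bar>D k\<bar>) * p x)"
        using s[of k] csn_nonneg[OF p(1) x] by (intro mult_left_mono mult_right_mono) auto
      also have "\<dots> = (1 / 2) ^ k * p x" by (simp add: s_def add_pos_nonneg less_imp_neq[symmetric])
      finally show ?thesis .
    qed
    moreover have "p (e' k) \<le> 1" for k
      using csn_scale[OF p(1) eS] t(1)[of k] t(3)[of k] by (simp add: e'_def)
    moreover have "f' k (e' j) \<noteq> 0 \<longleftrightarrow> j = k" for j k
    proof -
      have "f' k (e' j) = of_real (s k) * (of_real (t j) * f k (e j))"
        using linear_map_onD(2)[OF bdd_functional_lin[OF f[of k]] eS[of j]] by (simp add: f'_def e'_def)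
      then show ?thesis using s[of k] t(1)[of j] by (auto simp: bi)
    qed
    moreover have "range g \<subseteq> S" using spanS[OF gs] by blast
    moreover have "f' k (g j) = 0" for j k by (simp add: f'_def fg)
    moreover have "T closure_of (span (range e' \<union> range g)) = S"
    proof -
      let ?V = "span (range e' \<union> range g)"
      have "e k \<in> ?V" for k
      proof -
        have "e k = smul (of_real (1 / t k)) (e' k)"
          using t(1)[of k] by (simp add: e'_def)
        moreover have "smul (of_real (1 / t k)) (e' k) \<in> ?V"
          by (intro span_scale span_base) simp
        ultimately show ?thesis by simp
      qed
      moreover have "g k \<in> ?V" for k by (rule span_base) simp
      ultimately have "span (range e \<union> range g) \<subseteq> ?V"
        by (intro span_minimal subspace_span) auto
      then have "span (range z) \<subseteq> ?V"
        using zs by (intro span_minimal subspace_span) auto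
      then have "S \<subseteq> T closure_of ?V" using closure_of_mono z(2) by metis
      then show ?thesis using closure_of_subset_topspace[of T ?V] by blast
    qed
  ultimately show ?thesis
      using p(1) unfolding l1_system_def
      by (intro exI[of _ p] exI[of _ e'] exI[of _ f'] exI[of _ g]) simp
  qed
qed

section \<open>The locally convex direct sum\<close>

text \<open>Closure of \<open>Q\<close> under sums and nonnegative multiples lets the unit balls of
  single members serve as a neighbourhood base at 0, without finite intersections or radii.\<close>

locale seminorm_family = vector_space smul
  for smul :: "'k::real_normed_field \<Rightarrow> 'a::ab_group_add \<Rightarrow> 'a" +
  fixes S :: "'a set" and Q :: "('a \<Rightarrow> real) set"
  assumes subspace_S: "subspace S" and nontrivial: "S \<noteq> {0}"
    and Q_nonempty: "Q \<noteq> {}"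
    and Q_seminorm: "p \<in> Q \<Longrightarrow> seminorm_on smul S p"
    and Q_add: "p \<in> Q \<Longrightarrow> q \<in> Q \<Longrightarrow> (\<lambda>x. p x + q x) \<in> Q"
    and Q_mult: "p \<in> Q \<Longrightarrow> c \<ge> 0 \<Longrightarrow> (\<lambda>x. c * p x) \<in> Q"
    and Q_separates: "x \<in> S \<Longrightarrow> (\<And>p. p \<in> Q \<Longrightarrow> p x = 0) \<Longrightarrow> x = 0"
begin

lemmas S_intros [simp, intro] = subspace_0[OF subspace_S] subspace_add[OF subspace_S]
  subspace_scale[OF subspace_S] subspace_neg[OF subspace_S] subspace_diff[OF subspace_S]

lemmas Q_triangle = seminorm_on_triangle[OF vector_space_axioms Q_seminorm subspace_S]
  and Q_scale = seminorm_on_scale[OF vector_space_axioms Q_seminorm subspace_S]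
  and Q_0 = seminorm_on_0[OF vector_space_axioms Q_seminorm subspace_S]
  and Q_nonneg = seminorm_on_nonneg[OF vector_space_axioms Q_seminorm subspace_S]
  and Q_minus_commute = seminorm_on_minus_commute[OF vector_space_axioms Q_seminorm subspace_S]

definition seminorm_topology :: "'a topology" where
  "seminorm_topology =
     topology (\<lambda>U. U \<subseteq> S \<and> (\<forall>a\<in>U. \<exists>p\<in>Q. \<forall>x\<in>S. p (x - a) < 1 \<longrightarrow> x \<in> U))"

lemma openin_seminorm_topology:
  "openin seminorm_topology U \<longleftrightarrow> U \<subseteq> S \<and> (\<forall>a\<in>U. \<exists>p\<in>Q. \<forall>x\<in>S. p (x - a) < 1 \<longrightarrow> x \<in> U)"
proof -
  have "istopology (\<lambda>U. U \<subseteq> S \<and> (\<forall>a\<in>U. \<exists>p\<in>Q. \<forall>x\<in>S. p (x - a) < 1 \<longrightarrow> x \<in> U))"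
    unfolding istopology_def
  proof (intro conjI allI impI)
    fix U V assume U: "U \<subseteq> S \<and> (\<forall>a\<in>U. \<exists>p\<in>Q. \<forall>x\<in>S. p (x - a) < 1 \<longrightarrow> x \<in> U)"
      and V: "V \<subseteq> S \<and> (\<forall>a\<in>V. \<exists>p\<in>Q. \<forall>x\<in>S. p (x - a) < 1 \<longrightarrow> x \<in> V)"
    show "U \<inter> V \<subseteq> S" using U by blast
    show "\<forall>a\<in>U \<inter> V. \<exists>p\<in>Q. \<forall>x\<in>S. p (x - a) < 1 \<longrightarrow> x \<in> U \<inter> V"
    proof
      fix a assume a: "a \<in> U \<inter> V"
      obtain p where p: "p \<in> Q" "\<And>x. x \<in> S \<Longrightarrow> p (x - a) < 1 \<Longrightarrow> x \<in> U" using U a by blast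
      obtain q where q: "q \<in> Q" "\<And>x. x \<in> S \<Longrightarrow> q (x - a) < 1 \<Longrightarrow> x \<in> V" using V a by blast
      have aS: "a \<in> S" using U a by blast
      have "x \<in> U \<inter> V" if x: "x \<in> S" "p (x - a) + q (x - a) < 1" for x
        using p(2)[OF x(1)] q(2)[OF x(1)] Q_nonneg[OF p(1), of "x - a"] Q_nonneg[OF q(1), of "x - a"]
          x aS by simp
      then show "\<exists>p\<in>Q. \<forall>x\<in>S. p (x - a) < 1 \<longrightarrow> x \<in> U \<inter> V"
        by (intro bexI[OF _ Q_add[OF p(1) q(1)]]) blast
    qed
  next
    fix \<U> assume *: "\<forall>U\<in>\<U>. U \<subseteq> S \<and> (\<forall>a\<in>U. \<exists>p\<in>Q. \<forall>x\<in>S. p (x - a) < 1 \<longrightarrow> x \<in> U)"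
    show "\<Union>\<U> \<subseteq> S" using * by blast
    show "\<forall>a\<in>\<Union>\<U>. \<exists>p\<in>Q. \<forall>x\<in>S. p (x - a) < 1 \<longrightarrow> x \<in> \<Union>\<U>"
    proof
      fix a assume "a \<in> \<Union>\<U>"
      then obtain U where U: "U \<in> \<U>" "a \<in> U" by blast
      then obtain p where "p \<in> Q" "\<forall>x\<in>S. p (x - a) < 1 \<longrightarrow> x \<in> U" using * by blast
      then show "\<exists>p\<in>Q. \<forall>x\<in>S. p (x - a) < 1 \<longrightarrow> x \<in> \<Union>\<U>" using U(1) by blast
    qed
  qed
  then show ?thesis unfolding seminorm_topology_def by (simp add: topology_inverse')
qed

lemma topspace_seminorm_topology: "topspace seminorm_topology = S"
proof -
  have "openin seminorm_topology S"
    using Q_nonempty by (auto simp: openin_seminorm_topology)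
  from openin_subset[OF this] show ?thesis
    using openin_topspace[of seminorm_topology] unfolding openin_seminorm_topology by blast
qed

lemma Q_ball_open:
  assumes p: "p \<in> Q" and a: "a \<in> S"
  shows "openin seminorm_topology {x \<in> S. p (x - a) < r}"
  unfolding openin_seminorm_topology
proof (intro conjI ballI)
  fix b assume "b \<in> {x \<in> S. p (x - a) < r}"
  then have b: "b \<in> S" "p (b - a) < r" by auto
  \<comment> \<open>Chosen so that the unit ball of \<open>c * p\<close> around \<open>b\<close> is
    the \<open>p\<close>-ball whose radius is the room left inside the given ball.\<close>
  define c where "c = 1 / (r - p (b - a))"
  have c: "c > 0" using b(2) by (simp add: c_def)
  have "x \<in> {x \<in> S. p (x - a) < r}" if x: "x \<in> S" "c * p (x - b) < 1" for x
  proof -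
    have "p (x - b) < r - p (b - a)"
      using x(2) b(2) by (simp add: c_def field_simps)
    moreover have "p (x - a) \<le> p (x - b) + p (b - a)"
      using Q_triangle[OF p, of "x - b" "b - a"] x(1) a b(1) by simp
    ultimately show ?thesis using x(1) by simp
  qed
  then show "\<exists>q\<in>Q. \<forall>x\<in>S. q (x - b) < 1 \<longrightarrow> x \<in> {x \<in> S. p (x - a) < r}"
    using c by (intro bexI[OF _ Q_mult[OF p, of c]]) auto
qed auto

lemma Hausdorff_seminorm_topology: "Hausdorff_space seminorm_topology"
  unfolding Hausdorff_space_def topspace_seminorm_topology
proof (intro allI impI)
  fix x y assume xy: "x \<in> S \<and> y \<in> S \<and> x \<noteq> y"
  then obtain p where p: "p \<in> Q" "p (x - y) \<noteq> 0"
    using Q_separates[of "x - y"] by auto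
  define r where "r = p (x - y) / 2"
  have r: "r > 0" using p Q_nonneg[OF p(1), of "x - y"] xy by (simp add: r_def)
  have "False" if u: "u \<in> S" "p (u - x) < r" "p (u - y) < r" for u
  proof -
    have "p (x - y) \<le> p (x - u) + p (u - y)"
      using Q_triangle[OF p(1), of "x - u" "u - y"] xy u(1) by simp
    then show False using u Q_minus_commute[OF p(1), of x u] xy by (simp add: r_def)
  qed
  then have "disjnt {u \<in> S. p (u - x) < r} {u \<in> S. p (u - y) < r}"
    by (auto simp: disjnt_iff)
  moreover have "openin seminorm_topology {u \<in> S. p (u - x) < r}"
    "openin seminorm_topology {u \<in> S. p (u - y) < r}"
    using xy by (auto intro: Q_ball_open[OF p(1)])
  moreover have "x \<in> {u \<in> S. p (u - x) < r}" "y \<in> {u \<in> S. p (u - y) < r}"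
    using xy r Q_0[OF p(1)] by auto
  ultimately show "\<exists>U V. openin seminorm_topology U \<and> openin seminorm_topology V \<and>
      x \<in> U \<and> y \<in> V \<and> disjnt U V"
    by (intro exI conjI)
qed

lemma continuous_add_seminorm_topology:
  "continuous_map (prod_topology seminorm_topology seminorm_topology) seminorm_topology (\<lambda>(x, y). x + y)"
  unfolding continuous_map_def
proof (intro conjI allI impI)
  let ?T = seminorm_topology
  fix U assume U: "openin ?T U"
  show "openin (prod_topology ?T ?T) {z \<in> topspace (prod_topology ?T ?T). (\<lambda>(x, y). x + y) z \<in> U}"
    unfolding openin_prod_topology_alt
  proof (intro allI impI)
    fix a b assume "(a, b) \<in> {z \<in> topspace (prod_topology ?T ?T). (\<lambda>(x, y). x + y) z \<in> U}"
    then have ab: "a \<in> S" "b \<in> S" "a + b \<in> U" by (auto simp: topspace_seminorm_topology)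
    obtain p where p: "p \<in> Q" "\<And>x. x \<in> S \<Longrightarrow> p (x - (a + b)) < 1 \<Longrightarrow> x \<in> U"
      using U ab(3) unfolding openin_seminorm_topology by blast
    let ?B = "\<lambda>a. {x \<in> S. p (x - a) < 1 / 2}"
    have "x + y \<in> U" if "x \<in> ?B a" "y \<in> ?B b" for x y
    proof (rule p(2))
      show "x + y \<in> S" using that by auto
      have "p ((x - a) + (y - b)) \<le> p (x - a) + p (y - b)"
        using that ab by (intro Q_triangle[OF p(1)]) auto
      then show "p (x + y - (a + b)) < 1" using that by (simp add: algebra_simps)
    qed
    then have "?B a \<times> ?B b \<subseteq> {z \<in> topspace (prod_topology ?T ?T). (\<lambda>(x, y). x + y) z \<in> U}"
      by (auto simp: topspace_seminorm_topology)
    moreover have "openin ?T (?B a)" "openin ?T (?B b)"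
      using ab(1,2) by (simp_all only: Q_ball_open[OF p(1)])
    moreover have "a \<in> ?B a" "b \<in> ?B b"
      using ab Q_0[OF p(1)] by auto
    ultimately show "\<exists>V W. openin ?T V \<and> openin ?T W \<and> a \<in> V \<and> b \<in> W \<and>
        V \<times> W \<subseteq> {z \<in> topspace (prod_topology ?T ?T). (\<lambda>(x, y). x + y) z \<in> U}"
      by (intro exI conjI)
  qed
qed (auto simp: topspace_seminorm_topology)

lemma continuous_scale_seminorm_topology:
  "continuous_map (prod_topology euclidean seminorm_topology) seminorm_topology (\<lambda>(c, x). smul c x)"
  unfolding continuous_map_def
proof (intro conjI allI impI)
  let ?T = seminorm_topology and ?E = "euclidean :: 'k topology"
  fix U assume U: "openin ?T U"
  show "openin (prod_topology ?E ?T) {z \<in> topspace (prod_topology ?E ?T). (\<lambda>(c, x). smul c x) z \<in> U}"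
    unfolding openin_prod_topology_alt
  proof (intro allI impI)
    fix c a assume "(c, a) \<in> {z \<in> topspace (prod_topology ?E ?T). (\<lambda>(c, x). smul c x) z \<in> U}"
    then have ca: "a \<in> S" "smul c a \<in> U" by (auto simp: topspace_seminorm_topology)
    obtain p where p: "p \<in> Q" "\<And>x. x \<in> S \<Longrightarrow> p (x - smul c a) < 1 \<Longrightarrow> x \<in> U"
      using U ca(2) unfolding openin_seminorm_topology by blast
    have pa: "p a \<ge> 0" by (rule Q_nonneg[OF p(1) ca(1)])
    \<comment> \<open>The constants fit the splitting \<open>d (x - a) + (d - c) a\<close> of the
      difference of the products: \<open>\<delta> \<le> 1\<close> gives
      \<open>norm d \<le> norm c + 1\<close>, then \<open>\<epsilon>\<close> and
      \<open>\<delta>\<close> keep both parts within \<open>1 / 2\<close>.\<close>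
    define \<delta> where "\<delta> = min 1 (1 / (2 * (1 + p a)))"
    define \<epsilon> where "\<epsilon> = 1 / (2 * (norm c + 1))"
    have \<delta>: "\<delta> > 0" "\<delta> \<le> 1" "\<delta> * p a \<le> 1 / 2"
    proof -
      show "\<delta> > 0" "\<delta> \<le> 1" using pa by (auto simp: \<delta>_def)
      have "\<delta> * p a \<le> 1 / (2 * (1 + p a)) * p a"
        using pa by (intro mult_right_mono) (auto simp: \<delta>_def)
      also have "\<dots> \<le> 1 / 2" using pa by (simp add: field_simps)
      finally show "\<delta> * p a \<le> 1 / 2" .
    qed
    have nc: "norm c + 1 > 0" using norm_ge_zero[of c] by linarith
    then have \<epsilon>: "\<epsilon> > 0" "(norm c + 1) * \<epsilon> = 1 / 2"
      unfolding \<epsilon>_def by simp_all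
    let ?D = "ball c \<delta>" and ?B = "{x \<in> S. p (x - a) < \<epsilon>}"
    have "smul d x \<in> U" if d: "d \<in> ?D" and x: "x \<in> ?B" for d x
    proof (rule p(2))
      show "smul d x \<in> S" using x by auto
      have dc: "norm (d - c) < \<delta>" using d by (simp add: dist_norm norm_minus_commute)
      have "norm d \<le> norm c + 1"
        using dc \<delta>(2) norm_triangle_ineq2[of d c] by simp
      have "p (smul d (x - a) + smul (d - c) a) \<le> p (smul d (x - a)) + p (smul (d - c) a)"
        using x ca by (intro Q_triangle[OF p(1)]) auto
      also have "\<dots> = norm d * p (x - a) + norm (d - c) * p a"
        using x ca by (simp add: Q_scale[OF p(1)])
      also have "\<dots> < 1 / 2 + 1 / 2"
      proof (rule add_less_le_mono)
        have "norm d * p (x - a) \<le> (norm c + 1) * p (x - a)"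
          using \<open>norm d \<le> norm c + 1\<close> x ca Q_nonneg[OF p(1)] by (intro mult_right_mono) auto
        also have "\<dots> < (norm c + 1) * \<epsilon>"
          using x nc by (intro mult_strict_left_mono) auto
        finally show "norm d * p (x - a) < 1 / 2" using \<epsilon>(2) by simp
        have "norm (d - c) * p a \<le> \<delta> * p a" using dc pa by (intro mult_right_mono) auto
        then show "norm (d - c) * p a \<le> 1 / 2" using \<delta>(3) by simp
      qed
      finally show "p (smul d x - smul c a) < 1"
        by (simp add: scale_right_diff_distrib scale_left_diff_distrib)
    qed
    then have "?D \<times> ?B \<subseteq> {z \<in> topspace (prod_topology ?E ?T). (\<lambda>(c, x). smul c x) z \<in> U}"
      by (auto simp: topspace_seminorm_topology)
    moreover have "openin ?E ?D" by (simp only: open_openin[symmetric] open_ball)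
    moreover have "openin ?T ?B" "c \<in> ?D" "a \<in> ?B"
      using ca \<delta>(1) \<epsilon>(1) Q_0[OF p(1)] by (auto intro: Q_ball_open[OF p(1)])
    ultimately show "\<exists>V W. openin ?E V \<and> openin ?T W \<and> c \<in> V \<and> a \<in> W \<and>
        V \<times> W \<subseteq> {z \<in> topspace (prod_topology ?E ?T). (\<lambda>(c, x). smul c x) z \<in> U}"
      by (intro exI conjI)
  qed
qed (auto simp: topspace_seminorm_topology)

lemma locally_convex_seminorm_topology: "locally_convex_space smul seminorm_topology"
  unfolding locally_convex_space_def
proof (intro conjI allI impI)
  show "topological_vector_space smul seminorm_topology"
    unfolding topological_vector_space_def topspace_seminorm_topology
    using vector_space_axioms subspace_S nontrivial Hausdorff_seminorm_topology
      continuous_add_seminorm_topology continuous_scale_seminorm_topology by blast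
  fix U assume U: "openin seminorm_topology U \<and> 0 \<in> U"
  then obtain p where p: "p \<in> Q" "\<And>x. x \<in> S \<Longrightarrow> p (x - 0) < 1 \<Longrightarrow> x \<in> U"
    unfolding openin_seminorm_topology by blast
  let ?V = "{x \<in> S. p (x - 0) < 1}"
  have "convex_wrt smul ?V"
    unfolding convex_wrt_def
  proof (intro ballI allI impI)
    fix x y and t :: real assume xy: "x \<in> ?V" "y \<in> ?V" and t: "0 \<le> t \<and> t \<le> 1"
    have "p (smul (of_real t) x + smul (of_real (1 - t)) y) \<le>
        p (smul (of_real t) x) + p (smul (of_real (1 - t)) y)"
      using xy by (intro Q_triangle[OF p(1)]) auto
    also have "\<dots> = t * p x + (1 - t) * p y"
      using xy t by (simp add: Q_scale[OF p(1)] del: of_real_diff)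
    also have "\<dots> < 1" using xy t by (intro convex_bound_lt) auto
    finally show "smul (of_real t) x + smul (of_real (1 - t)) y \<in> ?V" using xy by simp
  qed
  moreover have "openin seminorm_topology ?V"
    by (rule Q_ball_open[OF p(1)]) simp
  moreover have "0 \<in> ?V" "?V \<subseteq> U"
    using p Q_0[OF p(1)] by auto
  ultimately show "\<exists>V. openin seminorm_topology V \<and> 0 \<in> V \<and> convex_wrt smul V \<and> V \<subseteq> U"
    by blast
qed

lemma cont_seminorm_seminorm_topology:
  assumes "p \<in> Q"
  shows "cont_seminorm smul seminorm_topology p"
proof -
  interpret lcs smul seminorm_topology
    by (simp add: lcs_def locally_convex_seminorm_topology)
  show ?thesis
  proof (rule csnI)
    show "seminorm_on smul (topspace seminorm_topology) p"
      unfolding topspace_seminorm_topology using assms by (rule Q_seminorm)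
    show "openin seminorm_topology {x \<in> S. p (x - 0) < 1}"
      using assms by (rule Q_ball_open) simp
  qed (use Q_0[OF assms] in auto)
qed

end

section \<open>The direct sum topology, described by seminorms\<close>

locale lcs_family =
  fixes smul :: "'k::real_normed_field \<Rightarrow> 'a::ab_group_add \<Rightarrow> 'a" and X :: "nat \<Rightarrow> 'a topology"
  assumes lcs: "lcs smul (X n)"
begin

sublocale X: lcs smul "X n" for n by (rule lcs)

abbreviation Sum_carrier where "Sum_carrier \<equiv> direct_sum_carrier X"
abbreviation ssmul where "ssmul \<equiv> sum_smul smul"
abbreviation single where "single \<equiv> Poly_Mapping.single"
abbreviation lookup where "lookup \<equiv> Poly_Mapping.lookup"

lemma lookup_sum_smul [simp]: "lookup (ssmul c x) n = smul c (lookup x n)"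
  by (simp add: sum_smul_def Poly_Mapping.map.rep_eq when_def)

lemma single_add: "single n (x + y) = single n x + single n (y :: 'a)"
  by (rule Poly_Mapping.single_add)

lemma single_smul: "single n (smul c x) = ssmul c (single n x)"
  by (rule poly_mapping_eqI) (simp add: lookup_single when_def)

lemma vector_space_sum_smul: "vector_space ssmul"
  by unfold_locales
    (auto intro!: poly_mapping_eqI simp: lookup_add X.scale_right_distrib X.scale_left_distrib)

sublocale sum: vector_space ssmul by (rule vector_space_sum_smul)

lemma subspace_carrier: "sum.subspace Sum_carrier"
  by (rule sum.subspaceI) (auto simp: direct_sum_carrier_def lookup_add)

lemma single_in_carrier: "x \<in> topspace (X n) \<Longrightarrow> single n x \<in> Sum_carrier"
  by (auto simp: direct_sum_carrier_def lookup_single when_def)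

lemma lookup_in_topspace: "x \<in> Sum_carrier \<Longrightarrow> lookup x n \<in> topspace (X n)"
  by (simp add: direct_sum_carrier_def)

lemma linear_single: "linear_map_on (topspace (X n)) smul ssmul (single n)"
  by (simp add: linear_map_on_def single_add single_smul)

text \<open>Only the restrictions to the individual summands are constrained, with nothing uniform
  in \<open>n\<close>. Taking all such seminorms is what makes the resulting topology the strongest
  one.\<close>

definition Sum_seminorms :: "((nat \<Rightarrow>\<^sub>0 'a) \<Rightarrow> real) set" where
  "Sum_seminorms = {P. seminorm_on ssmul Sum_carrier P \<and>
     (\<forall>n. cont_seminorm smul (X n) (\<lambda>x. P (single n x)))}"

text \<open>These members of the family separate points and make the projections continuous, so each
  \<open>X n\<close> keeps its own topology inside the sum.\<close>

lemma component_seminorm: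
  assumes p: "cont_seminorm smul (X n) p"
  shows "(\<lambda>y. p (lookup y n)) \<in> Sum_seminorms"
  unfolding Sum_seminorms_def
proof (intro CollectI conjI allI)
  show "seminorm_on ssmul Sum_carrier (\<lambda>y. p (lookup y n))"
    unfolding seminorm_on_def
    by (simp add: lookup_add X.csn_triangle[OF p] X.csn_scale[OF p] lookup_in_topspace)
  show "cont_seminorm smul (X m) (\<lambda>x. p (lookup (single m x) n))" for m
    using p X.csn_0[OF p] X.csn_zero[of m] by (cases "m = n") (auto simp: lookup_single when_def)
qed

sublocale Q: seminorm_family ssmul Sum_carrier Sum_seminorms
proof
  show "sum.subspace Sum_carrier" by (rule subspace_carrier)
  obtain x where x: "x \<in> topspace (X 0)" "x \<noteq> 0"
    using X.tvs[of 0] X.S_intros(1)[of 0] unfolding topological_vector_space_def by blast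
  have "lookup (single 0 x) 0 \<noteq> 0" using x(2) by simp
  then have "single 0 x \<noteq> 0" by (metis lookup_zero)
  then show "Sum_carrier \<noteq> {0}" using single_in_carrier[OF x(1)] by blast
  show "Sum_seminorms \<noteq> {}" using component_seminorm[OF X.csn_zero] by blast
next
  fix p assume "p \<in> Sum_seminorms"
  then show sp: "seminorm_on ssmul Sum_carrier p" by (simp add: Sum_seminorms_def)
  fix q assume q: "q \<in> Sum_seminorms"
  show "(\<lambda>x. p x + q x) \<in> Sum_seminorms"
    unfolding Sum_seminorms_def
  proof (intro CollectI conjI allI)
    have sq: "seminorm_on ssmul Sum_carrier q" using q by (simp add: Sum_seminorms_def)
    show "seminorm_on ssmul Sum_carrier (\<lambda>x. p x + q x)"
      unfolding seminorm_on_def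
    proof (intro conjI ballI allI)
      fix x y assume "x \<in> Sum_carrier" "y \<in> Sum_carrier"
      then have "p (x + y) \<le> p x + p y" "q (x + y) \<le> q x + q y"
        using sp sq by (simp_all add: seminorm_on_def)
      then show "p (x + y) + q (x + y) \<le> p x + q x + (p y + q y)" by linarith
    next
      fix c x assume "x \<in> Sum_carrier"
      then show "p (ssmul c x) + q (ssmul c x) = norm c * (p x + q x)"
        using sp sq by (simp add: seminorm_on_def distrib_left)
    qed
    show "cont_seminorm smul (X n) (\<lambda>x. p (single n x) + q (single n x))" for n
      using \<open>p \<in> Sum_seminorms\<close> q by (intro X.csn_add) (auto simp: Sum_seminorms_def)
  qed
next
  fix p and c :: real assume p: "p \<in> Sum_seminorms" and c: "c \<ge> 0"
  show "(\<lambda>x. c * p x) \<in> Sum_seminorms"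
    unfolding Sum_seminorms_def
  proof (intro CollectI conjI allI)
    show "seminorm_on ssmul Sum_carrier (\<lambda>x. c * p x)"
      using p c unfolding Sum_seminorms_def seminorm_on_def
      by (auto simp: distrib_left[symmetric] intro: mult_left_mono)
    show "cont_seminorm smul (X n) (\<lambda>x. c * p (single n x))" for n
      using p c by (intro X.csn_mult) (auto simp: Sum_seminorms_def)
  qed
next
  fix x assume x: "x \<in> Sum_carrier" and x0: "\<And>p. p \<in> Sum_seminorms \<Longrightarrow> p x = 0"
  have "lookup x n = 0" for n
    using lookup_in_topspace[OF x] x0[OF component_seminorm] by (rule X.eq_0_if_csn_0)
  then show "x = 0" by (intro poly_mapping_eqI) simp
qed

abbreviation Sum_topology where "Sum_topology \<equiv> Q.seminorm_topology"

sublocale Sum: lcs ssmul Sum_topology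
  by (simp add: lcs_def Q.locally_convex_seminorm_topology)

lemma topspace_Sum: "topspace Sum_topology = Sum_carrier"
  by (rule Q.topspace_seminorm_topology)

lemma continuous_single: "continuous_map (X n) Sum_topology (single n)"
  unfolding continuous_map_def
proof (intro conjI allI impI)
  fix U assume U: "openin Sum_topology U"
  show "openin (X n) {x \<in> topspace (X n). single n x \<in> U}"
    unfolding X.openin_iff_seminorm
  proof (intro conjI ballI)
    fix a assume a: "a \<in> {x \<in> topspace (X n). single n x \<in> U}"
    then obtain P where P: "P \<in> Sum_seminorms" "\<And>y. y \<in> Sum_carrier \<Longrightarrow> P (y - single n a) < 1 \<Longrightarrow> y \<in> U"
      using U unfolding Q.openin_seminorm_topology by blast
    have "cont_seminorm smul (X n) (\<lambda>x. P (single n x))"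
      using P(1) by (simp add: Sum_seminorms_def)
    moreover have "single n x \<in> U" if "x \<in> topspace (X n)" "P (single n (x - a)) < 1" for x
      using P(2)[OF single_in_carrier[OF that(1)]] that(2) by (simp add: Poly_Mapping.single_diff)
    ultimately show "\<exists>p. cont_seminorm smul (X n) p \<and>
        (\<forall>x\<in>topspace (X n). p (x - a) < 1 \<longrightarrow> x \<in> {x \<in> topspace (X n). single n x \<in> U})"
      by (intro exI[of _ "\<lambda>x. P (single n x)"]) auto
  qed auto
qed (auto simp: topspace_Sum intro: single_in_carrier)

text \<open>The universal property in terms of seminorms: continuity on the direct sum may be
  checked on one summand at a time. The continuity of the operator rests on it.\<close>

lemma cont_seminorm_Sum_iff:
  "cont_seminorm ssmul Sum_topology P \<longleftrightarrow> P \<in> Sum_seminorms"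
proof
  assume P: "cont_seminorm ssmul Sum_topology P"
  have "cont_seminorm smul (X n) (\<lambda>x. P (single n x))" for n
    using linear_single continuous_single P by (rule cont_seminorm_compose)
  then show "P \<in> Sum_seminorms"
    using Sum.csn_seminorm[OF P] unfolding topspace_Sum by (simp add: Sum_seminorms_def)
qed (rule Q.cont_seminorm_seminorm_topology)

lemma continuous_lookup: "continuous_map Sum_topology (X n) (\<lambda>y. lookup y n)"
proof (rule continuous_linear_mapI[OF Sum.lcs_axioms lcs])
  show "linear_map_on (topspace Sum_topology) ssmul smul (\<lambda>y. lookup y n)"
    by (simp add: linear_map_on_def lookup_add)
  show "lookup y n \<in> topspace (X n)" if "y \<in> topspace Sum_topology" for y
    using that by (simp add: topspace_Sum lookup_in_topspace)
  show "\<exists>p C. cont_seminorm ssmul Sum_topology p \<and> (\<forall>y\<in>topspace Sum_topology. q (lookup y n) \<le> C * p y)"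
    if "cont_seminorm smul (X n) q" for q
    using component_seminorm[OF that]
    by (intro exI[of _ "\<lambda>y. q (lookup y n)"] exI[of _ 1]) (simp add: cont_seminorm_Sum_iff)
qed

lemma embedding_single: "embedding_map (X n) Sum_topology (single n)"
proof -
  let ?Y = "subtopology Sum_topology (single n ` topspace (X n))"
  have "homeomorphic_maps (X n) ?Y (single n) (\<lambda>y. lookup y n)"
    unfolding homeomorphic_maps_def
  proof (intro conjI ballI)
    show "continuous_map (X n) ?Y (single n)"
      using continuous_single by (intro continuous_map_into_subtopology) auto
    show "continuous_map ?Y (X n) (\<lambda>y. lookup y n)"
      using continuous_lookup by (rule continuous_map_from_subtopology)
  qed auto
  then show ?thesis
    unfolding embedding_map_def by (rule homeomorphic_maps_imp_map)
qed

text \<open>A seminorm continuous for a competing topology restricts to a continuous one on each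
  summand, hence it already belongs to \<open>Sum_seminorms\<close>.\<close>

lemma strongest_inducing_Sum: "strongest_inducing_lc_topology smul X Sum_topology"
  unfolding strongest_inducing_lc_topology_def
proof (intro conjI allI impI)
  show "inducing_lc_topology smul X Sum_topology"
    unfolding inducing_lc_topology_def
    using topspace_Sum Q.locally_convex_seminorm_topology embedding_single by blast
  fix T' U assume T': "inducing_lc_topology smul X T'" and U: "openin T' U"
  interpret T': lcs ssmul T' using T' by (simp add: inducing_lc_topology_def lcs_def)
  have top: "topspace T' = Sum_carrier" using T' by (simp add: inducing_lc_topology_def)
  have "continuous_map (X n) T' (single n)" for n
  proof -
    have "embedding_map (X n) T' (single n)" using T' by (simp add: inducing_lc_topology_def)
    then show ?thesis
      unfolding embedding_map_def
      by (blast dest: homeomorphic_imp_continuous_map continuous_map_into_fulltopology)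
  qed
  then have "P \<in> Sum_seminorms" if "cont_seminorm ssmul T' P" for P
    using cont_seminorm_compose[OF linear_single _ that] T'.csn_seminorm[OF that]
    by (simp add: Sum_seminorms_def top)
  then show "openin Sum_topology U"
    using U unfolding T'.openin_iff_seminorm Q.openin_seminorm_topology top by blast
qed

lemma lc_direct_sum_eq: "lc_direct_sum smul X = Sum_topology"
  using strongest_inducing_Sum by (rule lc_direct_sum_eqI)

end

section \<open>An orbit with prescribed approximations\<close>

text \<open>The product of the coefficients along the path
  \<open>(0, 3^m) \<rightarrow> \<dots> \<rightarrow> (0, 3^Suc m - 1) \<rightarrow> (1, 3^Suc m - 1) \<rightarrow> \<dots> \<rightarrow> (3^Suc m, 3^Suc m - 1)\<close>.\<close>

definition chain_weight :: "(nat \<Rightarrow> nat \<Rightarrow> 'k::comm_monoid_mult) \<Rightarrow> nat \<Rightarrow> 'k" where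
  "chain_weight c m = (\<Prod>i<2 * 3 ^ m. c 0 (3 ^ m + i)) * (\<Prod>i<3 ^ Suc m. c (Suc i) (3 ^ Suc m - 1))"

text \<open>The index \<open>n\<close> of \<open>E n k\<close> stands for the summand,
  \<open>k\<close> for the position in it. \<open>D_chain\<close> divides out the coefficients of
  the chain and the factor with which it starts. \<open>d_span\<close> allows in \<open>d m\<close>
  only positions below \<open>3 ^ m\<close>, whose dying time is known before the chain that ends in
  \<open>d m\<close> is considered.\<close>

locale chain_operator = lcs smul T
  for smul :: "'k::real_normed_field \<Rightarrow> 'a::ab_group_add \<Rightarrow> 'a" and T +
  fixes A :: "'a \<Rightarrow> 'a" and E :: "nat \<Rightarrow> nat \<Rightarrow> 'a" and c :: "nat \<Rightarrow> nat \<Rightarrow> 'k"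
    and G :: "'a set" and D d :: "nat \<Rightarrow> 'a"
  assumes lin_A: "linear_map_on S smul smul A" and cont_A: "continuous_map T T A"
    and E_in_S: "E n k \<in> S" and E_l1_conv: "l1_conv smul T (E 0)"
    and G_in_S: "G \<subseteq> S"
    and c_nonzero: "c n k \<noteq> 0" and c_le_1: "norm (c n k) \<le> 1"
    and A_E_0: "A (E 0 k) = smul (c 0 k) (if \<exists>m. Suc k = 3 ^ m then E 1 k else E 0 (Suc k))"
    and A_E_mid: "1 \<le> n \<Longrightarrow> n \<le> k \<Longrightarrow> A (E n k) = smul (c n k) (E (Suc n) k)"
    and A_E_last: "A (E (Suc k) k) = smul (c (Suc k) k) (D k)"
    and A_E_beyond: "n > Suc k \<Longrightarrow> A (E n k) = 0"
    and A_G: "x \<in> G \<Longrightarrow> A x = 0"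
    and D_zero: "\<nexists>m. Suc k = 3 ^ Suc m \<Longrightarrow> D k = 0"
    and D_chain: "D (3 ^ Suc m - 1) = smul (inverse (of_real ((1 / 2) ^ 3 ^ m) * chain_weight c m)) (d m)"
    and d_span: "d m \<in> span ({E n b | n b. b < 3 ^ m} \<union> G)"
    and d_dense: "y \<in> S \<Longrightarrow> csn p \<Longrightarrow> e > 0 \<Longrightarrow> \<exists>m\<ge>M. p (d m - y) < e"
begin

lemma A_in_S: "x \<in> S \<Longrightarrow> A x \<in> S"
  using continuous_map_image_subset_topspace[OF cont_A] by blast

lemma pow_in_S: "x \<in> S \<Longrightarrow> (A ^^ r) x \<in> S"
  by (induction r) (auto simp: A_in_S)

lemma A_smul: "x \<in> S \<Longrightarrow> A (smul a x) = smul a (A x)"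
  using lin_A by (simp add: linear_map_on_def)

lemma pow_smul: "x \<in> S \<Longrightarrow> (A ^^ r) (smul a x) = smul a ((A ^^ r) x)"
  by (induction r) (auto simp: A_smul pow_in_S)

lemma pow_add: "x \<in> S \<Longrightarrow> y \<in> S \<Longrightarrow> (A ^^ r) (x + y) = (A ^^ r) x + (A ^^ r) y"
proof (induction r)
  case (Suc r)
  then show ?case using lin_A pow_in_S by (simp add: linear_map_on_def)
qed simp

lemma pow_0: "(A ^^ r) 0 = 0"
  using pow_smul[of 0 r 0] by simp

lemma pow_sum: "(\<And>i. i \<in> I \<Longrightarrow> g i \<in> S) \<Longrightarrow> (A ^^ r) (\<Sum>i\<in>I. g i) = (\<Sum>i\<in>I. (A ^^ r) (g i))"
  by (induction I rule: infinite_finite_induct) (auto simp: pow_0 pow_add S_sum)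

lemma pow_continuous: "continuous_map T T (A ^^ r)"
proof (induction r)
  case (Suc r)
  then show ?case
    using continuous_map_compose[OF Suc cont_A] by (simp only: funpow.simps)
qed simp

lemma pow_kill_mono: "(A ^^ r) x = 0 \<Longrightarrow> r \<le> s \<Longrightarrow> (A ^^ s) x = 0"
  using funpow_add[of "s - r" r A] by (simp add: pow_0)

lemma pow_kill_add: "(A ^^ r) x = smul a y \<Longrightarrow> y \<in> S \<Longrightarrow> (A ^^ s) y = 0 \<Longrightarrow> (A ^^ (s + r)) x = 0"
  by (simp add: funpow_add pow_smul)

lemma pow_kill_span:
  assumes "\<And>x. x \<in> B \<Longrightarrow> x \<in> S \<and> (A ^^ r) x = 0" "x \<in> span B"
  shows "(A ^^ r) x = 0"
proof -
  have "subspace {x \<in> S. (A ^^ r) x = 0}"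
    by (rule subspaceI) (auto simp: pow_0 pow_add pow_smul)
  then have "span B \<subseteq> {x \<in> S. (A ^^ r) x = 0}"
    using assms(1) by (intro span_minimal) auto
  then show ?thesis using assms(2) by blast
qed

lemma not_power_of_3:
  assumes "3 ^ m < (k::nat)" "k < 3 ^ Suc m"
  shows "k \<noteq> 3 ^ j"
proof
  assume "k = 3 ^ j"
  then have "(3::nat) ^ m < 3 ^ j" "(3::nat) ^ j < 3 ^ Suc m" using assms by (simp_all only:)
  then have "m < j" "j < Suc m"
    using power_less_imp_less_exp[of "3::nat" m j] power_less_imp_less_exp[of "3::nat" j "Suc m"]
    by (simp_all del: power_Suc)
  then show False by simp
qed

lemma pow_E_0:
  assumes "3 ^ m \<le> b" "b + r < 3 ^ Suc m"
  shows "(A ^^ r) (E 0 b) = smul (\<Prod>i<r. c 0 (b + i)) (E 0 (b + r))"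
  using assms(2)
proof (induction r)
  case (Suc r)
  have "\<nexists>j. Suc (b + r) = 3 ^ j"
    using not_power_of_3[of m "Suc (b + r)"] assms(1) Suc.prems by auto
  then have "A (E 0 (b + r)) = smul (c 0 (b + r)) (E 0 (Suc (b + r)))"
    by (simp only: A_E_0 if_False)
  then show ?case
    using Suc by (simp add: A_smul E_in_S)
qed simp

lemma pow_E_0_last:
  assumes "3 ^ m \<le> b" "b < 3 ^ Suc m"
  shows "(A ^^ (3 ^ Suc m - b)) (E 0 b) =
    smul (\<Prod>i<3 ^ Suc m - b. c 0 (b + i)) (E 1 (3 ^ Suc m - 1))"
proof -
  define r where "r = 3 ^ Suc m - 1 - b"
  have r: "3 ^ Suc m - b = Suc r" "b + r = 3 ^ Suc m - 1" "b + r < 3 ^ Suc m"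
    using assms(2) by (auto simp: r_def)
  have "A (E 0 (b + r)) = smul (c 0 (b + r)) (E 1 (b + r))"
    using r(3) A_E_0[of "b + r"] unfolding r(2) by (simp del: power_Suc)
  then have "(A ^^ Suc r) (E 0 b) = smul (\<Prod>i<Suc r. c 0 (b + i)) (E 1 (b + r))"
    by (simp add: pow_E_0[OF assms(1) r(3)] A_smul E_in_S)
  then show ?thesis unfolding r(1) by (simp only: r(2))
qed

lemma pow_E_pos:
  assumes "1 \<le> n" "n + r \<le> Suc k"
  shows "(A ^^ r) (E n k) = smul (\<Prod>i<r. c (n + i) k) (E (n + r) k)"
  using assms(2)
proof (induction r)
  case (Suc r)
  then show ?case
    using assms(1) by (simp add: A_smul E_in_S A_E_mid)
qed simp

lemma pow_E_pos_last:
  assumes "1 \<le> n" "n \<le> Suc k"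
  shows "(A ^^ (k + 2 - n)) (E n k) = smul (\<Prod>i<k + 2 - n. c (n + i) k) (D k)"
proof -
  have k: "k + 2 - n = Suc (Suc k - n)" "n + (Suc k - n) = Suc k" using assms by auto
  show ?thesis
    unfolding k(1) using pow_E_pos[OF assms(1), of "Suc k - n" k] k(2)
    by (simp add: A_smul E_in_S A_E_last)
qed

lemma d_in_S: "d m \<in> S"
proof -
  have "span ({E n b | n b. b < 3 ^ m} \<union> G) \<subseteq> S"
    using E_in_S G_in_S by (intro span_minimal subspace_S) auto
  then show ?thesis using d_span by blast
qed

lemma D_cases: "D k = 0 \<or> (\<exists>m a. Suc k = 3 ^ Suc m \<and> D k = smul a (d m))"
proof (cases "\<exists>m. Suc k = 3 ^ Suc m")
  case True
  then obtain m where m: "Suc k = 3 ^ Suc m" by blast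
  then have "k = 3 ^ Suc m - 1" by simp
  then show ?thesis using D_chain[of m] m by blast
qed (use D_zero in blast)

lemma D_in_S: "D k \<in> S"
  using D_cases[of k] d_in_S by auto

text \<open>From position \<open>b\<close> of the block between \<open>3 ^ m\<close> and
  \<open>3 ^ Suc m\<close>, at most \<open>2 * 3 ^ m\<close> steps lead out of the summand 0 and
  \<open>3 ^ Suc m\<close> more to a multiple of \<open>d m\<close>, which dies within
  \<open>3 ^ Suc m - 1\<close> steps by induction. The total \<open>8 * 3 ^ m - 1\<close> fits into
  \<open>3 ^ Suc (Suc m) - 1\<close>; starting in another summand is no slower.\<close>

lemma pow_kill_E: "b < 3 ^ m \<Longrightarrow> (A ^^ (3 ^ Suc m - 1)) (E n b) = 0"
proof (induction m arbitrary: n b)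
  case 0
  then have b: "b = 0" by simp
  \<comment> \<open>Position 0 leaves the summand 0 at once because \<open>Suc 0 = 3 ^ 0\<close>,
    but its chain has no target: 1 is not a positive power of 3, so \<open>D 0 = 0\<close>.\<close>
  have "Suc 0 \<noteq> 3 ^ Suc m" for m :: nat by simp
  then have D0: "D 0 = 0" by (intro D_zero) blast
  have E1: "A (E (Suc 0) 0) = 0" using A_E_last[of 0] D0 by simp
  have E2: "A (E n 0) = 0" if "n \<ge> 1" for n
    using that E1 A_E_beyond[of 0 n] by (cases "n = 1") auto
  have "\<exists>m. Suc 0 = 3 ^ m" by (rule exI[of _ 0]) simp
  then have "A (E 0 0) = smul (c 0 0) (E 1 0)"
    unfolding A_E_0[of 0] by (rule arg_cong[OF if_P])
  then have "(A ^^ 2) (E n 0) = 0"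
    using E2[of n] E1 E2[of 1] pow_0[of 1]
    by (cases n) (auto simp: numeral_2_eq_2 A_smul E_in_S)
  then show ?case using b by simp
next
  case (Suc m)
  let ?K = "3 ^ Suc m - 1 :: nat"
  have pow3: "(3::nat) ^ m \<ge> 1" "(3::nat) ^ Suc m = 3 * 3 ^ m" "(3::nat) ^ Suc (Suc m) = 9 * 3 ^ m"
    by simp_all
  have dm: "(A ^^ ?K) (d m) = 0"
  proof (rule pow_kill_span[OF _ d_span])
    fix x assume "x \<in> {E n b | n b. b < 3 ^ m} \<union> G"
    then show "x \<in> S \<and> (A ^^ ?K) x = 0"
    proof
      assume x: "x \<in> G"
      then have "(A ^^ 1) x = 0" by (simp add: A_G)
      then have "(A ^^ ?K) x = 0" by (rule pow_kill_mono) (use pow3 in linarith)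
      then show ?thesis using x G_in_S by blast
    qed (use Suc.IH E_in_S in blast)
  qed
  show ?case
  proof (cases "b < 3 ^ m")
    case True
    then show ?thesis using pow_kill_mono[OF Suc.IH] pow3 by simp
  next
    case False
    \<comment> \<open>Inside the block, \<open>D b\<close> can be nonzero only at the last position,
      where it is a multiple of \<open>d m\<close>.\<close>
    have DK: "(A ^^ ?K) (D b) = 0" if b: "3 ^ m \<le> b" "b < 3 ^ Suc m" for b
    proof (cases "D b = 0")
      case False
      then obtain j a where j: "Suc b = 3 ^ Suc j" "D b = smul a (d j)" using D_cases by blast
      have "\<not> Suc b < 3 ^ Suc m" using not_power_of_3[of m "Suc b" "Suc j"] j(1) b(1) by auto
      then have "(3::nat) ^ Suc j = 3 ^ Suc m" using j(1) b(2) by linarith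
      then have "j = m" by simp
      then show ?thesis using j(2) dm d_in_S pow_smul by simp
    qed (simp add: pow_0)
    have pos: "(A ^^ (?K + (b + 2 - n))) (E n b) = 0" if "1 \<le> n" "n \<le> Suc b" "3 ^ m \<le> b" "b < 3 ^ Suc m" for n b
      using pow_E_pos_last[OF that(1,2)] D_in_S DK[OF that(3,4)] by (rule pow_kill_add)
    consider "n > Suc b" | "1 \<le> n" "n \<le> Suc b" | "n = 0" by linarith
    then show ?thesis
    proof cases
      case 1
      then have "(A ^^ 1) (E n b) = 0" using A_E_beyond by simp
      then show ?thesis by (rule pow_kill_mono) (use pow3 in linarith)
    next
      case 2
      have "(A ^^ (?K + (b + 2 - n))) (E n b) = 0" using pos 2 False Suc.prems by simp
      then show ?thesis by (rule pow_kill_mono) (use pow3 2 Suc.prems in linarith)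
    next
      case 3
      \<comment> \<open>Every \<open>E 0 b\<close> of the block leaves the summand 0 through the
        last position \<open>?K\<close>, whatever \<open>b\<close> is.\<close>
      have "(A ^^ (?K + (?K + 2 - 1))) (E 1 ?K) = 0"
        using pow3 by (intro pos) auto
      moreover have "3 ^ m \<le> b" using False by simp
      ultimately have "(A ^^ ((?K + (?K + 2 - 1)) + (3 ^ Suc m - b))) (E n b) = 0"
        unfolding 3 by (intro pow_kill_add[OF pow_E_0_last[OF _ Suc.prems] E_in_S])
      then show ?thesis
        by (rule pow_kill_mono) (use pow3 False Suc.prems in linarith)
    qed
  qed
qed

text \<open>The scalar in \<open>D_chain\<close> is the inverse of the weight accumulated here times
  the starting coefficient, so exactly \<open>d m\<close> remains.\<close>

lemma pow_E_0_target:
  "smul (of_real ((1 / 2) ^ 3 ^ m)) ((A ^^ (5 * 3 ^ m)) (E 0 (3 ^ m))) = d m"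
proof -
  let ?K = "3 ^ Suc m - 1 :: nat"
  have steps: "5 * 3 ^ m = (?K + 2 - 1) + (3 ^ Suc m - 3 ^ m)" "3 ^ Suc m - 3 ^ m = 2 * (3::nat) ^ m"
    "?K + 2 - 1 = 3 ^ Suc m"
    by simp_all
  have "(A ^^ (3 ^ Suc m - 3 ^ m)) (E 0 (3 ^ m)) = smul (\<Prod>i<2 * 3 ^ m. c 0 (3 ^ m + i)) (E 1 ?K)"
    using pow_E_0_last[of m "3 ^ m"] unfolding steps(2) by simp
  moreover have "(A ^^ (?K + 2 - 1)) (E 1 ?K) = smul (\<Prod>i<3 ^ Suc m. c (Suc i) ?K) (D ?K)"
    using pow_E_pos_last[of 1 ?K] unfolding steps(3) by simp
  ultimately have "(A ^^ (5 * 3 ^ m)) (E 0 (3 ^ m)) = smul (chain_weight c m) (D ?K)"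
    unfolding steps(1) funpow_add o_apply by (simp only: pow_smul E_in_S scale_scale chain_weight_def)
  moreover have "chain_weight c m \<noteq> 0"
    unfolding chain_weight_def by (simp add: c_nonzero)
  then have "h * (chain_weight c m * inverse (h * chain_weight c m)) = 1"
    if "h \<noteq> 0" for h
    using that right_inverse[of "h * chain_weight c m"] by (simp only: mult.assoc mult_eq_0_iff) simp
  ultimately show ?thesis
    by (simp only: D_chain scale_scale) (simp del: inverse_mult_distrib of_real_power)
qed

definition start :: "nat \<Rightarrow> 'k" where
  "start k = (if \<exists>m. k = 3 ^ m then of_real ((1 / 2) ^ k) else 0)"

lemma norm_start_le: "norm (start k) \<le> (1 / 2) ^ k"
  by (simp add: start_def norm_power norm_divide)

lemma summable_start: "summable (\<lambda>k. norm (start k))"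
  by (rule summable_comparison_test'[where N = 0, OF summable_geometric[of "1 / 2 :: real"]])
    (use norm_start_le in auto)

lemma half_power_sum_le: "(\<Sum>k\<in>{Suc a..<N}. (1 / 2 :: real) ^ k) \<le> (1 / 2) ^ a"
proof (cases "Suc a \<le> N")
  case True
  then have "(\<Sum>k\<in>{Suc a..<N}. (1 / 2 :: real) ^ k) = (1 / 2) ^ a - 2 * (1 / 2) ^ N"
  proof (induction rule: dec_induct)
    case (step n)
    then show ?case by (simp add: sum.atLeastLessThan_Suc)
  qed simp
  moreover have "(0::real) \<le> 2 * (1 / 2) ^ N" by simp
  ultimately show ?thesis by linarith
qed simp

text \<open>The bound does not depend on \<open>N\<close>; this lets it pass to the limit. Since
  \<open>B\<close> bounds \<open>p\<close> on all of \<open>E 0\<close>, it also covers the terms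
  that have moved within the summand 0.\<close>

lemma pow_start_partial_sum_le:
  assumes p: "csn p" and B: "\<And>k. p (E 0 k) \<le> B" and N: "N > 3 ^ m"
  shows "p ((A ^^ (5 * 3 ^ m)) (\<Sum>k<N. smul (start k) (E 0 k)) + - d m) \<le> B * (1 / 2) ^ m"
proof -
  let ?r = "5 * 3 ^ m :: nat"
  let ?t = "\<lambda>k. smul (start k) ((A ^^ ?r) (E 0 k))"
  have B0: "B \<ge> 0" using csn_nonneg[OF p E_in_S] B order_trans by metis
  have pow3: "(3::nat) ^ m \<ge> 1" "(3::nat) ^ Suc m = 3 * 3 ^ m" by simp_all
  have "(A ^^ ?r) (\<Sum>k<N. smul (start k) (E 0 k)) = (\<Sum>k<N. ?t k)"
    by (subst pow_sum) (auto simp: pow_smul E_in_S)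
  also have "\<dots> = (\<Sum>k<3 ^ m. ?t k) + (?t (3 ^ m) + (\<Sum>k\<in>{Suc (3 ^ m)..<N}. ?t k))"
  proof -
    have "{..<N} = {..<3 ^ m} \<union> insert (3 ^ m) {Suc (3 ^ m)..<N}" using N by auto
    moreover have "{..<3 ^ m} \<inter> insert (3 ^ m) {Suc (3 ^ m)..<N} = {}" by auto
    ultimately show ?thesis by (simp add: sum.union_disjoint)
  qed
  also have "(\<Sum>k<3 ^ m. ?t k) = 0"
  proof (rule sum.neutral, rule ballI)
    fix k assume "k \<in> {..<(3::nat) ^ m}"
    then have "(A ^^ (3 ^ Suc m - 1)) (E 0 k) = 0" by (intro pow_kill_E) simp
    then have "(A ^^ ?r) (E 0 k) = 0" by (rule pow_kill_mono) simp
    then show "?t k = 0" by simp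
  qed
  also have "?t (3 ^ m) = d m"
    using pow_E_0_target[of m] unfolding start_def by auto
  finally have eq: "(A ^^ ?r) (\<Sum>k<N. smul (start k) (E 0 k)) + - d m = (\<Sum>k\<in>{Suc (3 ^ m)..<N}. ?t k)"
    by simp
  have "p (\<Sum>k\<in>{Suc (3 ^ m)..<N}. ?t k) \<le> (\<Sum>k\<in>{Suc (3 ^ m)..<N}. p (?t k))"
    using E_in_S pow_in_S by (intro csn_sum[OF p]) auto
  also have "\<dots> \<le> (\<Sum>k\<in>{Suc (3 ^ m)..<N}. B * (1 / 2) ^ k)"
  proof (rule sum_mono)
    fix k assume k: "k \<in> {Suc (3 ^ m)..<N}"
    show "p (?t k) \<le> B * (1 / 2) ^ k"
    proof (cases "\<exists>j. k = 3 ^ j")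
      case True
      then obtain j where j: "k = 3 ^ j" by blast
      have "(3::nat) ^ m < 3 ^ j" using k unfolding j by (simp only: atLeastLessThan_iff Suc_le_eq)
      then have "m < j" by (rule power_less_imp_less_exp[rotated]) simp
      then have "(3::nat) ^ Suc m \<le> 3 ^ j" by (intro power_increasing) auto
      \<comment> \<open>From \<open>3 * 3 ^ m \<le> 3 ^ j\<close> it follows that
        \<open>5 * 3 ^ m < 2 * 3 ^ j\<close>, so the term has not yet left the block of
        \<open>3 ^ j\<close>.\<close>
      then have kr: "k + ?r < 3 ^ Suc j"
        using pow3 power_Suc[of "3::nat" j] unfolding j by linarith
      have t: "?t k = smul (start k * (\<Prod>i<?r. c 0 (k + i))) (E 0 (k + ?r))"
        using pow_E_0[OF _ kr] j by simp
      \<comment> \<open>The step coefficients never enlarge a term, so the later terms keep at least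
        the smallness they had at the start.\<close>
      have "norm (\<Prod>i<?r. c 0 (k + i)) \<le> 1"
        unfolding prod_norm[symmetric] using c_le_1 by (intro prod_le_1) auto
      then have "norm (start k * (\<Prod>i<?r. c 0 (k + i))) \<le> (1 / 2) ^ k * 1"
        unfolding norm_mult using norm_start_le by (intro mult_mono) auto
      then have "norm (start k * (\<Prod>i<?r. c 0 (k + i))) * p (E 0 (k + ?r)) \<le> (1 / 2) ^ k * 1 * B"
        using B csn_nonneg[OF p E_in_S] by (intro mult_mono) auto
      then show ?thesis unfolding t csn_scale[OF p E_in_S] by (simp add: mult.commute)
    next
      case False
      then have "start k = 0" by (simp add: start_def)
      then show ?thesis using csn_0[OF p] B0 by simp
    qed
  qed
  also have "\<dots> = B * (\<Sum>k\<in>{Suc (3 ^ m)..<N}. (1 / 2) ^ k)" by (simp add: sum_distrib_left)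
  also have "\<dots> \<le> B * (1 / 2) ^ 3 ^ m"
    using B0 half_power_sum_le by (intro mult_left_mono) auto
  also have "\<dots> \<le> B * (1 / 2) ^ m"
    using B0 less_exp[of m] power_mono[of 2 "3::nat" m]
    by (intro mult_left_mono power_decreasing) auto
  finally show ?thesis unfolding eq .
qed

lemma hypercyclic: "\<exists>x\<in>S. T closure_of {(A ^^ k) x | k. True} = S"
proof
  define x where "x = l1_sum (E 0) start"
  have lim: "limitin T (\<lambda>N. \<Sum>k<N. smul (start k) (E 0 k)) x sequentially"
    unfolding x_def using E_l1_conv summable_start by (rule l1_sum_limit)
  show xS: "x \<in> S" using lim by (rule limitin_topspace)
  \<comment> \<open>Continuity of the fixed power carries the estimate from the partial sums to
    \<open>x\<close>.\<close>
  have close: "p ((A ^^ (5 * 3 ^ m)) x + - d m) \<le> B * (1 / 2) ^ m"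
    if p: "csn p" and B: "\<And>k. p (E 0 k) \<le> B" for p B m
  proof -
    have "limitin T ((A ^^ (5 * 3 ^ m)) \<circ> (\<lambda>N. \<Sum>k<N. smul (start k) (E 0 k)))
        ((A ^^ (5 * 3 ^ m)) x) sequentially"
      using pow_continuous lim by (rule continuous_map_limit)
    then have "limitin T (\<lambda>N. (A ^^ (5 * 3 ^ m)) (\<Sum>k<N. smul (start k) (E 0 k)) + - d m)
        ((A ^^ (5 * 3 ^ m)) x + - d m) sequentially"
      using d_in_S by (intro limitin_add) (auto simp: o_def)
    then show ?thesis
      by (rule limitin_csn_bound[OF p, where m = "Suc (3 ^ m)"])
        (use pow_start_partial_sum_le[OF p B] in simp)
  qed
  have "y \<in> T closure_of {(A ^^ k) x | k. True}" if y: "y \<in> S" for y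
    unfolding in_closure_iff_seminorm
  proof (intro conjI allI impI)
    fix p and e :: real assume pe: "csn p \<and> e > 0"
    then have p: "csn p" and e: "e > 0" by auto
    obtain B where B: "\<And>k. p (E 0 k) \<le> B" using l1_convD(2)[OF E_l1_conv p] by blast
    have B0: "B \<ge> 0" using csn_nonneg[OF p E_in_S] B order_trans by metis
    have "(\<lambda>m. B * (1 / 2) ^ m) \<longlonglongrightarrow> B * 0"
      by (intro tendsto_mult_left LIMSEQ_power_zero) simp
    then have "\<forall>\<^sub>F m in sequentially. B * (1 / 2) ^ m < e / 2"
      using e by (intro order_tendstoD(2)[where y = "B * 0"]) auto
    then obtain M where M: "\<And>m. m \<ge> M \<Longrightarrow> B * (1 / 2) ^ m < e / 2"
      by (auto simp: eventually_sequentially)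
    have "e / 2 > 0" using e by simp
    \<comment> \<open>It matters that \<open>d\<close> returns near \<open>y\<close> at arbitrarily
      late indices: only there is the error of the orbit below \<open>e / 2\<close>.\<close>
    then obtain m where m: "m \<ge> M" "p (d m - y) < e / 2" using d_dense[OF y p] by blast
    have "p (((A ^^ (5 * 3 ^ m)) x + - d m) + (d m - y)) \<le> p ((A ^^ (5 * 3 ^ m)) x + - d m) + p (d m - y)"
      using xS y d_in_S pow_in_S by (intro csn_triangle[OF p]) auto
    also have "\<dots> < e" using close[OF p B, of m] M[OF m(1)] m(2) by simp
    finally have "p ((A ^^ (5 * 3 ^ m)) x - y) < e" by simp
    then show "\<exists>u\<in>{(A ^^ k) x | k. True} \<inter> S. p (u - y) < e"
      using pow_in_S[OF xS] by blast
  qed (rule y)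
  then show "T closure_of {(A ^^ k) x | k. True} = S"
    using closure_of_subset_topspace[of T "{(A ^^ k) x | k. True}"] by blast
qed

end

section \<open>Operators on the direct sum\<close>

context lcs
begin

text \<open>With \<open>l1_conv_if\<close> and \<open>l1_conv_single\<close> this yields the image
  sequences of the operator: next positions, a switch at powers of 3, and one exceptional
  vector.\<close>

lemma l1_conv_shift:
  assumes v: "l1_conv smul T v"
  shows "l1_conv smul T (\<lambda>k. v (Suc k))"
  unfolding l1_conv_def
proof (intro conjI allI impI)
  show "v (Suc k) \<in> S" for k by (rule l1_convD(1)[OF v])
  show "\<exists>B. \<forall>k. p (v (Suc k)) \<le> B" if "csn p" for p
    using l1_convD(2)[OF v that] by blast
  fix a :: "nat \<Rightarrow> 'k" assume a: "summable (\<lambda>k. norm (a k))"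
  define b where "b k = (case k of 0 \<Rightarrow> 0 | Suc j \<Rightarrow> a j)" for k
  have "summable (\<lambda>k. norm (b k))"
    using a by (subst summable_Suc_iff[symmetric]) (simp add: b_def)
  then obtain s where "limitin T (\<lambda>N. \<Sum>k<N. smul (b k) (v k)) s sequentially"
    using l1_convD(3)[OF v] by blast
  then have "limitin T (\<lambda>N. \<Sum>k<N + 1. smul (b k) (v k)) s sequentially"
    by (rule limitin_sequentially_offset)
  moreover have "(\<Sum>k<N + 1. smul (b k) (v k)) = (\<Sum>k<N. smul (a k) (v (Suc k)))" for N
    unfolding add_Suc_right add_0_right One_nat_def sum.lessThan_Suc_shift by (simp add: b_def)
  ultimately show "\<exists>s. limitin T (\<lambda>N. \<Sum>k<N. smul (a k) (v (Suc k))) s sequentially" by auto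
qed

text \<open>The coefficients are split into their parts on and off \<open>P\<close>; each part is
  absolutely summable, so no order of summation has to be rearranged.\<close>

lemma l1_conv_if:
  assumes v: "l1_conv smul T v" and w: "l1_conv smul T w"
  shows "l1_conv smul T (\<lambda>k. if P k then v k else w k)"
  unfolding l1_conv_def
proof (intro conjI allI impI)
  show "(if P k then v k else w k) \<in> S" for k
    using l1_convD(1)[OF v] l1_convD(1)[OF w] by simp
  show "\<exists>B. \<forall>k. p (if P k then v k else w k) \<le> B" if p: "csn p" for p
  proof -
    obtain B where B: "\<And>k. p (v k) \<le> B" using l1_convD(2)[OF v p] by blast
    obtain C where C: "\<And>k. p (w k) \<le> C" using l1_convD(2)[OF w p] by blast
    have "p (if P k then v k else w k) \<le> max B C" for k
      using B[of k] C[of k] by auto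
    then show ?thesis by blast
  qed
  fix a :: "nat \<Rightarrow> 'k" assume a: "summable (\<lambda>k. norm (a k))"
  have ab: "summable (\<lambda>k. norm (if P k then a k else 0))" "summable (\<lambda>k. norm (if P k then 0 else a k))"
    by (rule summable_comparison_test'[OF a, of 0]; simp)+
  obtain s t where "limitin T (\<lambda>N. \<Sum>k<N. smul (if P k then a k else 0) (v k)) s sequentially"
      "limitin T (\<lambda>N. \<Sum>k<N. smul (if P k then 0 else a k) (w k)) t sequentially"
    using l1_convD(3)[OF v ab(1)] l1_convD(3)[OF w ab(2)] by blast
  then have "limitin T (\<lambda>N. (\<Sum>k<N. smul (if P k then a k else 0) (v k)) +
      (\<Sum>k<N. smul (if P k then 0 else a k) (w k))) (s + t) sequentially"
    by (rule limitin_add)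
  moreover have "(\<Sum>k<N. smul (if P k then a k else 0) (v k)) + (\<Sum>k<N. smul (if P k then 0 else a k) (w k)) =
      (\<Sum>k<N. smul (a k) (if P k then v k else w k))" for N
    unfolding sum.distrib[symmetric] by (rule sum.cong) auto
  ultimately show "\<exists>s. limitin T (\<lambda>N. \<Sum>k<N. smul (a k) (if P k then v k else w k)) s sequentially"
    by auto
qed

text \<open>The series has one nonzero term at most, so \<open>u\<close> may be as large as desired.
  This is where freely chosen images enter.\<close>

lemma l1_conv_single:
  assumes u: "u \<in> S"
  shows "l1_conv smul T (\<lambda>k. if k = j then u else 0)"
  unfolding l1_conv_def
proof (intro conjI allI impI)
  show "(if k = j then u else 0) \<in> S" for k using u by simp
  show "\<exists>B. \<forall>k. p (if k = j then u else 0) \<le> B" for p :: "'a \<Rightarrow> real"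
    by (rule exI[of _ "max (p u) (p 0)"]) simp
  fix a :: "nat \<Rightarrow> 'k"
  have "(\<Sum>k<N. smul (a k) (if k = j then u else 0)) = smul (a j) u" if "N \<ge> Suc j" for N
  proof -
    have "(\<Sum>k<N. smul (a k) (if k = j then u else 0)) = (\<Sum>k<N. if k = j then smul (a j) u else 0)"
      by (rule sum.cong) auto
    then show ?thesis using that by simp
  qed
  then have "\<forall>\<^sub>F N in sequentially. (\<Sum>k<N. smul (a k) (if k = j then u else 0)) = smul (a j) u"
    unfolding eventually_sequentially by blast
  then have "limitin T (\<lambda>N. \<Sum>k<N. smul (a k) (if k = j then u else 0)) (smul (a j) u) sequentially"
    using u by (intro limitin_eventually) auto
  then show "\<exists>s. limitin T (\<lambda>N. \<Sum>k<N. smul (a k) (if k = j then u else 0)) s sequentially" by blast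
qed

lemma l1_sum_single:
  assumes "v j \<in> S"
  shows "l1_sum v (\<lambda>k. if k = j then a else 0) = smul a (v j)"
proof (rule l1_sum_eqI)
  have "(\<Sum>k<N. smul (if k = j then a else 0) (v k)) = smul a (v j)" if "N \<ge> Suc j" for N
  proof -
    have "(\<Sum>k<N. smul (if k = j then a else 0) (v k)) = (\<Sum>k<N. if k = j then smul a (v j) else 0)"
      by (rule sum.cong) auto
    then show ?thesis using that by simp
  qed
  then have "\<forall>\<^sub>F N in sequentially. (\<Sum>k<N. smul (if k = j then a else 0) (v k)) = smul a (v j)"
    unfolding eventually_sequentially by blast
  then show "limitin T (\<lambda>N. \<Sum>k<N. smul (if k = j then a else 0) (v k)) (smul a (v j)) sequentially"
    using assms by (intro limitin_eventually) auto
qed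

lemma l1_sum_zero: "l1_sum v (\<lambda>k. 0) = 0"
  by (rule l1_sum_eqI) simp

lemma l1_sum_add:
  assumes "l1_conv smul T v" "summable (\<lambda>k. norm (a k))" "summable (\<lambda>k. norm (b k))"
  shows "l1_sum v (\<lambda>k. a k + b k) = l1_sum v a + l1_sum v b"
  using limitin_add[OF l1_sum_limit[OF assms(1,2)] l1_sum_limit[OF assms(1,3)]]
  by (intro l1_sum_eqI) (simp add: scale_left_distrib sum.distrib)

lemma l1_sum_scale:
  assumes "l1_conv smul T v" "summable (\<lambda>k. norm (a k))"
  shows "l1_sum v (\<lambda>k. c * a k) = smul c (l1_sum v a)"
  using limitin_scale[OF l1_sum_limit[OF assms], of c]
  by (intro l1_sum_eqI) (simp add: scale_sum_right)

lemma closure_of_subspace_add: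
  assumes V: "subspace V" and x: "x \<in> T closure_of V" and y: "y \<in> T closure_of V"
  shows "x + y \<in> T closure_of V"
  unfolding in_closure_iff_seminorm
proof (intro conjI allI impI)
  have xy: "x \<in> S" "y \<in> S" using x y by (simp_all add: in_closure_of)
  then show "x + y \<in> S" by simp
  fix p and e :: real assume pe: "csn p \<and> e > 0"
  then have p: "csn p" and e: "e / 2 > 0" by auto
  obtain u where u: "u \<in> V \<inter> S" "p (u - x) < e / 2"
    using x p e unfolding in_closure_iff_seminorm by meson
  obtain w where w: "w \<in> V \<inter> S" "p (w - y) < e / 2"
    using y p e unfolding in_closure_iff_seminorm by meson
  have "p ((u - x) + (w - y)) \<le> p (u - x) + p (w - y)"
    using u(1) w(1) xy by (intro csn_triangle[OF p]) auto
  then have "p ((u + w) - (x + y)) < e" using u(2) w(2) by (simp add: algebra_simps)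
  moreover have "u + w \<in> V \<inter> S" using u(1) w(1) subspace_add[OF V] by auto
  ultimately show "\<exists>z\<in>V \<inter> S. p (z - (x + y)) < e" by blast
qed

end

lemma l1_conv_image:
  assumes "lcs s T" "lcs s' T'" and lin: "linear_map_on (topspace T) s s' h"
    and cont: "continuous_map T T' h" and v: "l1_conv s T v"
  shows "l1_conv s' T' (\<lambda>k. h (v k))"
  unfolding l1_conv_def
proof (intro conjI allI impI)
  interpret A: lcs s T by fact
  interpret B: lcs s' T' by fact
  note vS = A.l1_convD(1)[OF v]
  show "h (v k) \<in> topspace T'" for k
    using continuous_map_image_subset_topspace[OF cont] vS by blast
  show "\<exists>B. \<forall>k. p (h (v k)) \<le> B" if "cont_seminorm s' T' p" for p
    using A.l1_convD(2)[OF v cont_seminorm_compose[OF lin cont that]] .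
  have hadd: "h (x + y) = h x + h y" if "x \<in> topspace T" "y \<in> topspace T" for x y
    using lin that by (simp add: linear_map_on_def)
  have hscale: "h (s c x) = s' c (h x)" if "x \<in> topspace T" for c x
    using lin that by (simp add: linear_map_on_def)
  have h0: "h 0 = 0"
    using hscale[of 0 0] A.S_intros(1) by simp
  have hsum: "h (\<Sum>k\<in>I. s (a k) (v k)) = (\<Sum>k\<in>I. s' (a k) (h (v k)))" for I :: "nat set" and a
  proof (induction I rule: infinite_finite_induct)
    case (insert k I)
    have "h (s (a k) (v k) + (\<Sum>k\<in>I. s (a k) (v k))) = h (s (a k) (v k)) + h (\<Sum>k\<in>I. s (a k) (v k))"
      using vS by (intro hadd A.S_sum) auto
    then show ?case using insert hscale[OF vS] by simp
  qed (simp_all add: h0)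
  fix a :: "nat \<Rightarrow> 'a" assume "summable (\<lambda>k. norm (a k))"
  then obtain l where "limitin T (\<lambda>N. \<Sum>k<N. s (a k) (v k)) l sequentially"
    using A.l1_convD(3)[OF v] by blast
  then have "limitin T' (h \<circ> (\<lambda>N. \<Sum>k<N. s (a k) (v k))) (h l) sequentially"
    by (rule continuous_map_limit[OF cont])
  then show "\<exists>l. limitin T' (\<lambda>N. \<Sum>k<N. s' (a k) (h (v k))) l sequentially"
    by (auto simp: o_def hsum)
qed

text \<open>The dense sequence is taken from the span itself and not merely from its closure,
  because the targets of the chains have to be killed by some power of the operator.\<close>

lemma countable_dense_in_span:
  fixes smul :: "'k::{real_normed_field, second_countable_topology} \<Rightarrow> 'a::ab_group_add \<Rightarrow> 'a"
  assumes "lcs smul T" and B: "countable B" "B \<subseteq> topspace T"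
    and dense: "T closure_of (module.span smul B) = topspace T"
  obtains a :: "nat \<Rightarrow> 'a" where "\<And>i. a i \<in> module.span smul B"
    "\<And>y p e. y \<in> topspace T \<Longrightarrow> cont_seminorm smul T p \<Longrightarrow> e > 0 \<Longrightarrow> \<exists>i. p (a i - y) < e"
proof -
  interpret lcs smul T by fact
  obtain K :: "'k set" where K: "countable K" "\<And>X. open X \<Longrightarrow> X \<noteq> {} \<Longrightarrow> \<exists>d\<in>K. d \<in> X"
    using countable_dense_setE[where 'a = 'k] by metis
  \<comment> \<open>Finite combinations with coefficients from a countable dense set of scalars,
    encoded by lists of pairs.\<close>
  define L where "L = (\<lambda>l. \<Sum>(c, b)\<leftarrow>l. smul c b) ` lists (K \<times> B)"
  have L: "countable L" unfolding L_def using K(1) B(1) by simp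
  have L0: "0 \<in> L" unfolding L_def by (rule image_eqI[of _ _ "[]"]) auto
  have Ladd: "smul c b + u \<in> L" if cb: "c \<in> K" "b \<in> B" and u: "u \<in> L" for c b u
  proof -
    obtain l where "l \<in> lists (K \<times> B)" "u = (\<Sum>(c, b)\<leftarrow>l. smul c b)" using u by (auto simp: L_def)
    then show ?thesis unfolding L_def using cb by (intro image_eqI[of _ _ "(c, b) # l"]) auto
  qed
  have spanS: "u \<in> S" if "u \<in> span B" for u
    using span_minimal[OF B(2) subspace_S] that by blast
  have Lspan: "u \<in> span B" if u: "u \<in> L" for u
  proof -
    obtain l where "l \<in> lists (K \<times> B)" "u = (\<Sum>(c, b)\<leftarrow>l. smul c b)" using u by (auto simp: L_def)
    then show ?thesis
    proof (induction l arbitrary: u)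
      case (Cons x l)
      then show ?case by (auto intro: span_add span_scale span_base)
    qed (simp add: span_zero)
  qed
  have approx: "u \<in> S \<and> (\<forall>e>0. \<exists>w\<in>L. p (w - u) < e)" if p: "csn p" and u: "u \<in> span B" for p u
    using u
  proof (induction rule: span_induct_alt)
    case base
    show ?case using L0 csn_0[OF p] by (intro conjI allI impI bexI[of _ 0]) auto
  next
    case (step c b u)
    have bS: "b \<in> S" using step(1) B(2) by blast
    have uS: "u \<in> S" using step(2) by blast
    show ?case
    proof (intro conjI allI impI)
      show "smul c b + u \<in> S" using bS uS by simp
      fix e :: real assume e: "e > 0"
      then obtain w where w: "w \<in> L" "p (w - u) < e / 2"
        using step(2) half_gt_zero by blast
      have wS: "w \<in> S" by (rule spanS[OF Lspan[OF w(1)]])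
      \<comment> \<open>Changing the coefficient of \<open>b\<close> by less than
        \<open>\<delta>\<close> costs at most \<open>e / 2\<close>; the added 1 covers
        \<open>p b = 0\<close>.\<close>
      define \<delta> where "\<delta> = e / 2 / (p b + 1)"
      have pb: "p b \<ge> 0" by (rule csn_nonneg[OF p bS])
      have \<delta>: "\<delta> > 0" using e pb by (simp add: \<delta>_def)
      then obtain q where q: "q \<in> K" "q \<in> ball c \<delta>" using K(2)[of "ball c \<delta>"] by auto
      have "norm (q - c) * p b \<le> \<delta> * (p b + 1)"
        using q(2) pb \<delta> by (intro mult_mono) (auto simp: dist_norm norm_minus_commute)
      also have "\<dots> = e / 2"
      proof -
        have "r / (p b + 1) * (p b + 1) = r" for r using pb by simp
        then show ?thesis unfolding \<delta>_def .
      qed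
      finally have *: "p (smul (q - c) b) \<le> e / 2" by (simp add: csn_scale[OF p bS])
      have "p (smul (q - c) b + (w - u)) \<le> p (smul (q - c) b) + p (w - u)"
        using bS wS uS by (intro csn_triangle[OF p]) auto
      then have "p ((smul q b + w) - (smul c b + u)) < e"
        using * w(2) by (simp add: scale_left_diff_distrib algebra_simps)
      then show "\<exists>w\<in>L. p (w - (smul c b + u)) < e"
        using Ladd[OF q(1) step(1) w(1)] by blast
    qed
  qed
  show thesis
  proof (rule that[of "from_nat_into L"])
    have "from_nat_into L i \<in> L" for i using L0 by (intro from_nat_into) auto
    then show "from_nat_into L i \<in> span B" for i by (rule Lspan)
    fix y p and e :: real assume y: "y \<in> S" and p: "csn p" and e: "e > 0"
    have "y \<in> T closure_of span B" using dense y by simp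
    then obtain u where u: "u \<in> span B \<inter> S" "p (u - y) < e / 2"
      using p half_gt_zero[OF e] unfolding in_closure_iff_seminorm by meson
    then obtain w where w: "w \<in> L" "p (w - u) < e / 2"
      using approx[OF p, of u] half_gt_zero[OF e] by blast
    have wS: "w \<in> S" by (rule spanS[OF Lspan[OF w(1)]])
    obtain i where i: "from_nat_into L i = w" using from_nat_into_surj[OF L w(1)] by blast
    have "p ((w - u) + (u - y)) \<le> p (w - u) + p (u - y)"
      using wS u(1) y by (intro csn_triangle[OF p]) auto
    then show "\<exists>i. p (from_nat_into L i - y) < e"
      using u(2) w(2) by (intro exI[of _ i]) (simp add: i)
  qed
qed

context lcs_family
begin

definition sum_operator :: "(nat \<Rightarrow> nat \<Rightarrow> nat \<Rightarrow>\<^sub>0 'a) \<Rightarrow> (nat \<Rightarrow> nat \<Rightarrow> 'a \<Rightarrow> 'k) \<Rightarrow> (nat \<Rightarrow>\<^sub>0 'a) \<Rightarrow> (nat \<Rightarrow>\<^sub>0 'a)" where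
  "sum_operator v f y = (\<Sum>n\<in>Poly_Mapping.keys y. Sum.l1_sum (v n) (\<lambda>k. f n k (lookup y n)))"

text \<open>On the summand \<open>n\<close> a continuous seminorm of the image is at most
  \<open>2 * B * p n x\<close>, where \<open>B\<close> bounds that seminorm on \<open>v n\<close>
  and 2 is the sum of the geometric series. Nothing relates the bounds for different
  \<open>n\<close>, so the sequences \<open>v n\<close> may grow with \<open>n\<close> at
  will.\<close>

lemma sum_operator_properties:
  assumes v: "\<And>n. l1_conv ssmul Sum_topology (v n)"
    and p: "\<And>n. cont_seminorm smul (X n) (p n)"
    and lin: "\<And>n k. linear_map_on (topspace (X n)) smul (*) (f n k)"
    and bound: "\<And>n k x. x \<in> topspace (X n) \<Longrightarrow> norm (f n k x) \<le> (1 / 2) ^ k * p n x"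
  shows sum_operator_single: "\<And>n x. x \<in> topspace (X n) \<Longrightarrow>
      sum_operator v f (single n x) = Sum.l1_sum (v n) (\<lambda>k. f n k x)"
    and sum_operator_linear: "linear_map_on Sum_carrier ssmul ssmul (sum_operator v f)"
    and sum_operator_continuous: "continuous_map Sum_topology Sum_topology (sum_operator v f)"
proof -
  let ?F = "\<lambda>n x. Sum.l1_sum (v n) (\<lambda>k. f n k x)"
  note fD = X.linear_map_onD[OF lin]
  have geo: "summable (\<lambda>k. (1 / 2 :: real) ^ k * r)" for r
    by (intro summable_mult2 summable_geometric) simp
  have summ: "summable (\<lambda>k. norm (f n k x))" if "x \<in> topspace (X n)" for n x
    by (rule summable_comparison_test'[OF geo[of "p n x"], of 0]) (use bound[OF that] in simp)
  have F0: "?F n 0 = 0" for n using fD(3) by (simp add: Sum.l1_sum_zero)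
  have Fadd: "?F n (x + y) = ?F n x + ?F n y" if "x \<in> topspace (X n)" "y \<in> topspace (X n)" for n x y
    using Sum.l1_sum_add[OF v summ summ, OF that] fD(1)[OF that] by simp
  have Fscale: "?F n (smul a x) = ssmul a (?F n x)" if "x \<in> topspace (X n)" for n a x
    using Sum.l1_sum_scale[OF v summ, OF that] fD(2)[OF that] by simp
  have FS: "?F n x \<in> Sum_carrier" if "x \<in> topspace (X n)" for n x
    using Sum.l1_sum_in_S[OF v summ[OF that]] by (simp only: topspace_Sum)
  have ext: "sum_operator v f y = (\<Sum>n\<in>N. ?F n (lookup y n))"
    if "finite N" "Poly_Mapping.keys y \<subseteq> N" for y N
    unfolding sum_operator_def using that
    by (intro sum.mono_neutral_left) (auto simp: F0 in_keys_iff)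
  show single: "sum_operator v f (single n x) = ?F n x" if "x \<in> topspace (X n)" for n x
    using ext[of "{n}" "single n x"] by (simp add: keys_single)
  show lin_op: "linear_map_on Sum_carrier ssmul ssmul (sum_operator v f)"
    unfolding linear_map_on_def
  proof (intro conjI ballI allI)
    fix x y assume x: "x \<in> Sum_carrier" and y: "y \<in> Sum_carrier"
    let ?N = "Poly_Mapping.keys x \<union> Poly_Mapping.keys y"
    have N: "finite ?N" by simp
    have "sum_operator v f (x + y) = (\<Sum>n\<in>?N. ?F n (lookup (x + y) n))"
      using N by (rule ext) (rule keys_add)
    also have "\<dots> = (\<Sum>n\<in>?N. ?F n (lookup x n)) + (\<Sum>n\<in>?N. ?F n (lookup y n))"
      unfolding lookup_add sum.distrib[symmetric]
      by (intro sum.cong Fadd lookup_in_topspace x y refl)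
    finally show "sum_operator v f (x + y) = sum_operator v f x + sum_operator v f y"
      using ext[OF N, of x] ext[OF N, of y] by simp
  next
    fix c x assume x: "x \<in> Sum_carrier"
    have "Poly_Mapping.keys (ssmul c x) \<subseteq> Poly_Mapping.keys x"
      by (auto simp: in_keys_iff)
    then have "sum_operator v f (ssmul c x) = (\<Sum>n\<in>Poly_Mapping.keys x. ?F n (lookup (ssmul c x) n))"
      by (intro ext) simp_all
    also have "\<dots> = (\<Sum>n\<in>Poly_Mapping.keys x. ssmul c (?F n (lookup x n)))"
      unfolding lookup_sum_smul by (intro sum.cong Fscale lookup_in_topspace x refl)
    finally show "sum_operator v f (ssmul c x) = ssmul c (sum_operator v f x)"
      unfolding sum_operator_def by (simp only: sum.scale_sum_right)
  qed
  have opS: "sum_operator v f y \<in> Sum_carrier" if "y \<in> Sum_carrier" for y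
    unfolding sum_operator_def
    by (intro sum.subspace_sum[OF subspace_carrier] FS lookup_in_topspace that)
  show "continuous_map Sum_topology Sum_topology (sum_operator v f)"
  proof (rule continuous_linear_mapI[OF Sum.lcs_axioms Sum.lcs_axioms])
    fix q assume q: "cont_seminorm ssmul Sum_topology q"
    have sq: "seminorm_on ssmul Sum_carrier q"
      using Sum.csn_seminorm[OF q] by (simp only: topspace_Sum)
    have "(\<lambda>y. q (sum_operator v f y)) \<in> Sum_seminorms"
      unfolding Sum_seminorms_def
    proof (intro CollectI conjI allI)
      show "seminorm_on ssmul Sum_carrier (\<lambda>y. q (sum_operator v f y))"
        using sq lin_op opS unfolding seminorm_on_def linear_map_on_def by simp
      fix n
      obtain B where B: "\<And>k. q (v n k) \<le> B" using Sum.l1_convD(2)[OF v q] by blast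
      have B0: "B \<ge> 0" using Sum.csn_nonneg[OF q Sum.l1_convD(1)[OF v]] B order_trans by metis
      show "cont_seminorm smul (X n) (\<lambda>x. q (sum_operator v f (single n x)))"
      proof (rule X.csn_dominated[OF _ p[of n], where C = "2 * B"])
        show "seminorm_on smul (topspace (X n)) (\<lambda>x. q (sum_operator v f (single n x)))"
          using sq Fadd Fscale FS unfolding seminorm_on_def
          by (simp add: single)
        fix x assume x: "x \<in> topspace (X n)"
        have "q (?F n x) \<le> B * suminf (\<lambda>k. norm (f n k x))"
          using v summ[OF x] q B by (rule Sum.csn_l1_sum_le)
        also have "\<dots> \<le> B * suminf (\<lambda>k. (1 / 2) ^ k * p n x)"
          using B0 by (intro mult_left_mono suminf_le bound[OF x] summ[OF x] geo)
        also have "suminf (\<lambda>k. (1 / 2 :: real) ^ k * p n x) = 2 * p n x"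
          by (subst suminf_mult2[symmetric]) (simp_all add: suminf_geometric summable_geometric)
        finally show "q (sum_operator v f (single n x)) \<le> 2 * B * p n x"
          by (simp add: single[OF x] mult_ac)
      qed
    qed
    then show "\<exists>p C. cont_seminorm ssmul Sum_topology p \<and>
        (\<forall>y\<in>topspace Sum_topology. q (sum_operator v f y) \<le> C * p y)"
      by (intro exI[of _ "\<lambda>y. q (sum_operator v f y)"] exI[of _ 1]) (simp add: cont_seminorm_Sum_iff)
  qed (simp_all only: topspace_Sum lin_op opS)
qed

text \<open>Supports are finite, so it suffices to approximate the components one at a time and to
  add.\<close>

lemma Sum_closure_of_span:
  assumes B: "\<And>n. B n \<subseteq> topspace (X n)"
    and dense: "\<And>n. X n closure_of (module.span smul (B n)) = topspace (X n)"
  shows "Sum_topology closure_of (sum.span (\<Union>n. single n ` B n)) = Sum_carrier"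
proof -
  let ?V = "sum.span (\<Union>n. single n ` B n)"
  have single: "single n x \<in> Sum_topology closure_of ?V" if x: "x \<in> topspace (X n)" for n x
  proof -
    have "single n ` module.span smul (B n) \<subseteq> ?V"
    proof
      fix z assume "z \<in> single n ` module.span smul (B n)"
      then obtain u where u: "u \<in> module.span smul (B n)" "z = single n u" by blast
      have "single n u \<in> ?V"
        using u(1)
      proof (induction rule: X.span_induct_alt)
        case (step c b u)
        have "single n b \<in> ?V" using step(1) by (intro sum.span_base) blast
        then show ?case unfolding single_add single_smul
          by (intro sum.span_add sum.span_scale step(2))
      qed (simp add: sum.span_zero)
      then show "z \<in> ?V" by (simp add: u(2))
    qed
    moreover have "single n x \<in> Sum_topology closure_of (single n ` module.span smul (B n))"
      using continuous_map_image_closure_subset[OF continuous_single, of n "module.span smul (B n)"] x dense[of n]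
      by blast
    ultimately show ?thesis using closure_of_mono by blast
  qed
  have "y \<in> Sum_topology closure_of ?V" if y: "y \<in> Sum_carrier" for y
  proof -
    have "(\<Sum>n\<in>N. single n (lookup y n)) \<in> Sum_topology closure_of ?V" if "finite N" for N
      using that
    proof (induction N rule: finite_induct)
      case empty
      show ?case using single[of 0 0] by simp
    next
      case (insert n N)
      then show ?case
        using Sum.closure_of_subspace_add[OF sum.subspace_span single[OF lookup_in_topspace[OF y]]] by simp
    qed
    from this[OF finite_keys] have
      "(\<Sum>n\<in>Poly_Mapping.keys y. single n (lookup y n)) \<in> Sum_topology closure_of ?V" .
    also have "(\<Sum>n\<in>Poly_Mapping.keys y. single n (lookup y n)) = y"
      by (rule poly_mapping_eqI) (simp add: lookup_sum lookup_single when_def in_keys_iff)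
    finally show ?thesis .
  qed
  then show ?thesis
    using closure_of_subset_topspace[of Sum_topology ?V] unfolding topspace_Sum by blast
qed

end

section \<open>Choice of targets and images, and assembly of the operator\<close>

theorem hypercyclic_lc_direct_sum:
  fixes smul :: "'k::{real_normed_field, banach, second_countable_topology} \<Rightarrow> 'a::ab_group_add \<Rightarrow> 'a"
  assumes M: "\<And>n. class_M smul (X n)" and sf: "supporting_functionals smul"
  shows "\<exists>A. hypercyclic_operator (sum_smul smul) (lc_direct_sum smul X) A"
proof -
  interpret lcs_family smul X
    using M by (simp add: lcs_family_def lcs_def class_M_def)
  have "\<forall>n. \<exists>p e f g. l1_system smul (X n) p e f g"
    using class_M_l1_system[OF M sf] by blast
  then obtain p e f g where sys: "\<And>n. l1_system smul (X n) (p n) (e n) (f n) (g n)" by metis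
  note sys = sys[unfolded l1_system_def]
  have p: "cont_seminorm smul (X n) (p n)" for n
    by (rule sys[THEN conjunct1])
  have el1: "l1_conv smul (X n) (e n)" for n
    by (rule sys[THEN conjunct2, THEN conjunct1, rule_format])
  have flin: "linear_map_on (topspace (X n)) smul (*) (f n k)" for n k
    by (rule sys[THEN conjunct2, THEN conjunct2, THEN conjunct1, rule_format])
  have fbound: "norm (f n k x) \<le> (1 / 2) ^ k * p n x" if "x \<in> topspace (X n)" for n k x
    using that by (rule sys[THEN conjunct2, THEN conjunct2, THEN conjunct2, THEN conjunct1, rule_format])
  have pe: "p n (e n k) \<le> 1" for n k
    by (rule sys[THEN conjunct2, THEN conjunct2, THEN conjunct2, THEN conjunct2, THEN conjunct1, rule_format])
  have fe: "f n k (e n j) \<noteq> 0 \<longleftrightarrow> j = k" for n j k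
    by (rule sys[THEN conjunct2, THEN conjunct2, THEN conjunct2, THEN conjunct2, THEN conjunct2, THEN conjunct1, rule_format])
  have "range (g n) \<subseteq> topspace (X n)" for n
    by (rule sys[THEN conjunct2, THEN conjunct2, THEN conjunct2, THEN conjunct2, THEN conjunct2, THEN conjunct2, THEN conjunct1, rule_format])
  then have gS: "g n k \<in> topspace (X n)" for n k by blast
  have fg: "f n k (g n j) = 0" for n j k
    by (rule sys[THEN conjunct2, THEN conjunct2, THEN conjunct2, THEN conjunct2, THEN conjunct2, THEN conjunct2, THEN conjunct2, THEN conjunct1, rule_format])
  have dense: "X n closure_of (module.span smul (range (e n) \<union> range (g n))) = topspace (X n)" for n
    by (rule sys[THEN conjunct2, THEN conjunct2, THEN conjunct2, THEN conjunct2, THEN conjunct2, THEN conjunct2, THEN conjunct2, THEN conjunct2, rule_format])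
  have eS: "e n k \<in> topspace (X n)" for n k by (rule X.l1_convD(1)[OF el1])

  define E where "E n k = single n (e n k)" for n k
  \<comment> \<open>These coefficients depend only on the biorthogonal systems, so the images chosen
    below may refer to them without circularity.\<close>
  define c where "c n k = f n k (e n k)" for n k
  define G where "G = (\<Union>n. single n ` range (g n))"
  \<comment> \<open>The vectors allowed in the \<open>m\<close>-th target. All summands occur at
    once; only the position is restricted.\<close>
  define W where "W m = {E n b | n b. b < 3 ^ m} \<union> G" for m :: nat
  define B where "B = (\<Union>n. single n ` (range (e n) \<union> range (g n)))"
  have E_S: "E n k \<in> Sum_carrier" for n k
    unfolding E_def by (rule single_in_carrier[OF eS])
  have G_S: "G \<subseteq> Sum_carrier"
    unfolding G_def using single_in_carrier[OF gS] by blast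
  have W_S: "sum.span (W m) \<subseteq> Sum_carrier" for m
    unfolding W_def using E_S G_S by (intro sum.span_minimal subspace_carrier) auto
  have B_eq: "B = range (\<lambda>(n, k). E n k) \<union> G"
    unfolding B_def G_def E_def by auto
  have "countable B" unfolding B_def by auto
  moreover have "B \<subseteq> topspace Sum_topology"
    unfolding B_eq topspace_Sum using E_S G_S by auto
  moreover have "Sum_topology closure_of sum.span B = topspace Sum_topology"
    unfolding B_def topspace_Sum using eS gS dense by (intro Sum_closure_of_span) auto
  ultimately obtain a :: "nat \<Rightarrow> nat \<Rightarrow>\<^sub>0 'a" where a: "\<And>i. a i \<in> sum.span B"
    "\<And>y q \<epsilon>. y \<in> topspace Sum_topology \<Longrightarrow> cont_seminorm ssmul Sum_topology q \<Longrightarrow> \<epsilon> > 0 \<Longrightarrow>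
      \<exists>i. q (a i - y) < \<epsilon>"
    using countable_dense_in_span[OF Sum.lcs_axioms, of B] by metis
  have W_mono: "sum.span (W m) \<subseteq> sum.span (W m')" if "m \<le> m'" for m m'
  proof (rule sum.span_mono)
    have "(3::nat) ^ m \<le> 3 ^ m'" using that by (rule power_increasing) simp
    then have "b < 3 ^ m'" if "b < 3 ^ m" for b :: nat using that by (rule less_le_trans[rotated])
    then show "W m \<subseteq> W m'" unfolding W_def by blast
  qed
  have ex_W: "\<exists>m. x \<in> sum.span (W m)" if "x \<in> sum.span B" for x
    using that
  proof (induction rule: sum.span_induct_alt)
    case base
    show ?case by (intro exI sum.span_zero)
  next
    case (step r b y)
    obtain m where m: "y \<in> sum.span (W m)" using step(2) by blast
    have "\<exists>m'. b \<in> W m'"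
    proof -
      consider n k where "b = E n k" | "b \<in> G" using step(1) unfolding B_eq by auto
      then show ?thesis
      proof cases
        case 1
        have "k < 3 ^ k" using less_exp[of k] power_mono[of 2 "3::nat" k] by linarith
        then have "b \<in> W k" using 1 unfolding W_def by blast
        then show ?thesis by blast
      qed (auto simp: W_def)
    qed
    then obtain m' where "b \<in> sum.span (W m')" using sum.span_base by blast
    then have "ssmul r b + y \<in> sum.span (W (max m m'))"
      using m W_mono[of m "max m m'"] W_mono[of m' "max m m'"]
      by (intro sum.span_add sum.span_scale) auto
    then show ?case by blast
  qed

  text \<open>Every \<open>a i\<close> is listed infinitely often, but replaced by 0 as long as it is not in the
    span of \<open>W m\<close>.\<close>
  define d where "d m = (let x = a (fst (prod_decode m)) in if x \<in> sum.span (W m) then x else 0)" for m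
  have d_span: "d m \<in> sum.span (W m)" for m
    by (simp add: d_def Let_def sum.span_zero)
  have d_dense: "\<exists>m\<ge>M. q (d m - y) < \<epsilon>"
    if y: "y \<in> topspace Sum_topology" and q: "cont_seminorm ssmul Sum_topology q" and \<epsilon>: "\<epsilon> > 0" for y q \<epsilon> M
  proof -
    obtain i where i: "q (a i - y) < \<epsilon>" using a(2)[OF y q \<epsilon>] by blast
    obtain m0 where m0: "a i \<in> sum.span (W m0)" using ex_W[OF a(1)] by blast
    \<comment> \<open>The second component of the pair only serves to make the code large.\<close>
    define m where "m = prod_encode (i, max M m0)"
    have "max M m0 \<le> m" unfolding m_def by (rule le_prod_encode_2)
    then have m: "M \<le> m" "m0 \<le> m" by auto
    have "a i \<in> sum.span (W m)" using m0 W_mono[OF m(2)] by blast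
    then have "d m = a i" by (simp add: d_def m_def)
    then show ?thesis using i m(1) by auto
  qed
  have d_S: "d m \<in> Sum_carrier" for m using d_span W_S by blast

  \<comment> \<open>The exponent is unique by injectivity of powers, so the choice operator recovers
    it.\<close>
  define D where "D k = (if \<exists>m. Suc k = 3 ^ Suc m then
      let m = SOME m. Suc k = 3 ^ Suc m in
        ssmul (inverse (of_real ((1 / 2) ^ 3 ^ m) * chain_weight c m)) (d m) else 0)" for k
  have D_chain: "D (3 ^ Suc m - 1) = ssmul (inverse (of_real ((1 / 2) ^ 3 ^ m) * chain_weight c m)) (d m)" for m
  proof -
    have *: "Suc (3 ^ Suc m - 1) = 3 ^ Suc j \<longleftrightarrow> j = m" for j :: nat
    proof -
      have "Suc (3 ^ Suc m - 1) = (3::nat) ^ Suc m" by simp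
      then show ?thesis by (simp only: power_inject_exp one_less_numeral_iff semiring_norm nat.inject) auto
    qed
    show ?thesis unfolding D_def Let_def * by (simp only: some_eq_trivial ex_simps simp_thms if_True)
  qed
  have D_S: "D k \<in> Sum_carrier" for k
    using sum.subspace_0[OF subspace_carrier] sum.subspace_scale[OF subspace_carrier d_S]
    by (simp add: D_def Let_def)

  \<comment> \<open>Images up to the factors \<open>c n k\<close>. For \<open>n \<ge> 1\<close> only
    the index \<open>n - 1\<close> carries a free vector, and smaller indices are sent to 0, so the
    sequence is \<open>l1_conv\<close> however large \<open>D (n - 1)\<close> is.\<close>
  define v where "v n = (if n = 0 then (\<lambda>k. if \<exists>m. Suc k = 3 ^ m then E 1 k else E 0 (Suc k))
      else (\<lambda>k. if n \<le> k then E (Suc n) k else if k = n - 1 then D (n - 1) else 0))" for n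
  have E_l1: "l1_conv ssmul Sum_topology (E n)" for n
    unfolding E_def using l1_conv_image[OF lcs Sum.lcs_axioms linear_single continuous_single el1] .
  have D_l1: "l1_conv ssmul Sum_topology (\<lambda>k. if k = j then D j else 0)" for j
    by (rule Sum.l1_conv_single) (simp only: topspace_Sum D_S)
  have v: "l1_conv ssmul Sum_topology (v n)" for n
  proof (cases "n = 0")
    case True
    then show ?thesis
      using Sum.l1_conv_if[OF E_l1[of 1] Sum.l1_conv_shift[OF E_l1[of 0]]] by (simp add: v_def)
  next
    case False
    then show ?thesis
      using Sum.l1_conv_if[OF E_l1[of "Suc n"] D_l1[of "n - 1"]] by (simp add: v_def)
  qed
  note op = v p flin fbound
  define A where "A = sum_operator v f"
  have A_E: "A (E n k) = ssmul (c n k) (v n k)" for n k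
  proof -
    \<comment> \<open>Biorthogonality leaves a single term of the series, so the image of
      \<open>E n k\<close> is read off directly.\<close>
    have "f n i (e n k) = (if i = k then c n k else 0)" for i
      using fe[of n i k] by (auto simp: c_def)
    then have "A (E n k) = Sum.l1_sum (v n) (\<lambda>i. if i = k then c n k else 0)"
      unfolding A_def E_def using sum_operator_single[OF op eS] by simp
    also have "\<dots> = ssmul (c n k) (v n k)"
      by (rule Sum.l1_sum_single[OF Sum.l1_convD(1)[OF v]])
    finally show ?thesis .
  qed
  have A_G: "A x = 0" if "x \<in> G" for x
  proof -
    obtain n j where "x = single n (g n j)" using \<open>x \<in> G\<close> unfolding G_def by blast
    then show ?thesis
      unfolding A_def using sum_operator_single[OF op gS] by (simp add: fg Sum.l1_sum_zero)
  qed
  have lin_A: "linear_map_on (topspace Sum_topology) ssmul ssmul A"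
    unfolding A_def topspace_Sum by (rule sum_operator_linear[OF op])
  have cont_A: "continuous_map Sum_topology Sum_topology A"
    unfolding A_def by (rule sum_operator_continuous[OF op])
  have "chain_operator ssmul Sum_topology A E c G D d"
  proof
    show "norm (c n k) \<le> 1" for n k
    proof -
      have "norm (c n k) \<le> (1 / 2) ^ k * p n (e n k)" unfolding c_def by (rule fbound[OF eS])
      also have "\<dots> \<le> 1 * 1"
        using pe X.csn_nonneg[OF p eS] by (intro mult_mono) (auto simp: power_le_one)
      finally show ?thesis by simp
    qed
    show "c n k \<noteq> 0" for n k unfolding c_def using fe by blast
    show "A (E 0 k) = ssmul (c 0 k) (if \<exists>m. Suc k = 3 ^ m then E 1 k else E 0 (Suc k))" for k
      unfolding A_E by (simp add: v_def)
    show "A (E n k) = ssmul (c n k) (E (Suc n) k)" if "1 \<le> n" "n \<le> k" for n k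
      unfolding A_E using that by (simp add: v_def)
    show "A (E (Suc k) k) = ssmul (c (Suc k) k) (D k)" for k
      unfolding A_E by (simp add: v_def)
    show "A (E n k) = 0" if "n > Suc k" for n k
    proof -
      have "n \<noteq> 0" "\<not> n \<le> k" "k \<noteq> n - 1" using that by auto
      then show ?thesis unfolding A_E by (simp add: v_def)
    qed
    show "D k = 0" if "\<nexists>m. Suc k = 3 ^ Suc m" for k
      unfolding D_def using that by (simp only: if_False)
    show "d m \<in> sum.span ({E n b |n b. b < 3 ^ m} \<union> G)" for m
      using d_span by (simp only: W_def)
    show "E n k \<in> topspace Sum_topology" for n k by (simp only: topspace_Sum E_S)
    show "G \<subseteq> topspace Sum_topology" by (simp only: topspace_Sum G_S)
  qed (fact lin_A cont_A E_l1 A_G D_chain d_dense)+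
  then have "\<exists>x\<in>topspace Sum_topology. Sum_topology closure_of {(A ^^ k) x | k. True} = topspace Sum_topology"
    by (rule chain_operator.hypercyclic)
  then show ?thesis
    unfolding lc_direct_sum_eq hypercyclic_operator_def using lin_A cont_A by blast
qed

lemma class_M_vector_space: "class_M smul T \<Longrightarrow> vector_space smul"
  by (simp add: class_M_def locally_convex_space_def topological_vector_space_def)

theorem theorem1p14:
  fixes smulR :: "real \<Rightarrow> 'a::ab_group_add \<Rightarrow> 'a" and XR :: "nat \<Rightarrow> 'a topology"
    and smulC :: "complex \<Rightarrow> 'b::ab_group_add \<Rightarrow> 'b" and XC :: "nat \<Rightarrow> 'b topology"
  shows "((\<forall>n. class_M smulR (XR n)) \<longrightarrow>
            (\<exists>T. hypercyclic_operator (sum_smul smulR) (lc_direct_sum smulR XR) T)) \<and>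
         ((\<forall>n. class_M smulC (XC n)) \<longrightarrow>
            (\<exists>T. hypercyclic_operator (sum_smul smulC) (lc_direct_sum smulC XC) T))"
proof (intro conjI impI)
  show "\<exists>T. hypercyclic_operator (sum_smul smulR) (lc_direct_sum smulR XR) T"
    if "\<forall>n. class_M smulR (XR n)"
    using that by (intro hypercyclic_lc_direct_sum supporting_functionals_real) (auto intro: class_M_vector_space)
  show "\<exists>T. hypercyclic_operator (sum_smul smulC) (lc_direct_sum smulC XC) T"
    if "\<forall>n. class_M smulC (XC n)"
    using that by (intro hypercyclic_lc_direct_sum supporting_functionals_complex) (auto intro: class_M_vector_space)
qed

end
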